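(* Let $\mathbf{C}^-:=\inf_{F\in\mathcal{H}_{\pi\Delta},F\ne0}\|F\|_{L^2(\mathbb{R},W)}/\|F\|_{L^2(\mathbb{R})}$ and $\mathbf{C}^+:=\sup_{F\in\mathcal{H}_{\pi\Delta},F\ne0}\|F\|_{L^2(\mathbb{R},W)}/\|F\|_{L^2(\mathbb{R})}$, where $W(x)=1+\frac{\sin 2\pi x}{2\pi x}$. (i) For $0<\Delta\le1$: $\mathbf{C}^-=1$ and $\mathbf{C}^+=\sqrt{1+\frac{\Delta}{2}}$. (ii) For $1<\Delta\le2$, let $\eta^+$ and $\eta^-$ be the largest and the smallest real solutions $\eta$ of \[ \left(\tfrac{1}{2}+\tfrac{2-\Delta}{4\eta}\right)\cos\left(\tfrac{\Delta-1}{2\eta}\right)+\sin\left(\tfrac{\Delta-1}{2\eta}\right) = 1. \] Then $\mathbf{C}^-=\sqrt{1+\eta^-}$ and $\mathbf{C}^+=\sqrt{1+\eta^+}$.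
   Context: $\mathcal{H}_{\pi\Delta}$ is the space of entire functions of exponential type at most $\pi\Delta$ that are square-integrable on $\mathbb{R}$; $\|F\|^2_{L^2(\mathbb{R},W)}=\int_{\mathbb{R}}|F(x)|^2W(x)\,dx$. *)

theory Defs
  imports "HOL-Analysis.Analysis"
begin

definition exp_type_le :: "(complex \<Rightarrow> complex) \<Rightarrow> real \<Rightarrow> bool" where
  "exp_type_le F \<tau> \<longleftrightarrow> (\<forall>\<epsilon>>0. \<exists>C. \<forall>z. norm (F z) \<le> C * exp ((\<tau> + \<epsilon>) * norm z))"

definition PW :: "real \<Rightarrow> (complex \<Rightarrow> complex) set" where
  "PW \<tau> = {F. F holomorphic_on UNIV \<and> exp_type_le F \<tau> \<and>
              integrable lborel (\<lambda>x::real. (norm (F (complex_of_real x)))\<^sup>2)}"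

text \<open>The weight W(x) = 1 + sin(2 pi x)/(2 pi x), with its continuous value 2 at x = 0.\<close>
definition W :: "real \<Rightarrow> real" where
  "W x = (if x = 0 then 2 else 1 + sin (2 * pi * x) / (2 * pi * x))"

definition L2norm :: "(complex \<Rightarrow> complex) \<Rightarrow> real" where
  "L2norm F = sqrt (\<integral>x. (norm (F (complex_of_real x)))\<^sup>2 \<partial>lborel)"

definition L2normW :: "(complex \<Rightarrow> complex) \<Rightarrow> real" where
  "L2normW F = sqrt (\<integral>x. (norm (F (complex_of_real x)))\<^sup>2 * W x \<partial>lborel)"

definition ratios :: "real \<Rightarrow> real set" where
  "ratios \<Delta> = {L2normW F / L2norm F | F. F \<in> PW (pi * \<Delta>) \<and> F \<noteq> (\<lambda>z. 0)}"

definition C_minus :: "real \<Rightarrow> real" where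
  "C_minus \<Delta> = Inf (ratios \<Delta>)"

definition C_plus :: "real \<Rightarrow> real" where
  "C_plus \<Delta> = Sup (ratios \<Delta>)"

definition eta_eq :: "real \<Rightarrow> real \<Rightarrow> bool" where
  "eta_eq \<Delta> \<eta> \<longleftrightarrow> \<eta> \<noteq> 0 \<and>
     (1/2 + (2 - \<Delta>) / (4 * \<eta>)) * cos ((\<Delta> - 1) / (2 * \<eta>)) + sin ((\<Delta> - 1) / (2 * \<eta>)) = 1"

end

theory Submission
  imports Defs "HOL-Complex_Analysis.Complex_Analysis" "HOL-Probability.Probability"
begin

text \<open>
  A function \<open>F\<close> of exponential type \<open>\<pi>\<Delta>\<close> in \<open>L\<^sup>2\<close> is the Fourier transform of a function \<open>f\<close> supported in
  \<open>[-a, a]\<close> with \<open>a = \<Delta>/2\<close>, and \<open>sin (2\<pi>x) / (2\<pi>x)\<close> is the transform of half the indicator of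
  \<open>[-1, 1]\<close>. So \<open>\<parallel>F\<parallel>\<^sup>2 = \<parallel>f\<parallel>\<^sup>2\<close> and the weighted norm squared is \<open>\<parallel>f\<parallel>\<^sup>2 + \<langle>T f, f\<rangle>\<close>, where \<open>T\<close> is the
  integral operator on \<open>[-a, a]\<close> with kernel one half on \<open>\<bar>s - t\<bar> \<le> 1\<close>. The extreme values of its
  quadratic form are eigenvalues by compactness. For \<open>\<Delta> \<le> 1\<close> the operator has rank one. For
  \<open>1 < \<Delta> \<le> 2\<close> an eigenfunction \<open>h\<close> with eigenvalue \<open>\<eta>\<close> is constant on \<open>[a - 1, 1 - a]\<close>, and
  \<open>(h (s + 1/2), h (s - 1/2))\<close> rotates with angular speed \<open>1/(2\<eta>)\<close>; matching at the end points gives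
  the transcendental equation.

  The Paley-Wiener theorem is only needed for functions with some decay: \<open>F\<close> is replaced by
  \<open>F ((1 - \<delta>) z) sinc (\<delta>\<tau>z/4)\<^sup>4\<close>, which has the same type \<open>\<tau>\<close>. To bound \<open>F\<close> itself, the
  Phragmen-Lindelof principle is applied to a primitive of \<open>F\<close>, which grows at most linearly on the
  real line because \<open>F\<close> is square integrable.
\<close>

section \<open>The Phragmen-Lindelof principle in a quadrant\<close>

text \<open>The form problem is posed on functions that are continuous on \<open>[- a, a]\<close>
  and zero outside (\<open>supp_cont\<close>). This class is not complete, but it contains the
  transforms of all damped functions, and \<open>Top\<close> maps it into itself with a Hoelder
  bound, so eigenfunctions can be found inside it. A maximising sequence is not expected to
  converge; its image under \<open>Top\<close> has a uniformly convergent subsequence, and the limit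
  is the eigenfunction. This works only for a nonzero extreme value, so for
  \<open>\<Delta> > 1\<close> the form must be seen to take both signs; two explicit solutions of
  the equation supply them. For \<open>\<Delta> \<le> 1\<close> the lower value is 0, and it is
  attained on the kernel of the rank-one operator. The transfer to entire functions is asymmetric:
  bounds for all \<open>F\<close> come from damped functions in the limit, while attainment starts
  from a function on the interval and extends its transform to the plane.\<close>

lemma Re_csqrt_cube_ge:
  assumes "\<bar>Im w\<bar> \<le> Re w"
  shows "Re (csqrt w ^ 3) \<ge> cmod (csqrt w) ^ 3 / 5"
proof -
  define p q where "p = Re (csqrt w)" and "q = \<bar>Im (csqrt w)\<bar>"
  have p: "p \<ge> 0" and q: "q \<ge> 0"
    using csqrt_principal[of w] unfolding p_def q_def by auto
  have w: "w = csqrt w ^ 2" by simp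
  have "Re w = p\<^sup>2 - q\<^sup>2"
    unfolding p_def q_def by (subst w) (simp only: Re_power2 power2_abs)
  moreover have "\<bar>Im w\<bar> = 2 * p * q"
    using p unfolding p_def q_def by (subst w) (simp only: Im_power2 abs_mult abs_of_nonneg abs_numeral)
  ultimately have pq: "2 * p * q \<le> p\<^sup>2 - q\<^sup>2" using assms by simp
  \<comment> \<open>The square root lies in the sector \<open>|arg| <= pi / 8\<close>, and
    \<open>tan (pi / 8) < 1 / 2\<close>. Hence \<open>5 * q^2 <= p^2\<close>, and
    \<open>p^2 - 3 * q^2\<close> keeps at least 2/5 of \<open>p^2\<close>: the cube has argument at
    most \<open>3 * pi / 8\<close>, away from the imaginary axis.\<close>
  have qp: "2 * q \<le> p"
  proof (rule ccontr)
    assume "\<not> 2 * q \<le> p"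
    then have "p * p \<le> p * (2 * q)" "q > 0" using p by (auto intro: mult_left_mono)
    then have "p * p \<le> 2 * (p * q)" "q * q > 0" by auto
    then show False using pq by (simp add: power2_eq_square mult.assoc)
  qed
  then have "2 * q * (2 * q) \<le> p * (2 * q)" using q by (intro mult_right_mono) auto
  then have q2: "5 * q\<^sup>2 \<le> p\<^sup>2" using pq by (simp add: power2_eq_square)
  have re: "Re (csqrt w ^ 3) = p * (p\<^sup>2 - 3 * q\<^sup>2)"
    unfolding p_def q_def by (simp add: power3_eq_cube power2_eq_square algebra_simps)
  have "p * (2 / 5 * p\<^sup>2) \<le> Re (csqrt w ^ 3)"
    unfolding re using p q2 by (intro mult_left_mono) auto
  moreover have "cmod (csqrt w) \<le> 6 / 5 * p"
  proof (rule power2_le_imp_le)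
    have "(cmod (csqrt w))\<^sup>2 = p\<^sup>2 + q\<^sup>2" unfolding p_def q_def by (simp only: cmod_power2 power2_abs)
    then show "(cmod (csqrt w))\<^sup>2 \<le> (6 / 5 * p)\<^sup>2"
      using q2 by (simp add: power_mult_distrib power_divide) (smt (verit) zero_le_power2)
  qed (use p in simp)
  then have "cmod (csqrt w) ^ 3 \<le> (6 / 5 * p) ^ 3" by (intro power_mono) auto
  moreover have "(6 / 5 * p) ^ 3 / 5 \<le> p * (2 / 5 * p\<^sup>2)"
    using p by (simp add: power3_eq_cube power2_eq_square)
  ultimately show ?thesis by linarith
qed

text \<open>Maximum modulus principle on large quarter discs for \<open>H\<close> times
  \<open>exp (- d * s z ^ 3)\<close>. The exponent has order 3/2: more than the order 1 of
  \<open>H\<close>, so the arc is harmless, and less than the critical order 2 of a quadrant, so its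
  real part can stay positive. Letting \<open>d\<close> tend to 0 removes the factor.\<close>

lemma phragmen_lindelof_quadrant:
  fixes H :: "complex \<Rightarrow> complex"
  assumes hol: "H holomorphic_on S" and S: "open S" "{z. 0 \<le> Re z \<and> 0 \<le> Im z} \<subseteq> S"
    and growth: "\<And>z. 0 \<le> Re z \<Longrightarrow> 0 \<le> Im z \<Longrightarrow> cmod (H z) \<le> A * exp (B * cmod z)"
    and bdry: "\<And>z. 0 \<le> Re z \<Longrightarrow> 0 \<le> Im z \<Longrightarrow> Re z = 0 \<or> Im z = 0 \<Longrightarrow> cmod (H z) \<le> M"
    and M: "M > 0" and z: "0 \<le> Re z" "0 \<le> Im z"
  shows "cmod (H z) \<le> M"
proof -
  define q where "q = {z. 0 \<le> Re z \<and> 0 \<le> Im z}"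
  (* w maps the quadrant into the sector |arg w| <= pi/4, where exp (- d w^(3/2)) beats every exp (B |z|). *)
  define w where "w z = 1 + (1 - \<i>) * z" for z
  define s where "s z = csqrt (w z)" for z
  have w: "\<bar>Im (w z)\<bar> \<le> Re (w z)" "cmod z \<le> cmod (w z)" "w z \<notin> \<real>\<^sub>\<le>\<^sub>0" if "z \<in> q" for z
  proof -
    show "\<bar>Im (w z)\<bar> \<le> Re (w z)" using that unfolding q_def w_def by auto
    have "cmod z \<le> \<bar>Re z\<bar> + \<bar>Im z\<bar>" by (rule cmod_le)
    also have "\<dots> \<le> Re (w z)" using that unfolding q_def w_def by auto
    also have "\<dots> \<le> cmod (w z)" by (rule complex_Re_le_cmod)
    finally show "cmod z \<le> cmod (w z)" .
    have "Re (w z) > 0" using that unfolding q_def w_def by auto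
    then show "w z \<notin> \<real>\<^sub>\<le>\<^sub>0" by (auto simp: complex_nonpos_Reals_iff)
  qed
  have Re_s: "Re (s z ^ 3) \<ge> cmod z * sqrt (cmod z) / 5" if "z \<in> q" for z
  proof -
    have c: "cmod (s z) = sqrt (cmod (w z))"
      unfolding s_def by (simp add: norm_csqrt)
    have "cmod z * sqrt (cmod z) \<le> cmod (w z) * sqrt (cmod (w z))"
      using w(2)[OF that] by (intro mult_mono) auto
    also have "\<dots> = cmod (s z) ^ 3" unfolding c by (simp add: power3_eq_cube)
    finally show ?thesis using Re_csqrt_cube_ge[OF w(1)[OF that]] unfolding s_def by simp
  qed
  have A: "A \<ge> 0"
  proof -
    have "0 \<le> cmod (H 0)" by simp
    also have "\<dots> \<le> A" using growth[of 0] by simp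
    finally show ?thesis .
  qed
  have damp: "cmod (H z) \<le> M * exp (d * Re (s z ^ 3))" if d: "d > 0" for d
  proof -
    define K where "K z = H z * exp (- of_real d * s z ^ 3)" for z
    \<comment> \<open>\<open>R\<close> is taken so large that the bound on the arc
      \<open>cmod z = R\<close> drops to \<open>M\<close> as well; \<open>A + 1\<close> keeps the
      logarithm meaningful when \<open>A = 0\<close>.\<close>
    have "filterlim (\<lambda>R::real. B * R - d * (R * sqrt R / 5)) at_bot at_top"
      using d by real_asymp
    then have "\<forall>\<^sub>F R in at_top. B * R - d * (R * sqrt R / 5) \<le> ln (M / (A + 1))"
      by (simp add: filterlim_at_bot)
    then have "\<forall>\<^sub>F R in at_top. B * R - d * (R * sqrt R / 5) \<le> ln (M / (A + 1)) \<and> R \<ge> cmod z"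
      using eventually_ge_at_top by (intro eventually_conj)
    then obtain R where R: "B * R - d * (R * sqrt R / 5) \<le> ln (M / (A + 1))" "R \<ge> cmod z"
      by (auto simp: eventually_at_top_linorder)
    define D where "D = q \<inter> cball 0 R"
    have clq: "closed q" unfolding q_def
      by (intro closed_Collect_conj closed_Collect_le continuous_intros)
    then have cl: "closed D" unfolding D_def by auto
    have hol': "H holomorphic_on q" using holomorphic_on_subset[OF hol S(2)] unfolding q_def .
    have holK: "K holomorphic_on q"
      unfolding K_def s_def w_def using w(3)
      by (intro holomorphic_intros hol') (auto simp: w_def)
    have nK: "cmod (K z) = cmod (H z) * exp (- d * Re (s z ^ 3))" for z
      unfolding K_def by (simp add: norm_mult)
    have "cmod (K z) \<le> M"
    proof (rule maximum_modulus_frontier[where f = K and S = D])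
      show "K holomorphic_on interior D"
        using interior_subset by (intro holomorphic_on_subset[OF holK]) (auto simp: D_def)
      show "continuous_on (closure D) K"
        using cl by (intro holomorphic_on_imp_continuous_on holomorphic_on_subset[OF holK])
          (auto simp: D_def)
      show "bounded D" unfolding D_def by (intro bounded_Int) auto
      show "z \<in> D" using z R unfolding D_def q_def by auto
    next
      fix \<xi> assume "\<xi> \<in> frontier D"
      then have \<xi>: "\<xi> \<in> D" "\<xi> \<notin> interior D" using cl by (auto simp: frontier_def)
      then have \<xi>q: "\<xi> \<in> q" "0 \<le> Re \<xi>" "0 \<le> Im \<xi>" by (auto simp: D_def q_def)
      have ex: "exp (- d * Re (s \<xi> ^ 3)) \<le> 1"
      proof -
        have "0 \<le> cmod \<xi> * sqrt (cmod \<xi>) / 5" by simp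
        also note Re_s[OF \<xi>q(1)]
        finally show ?thesis using d by simp
      qed
      consider "Re \<xi> = 0 \<or> Im \<xi> = 0" | "cmod \<xi> = R" "Re \<xi> \<noteq> 0" "Im \<xi> \<noteq> 0"
      proof (cases "cmod \<xi> = R \<or> Re \<xi> = 0 \<or> Im \<xi> = 0")
        case False
        then have "\<xi> \<in> {z. 0 < Re z} \<inter> {z. 0 < Im z} \<inter> ball 0 R"
          using \<xi> \<xi>q by (auto simp: D_def)
        moreover have "open ({z. 0 < Re z} \<inter> {z. 0 < Im z} \<inter> ball 0 R)"
          by (intro open_Int open_Collect_less continuous_intros) auto
        moreover have "{z. 0 < Re z} \<inter> {z. 0 < Im z} \<inter> ball 0 R \<subseteq> D"
          by (auto simp: D_def q_def)
        ultimately have "\<xi> \<in> interior D" by (meson interiorI)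
        with \<xi> show ?thesis by simp
      qed (use that in auto)
      then show "cmod (K \<xi>) \<le> M"
      proof cases
        case 1
        have "cmod (K \<xi>) \<le> M * 1"
          unfolding nK using bdry[OF \<xi>q(2,3) 1] ex M by (intro mult_mono) auto
        then show ?thesis by simp
      next
        case 2
        have "cmod (K \<xi>) \<le> (A * exp (B * R)) * exp (- d * (R * sqrt R / 5))"
          unfolding nK using growth[OF \<xi>q(2,3)] Re_s[OF \<xi>q(1)] 2 d A by (intro mult_mono) auto
        also have "\<dots> = A * exp (B * R - d * (R * sqrt R / 5))"
          by (simp add: mult.assoc flip: exp_add)
        also have "\<dots> \<le> (A + 1) * exp (ln (M / (A + 1)))"
          using R A by (intro mult_mono) auto
        also have "\<dots> = M" using A M by simp
        finally show ?thesis .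
      qed
    qed
    then show ?thesis unfolding nK by (simp add: exp_minus field_simps)
  qed
  have "((\<lambda>d. M * exp (d * Re (s z ^ 3))) \<longlongrightarrow> M * exp (0 * Re (s z ^ 3))) (at_right 0)"
    by (intro tendsto_intros)
  then have "cmod (H z) \<le> M * exp (0 * Re (s z ^ 3))"
    by (rule tendsto_lowerbound)
      (use damp in \<open>auto simp: eventually_at_filter trivial_limit_at_right_real\<close>)
  then show ?thesis by simp
qed

text \<open>On the imaginary axis \<open>exp (\<i> * \<sigma> * z)\<close> cancels the exponential
  growth, on the real axis it has modulus 1, and division by \<open>z + \<i>\<close>, whose zero
  lies outside the quadrant, absorbs the linear growth. So the quotient \<open>H\<close> is bounded
  on the boundary.\<close>

lemma quadrant_growth:
  fixes P :: "complex \<Rightarrow> complex"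
  assumes hol: "P holomorphic_on UNIV" and \<sigma>: "\<sigma> \<ge> 0"
    and growth: "\<And>z. cmod (P z) \<le> C * exp (\<sigma> * cmod z)"
    and real_bd: "\<And>x. cmod (P (of_real x)) \<le> D * (1 + \<bar>x\<bar>)"
    and z: "0 \<le> Re z" "0 \<le> Im z"
  shows "cmod (P z) \<le> (2 * D + C + 1) * (1 + cmod z) * exp (\<sigma> * Im z)"
proof -
  have C: "C \<ge> 0" using order.trans[OF norm_ge_zero growth[of 0]] by simp
  have D: "D \<ge> 0" using order.trans[OF norm_ge_zero real_bd[of 0]] by simp
  define H where "H z = P z * exp (\<i> * of_real \<sigma> * z) / (z + \<i>)" for z
  have low: "1 + cmod z \<le> 2 * cmod (z + \<i>)" "1 \<le> cmod (z + \<i>)"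
    if "0 \<le> Re z" "0 \<le> Im z" for z
  proof -
    have e: "(cmod (z + \<i>))\<^sup>2 = (cmod z)\<^sup>2 + 2 * Im z + 1"
      unfolding cmod_power2 by (simp add: power2_eq_square algebra_simps)
    show "1 + cmod z \<le> 2 * cmod (z + \<i>)"
    proof (rule power2_le_imp_le)
      have "0 \<le> (cmod z - 1)\<^sup>2" by simp
      then have "(1 + cmod z)\<^sup>2 \<le> 2 * ((cmod z)\<^sup>2 + 1)"
        by (simp add: power2_eq_square algebra_simps)
      also have "\<dots> \<le> 4 * ((cmod z)\<^sup>2 + 2 * Im z + 1)"
        using that(2) by (simp add: algebra_simps)
      finally have "(1 + cmod z)\<^sup>2 \<le> 4 * ((cmod z)\<^sup>2 + 2 * Im z + 1)" .
      then show "(1 + cmod z)\<^sup>2 \<le> (2 * cmod (z + \<i>))\<^sup>2"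
        by (simp add: power_mult_distrib e)
    qed auto
    show "1 \<le> cmod (z + \<i>)"
      by (rule power2_le_imp_le) (use that in \<open>auto simp: e\<close>)
  qed
  have nexp: "cmod (exp (\<i> * of_real \<sigma> * z)) = exp (- \<sigma> * Im z)" for z by simp
  have "cmod (H z) \<le> 2 * D + C + 1"
  proof (rule phragmen_lindelof_quadrant[where H = H and S = "- {- \<i>}" and B = \<sigma> and A = C])
    show "H holomorphic_on - {- \<i>}"
      unfolding H_def
      by (intro holomorphic_intros holomorphic_on_subset[OF hol]) (auto simp: add_eq_0_iff2)
  next
    fix z :: complex assume z: "0 \<le> Re z" "0 \<le> Im z"
    have "cmod (H z) \<le> C * exp (\<sigma> * cmod z) * 1 / 1"
      unfolding H_def norm_divide norm_mult nexp using growth[of z] low[OF z] z \<sigma> C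
      by (intro frac_le mult_mono) auto
    then show "cmod (H z) \<le> C * exp (\<sigma> * cmod z)" by simp
  next
    fix z :: complex assume z: "0 \<le> Re z" "0 \<le> Im z" "Re z = 0 \<or> Im z = 0"
    show "cmod (H z) \<le> 2 * D + C + 1"
    proof (cases "Re z = 0")
      case True
      then have "cmod z = Im z" using z by (simp add: cmod_def)
      then have "cmod (H z) \<le> C * exp (\<sigma> * Im z) * exp (- \<sigma> * Im z) / 1"
        unfolding H_def norm_divide norm_mult nexp using growth[of z] low[OF z(1,2)] C
        by (intro frac_le mult_mono) auto
      also have "\<dots> = C" by (simp add: exp_minus)
      finally show ?thesis using D by simp
    next
      case False
      then have i: "Im z = 0" using z by auto
      then have zr: "z = of_real (Re z)" "cmod z = \<bar>Re z\<bar>" by (auto simp: complex_eq_iff cmod_def)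
      have "cmod (P z) \<le> D * (1 + cmod z)" using real_bd[of "Re z"] zr by metis
      also have "\<dots> \<le> D * (2 * cmod (z + \<i>))" using low[OF z(1,2)] D by (intro mult_left_mono)
      finally have "cmod (H z) \<le> 2 * D"
        unfolding H_def norm_divide norm_mult nexp i using low(2)[OF z(1,2)]
        by (simp add: divide_le_eq D)
      then show ?thesis using C by simp
    qed
  qed (use z C D in auto)
  then have "cmod (P z) * exp (- \<sigma> * Im z) \<le> (2 * D + C + 1) * cmod (z + \<i>)"
    unfolding H_def norm_divide norm_mult nexp using low(2)[OF z]
    by (auto simp: divide_le_eq split: if_splits)
  also have "\<dots> \<le> (2 * D + C + 1) * (1 + cmod z)"
    using norm_triangle_ineq[of z \<i>] C D by (intro mult_left_mono) auto
  finally show ?thesis by (simp add: exp_minus field_simps)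
qed

text \<open>The reflections \<open>z\<close> to \<open>- z\<close> and \<open>z\<close> to
  \<open>- cnj z\<close> carry the other quadrants to the first one and preserve all hypotheses; the
  second is combined with a conjugation of the value to stay holomorphic.\<close>

lemma strip_growth:
  fixes P :: "complex \<Rightarrow> complex"
  assumes hol: "P holomorphic_on UNIV" and \<sigma>: "\<sigma> \<ge> 0"
    and growth: "\<And>z. cmod (P z) \<le> C * exp (\<sigma> * cmod z)"
    and real_bd: "\<And>x. cmod (P (of_real x)) \<le> D * (1 + \<bar>x\<bar>)"
  shows "cmod (P z) \<le> (2 * D + C + 1) * (1 + cmod z) * exp (\<sigma> * \<bar>Im z\<bar>)"
proof -
  have upper: "cmod (P z) \<le> (2 * D + C + 1) * (1 + cmod z) * exp (\<sigma> * Im z)"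
    if P: "P holomorphic_on UNIV" "\<And>z. cmod (P z) \<le> C * exp (\<sigma> * cmod z)"
      "\<And>x. cmod (P (of_real x)) \<le> D * (1 + \<bar>x\<bar>)" and z: "0 \<le> Im z"
    for P :: "complex \<Rightarrow> complex" and z
  proof (cases "0 \<le> Re z")
    case True
    then show ?thesis using quadrant_growth[OF P(1) \<sigma> P(2,3)] z by blast
  next
    case False
    define R where "R z = (cnj \<circ> (\<lambda>z. P (- z)) \<circ> cnj) z" for z
    have "(\<lambda>z. P (- z)) holomorphic_on UNIV"
      by (rule holomorphic_on_compose_gen[OF _ P(1), unfolded o_def]) (auto intro!: holomorphic_intros)
    then have "R holomorphic_on UNIV"
      unfolding R_def by (intro holomorphic_on_compose_cnj_cnj) (auto intro: holomorphic_on_subset)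
    moreover have "cmod (R z) \<le> C * exp (\<sigma> * cmod z)" for z
      using P(2)[of "- cnj z"] by (simp add: R_def)
    moreover have "cmod (R (of_real x)) \<le> D * (1 + \<bar>x\<bar>)" for x
      using P(3)[of "- x"] by (simp add: R_def)
    ultimately have "cmod (R (- cnj z)) \<le> (2 * D + C + 1) * (1 + cmod (- cnj z)) * exp (\<sigma> * Im (- cnj z))"
      using z False by (intro quadrant_growth \<sigma>) auto
    then show ?thesis by (simp add: R_def)
  qed
  show ?thesis
  proof (cases "0 \<le> Im z")
    case True
    then show ?thesis using upper[OF hol growth real_bd] by simp
  next
    case False
    have "(\<lambda>z. P (- z)) holomorphic_on UNIV"
      by (rule holomorphic_on_compose_gen[OF _ hol, unfolded o_def]) (auto intro!: holomorphic_intros)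
    moreover have "cmod (P (- z)) \<le> C * exp (\<sigma> * cmod z)" for z
      using growth[of "- z"] by simp
    moreover have "cmod (P (- of_real x)) \<le> D * (1 + \<bar>x\<bar>)" for x
      using real_bd[of "- x"] by simp
    ultimately have "cmod (P (- (- z))) \<le> (2 * D + C + 1) * (1 + cmod (- z)) * exp (\<sigma> * Im (- z))"
      using False by (intro upper) auto
    then show ?thesis using False by simp
  qed
qed

section \<open>Strip bounds for Paley-Wiener functions through a primitive\<close>

lemma entire_has_primitive:
  fixes F :: "complex \<Rightarrow> complex"
  assumes "F holomorphic_on UNIV"
  obtains P where "\<And>z. (P has_field_derivative F z) (at z)"
  by (rule holomorphic_convex_primitive'[of UNIV F]) (use assms that in auto)

lemma has_integral_primitive_horizontal:
  fixes P :: "complex \<Rightarrow> complex"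
  assumes P: "\<And>z. (P has_field_derivative F z) (at z)" and "u \<le> v"
  shows "((\<lambda>x. F (of_real x + c)) has_integral P (of_real v + c) - P (of_real u + c)) {u..v}"
proof (rule fundamental_theorem_of_calculus)
  fix x :: real
  have "((\<lambda>x. P (of_real x + c)) has_vector_derivative 1 * F (of_real x + c)) (at x within {u..v})"
    by (rule field_vector_diff_chain_within[unfolded o_def])
      (auto intro!: has_field_derivative_at_within[OF P] has_vector_derivative_add_const[THEN iffD2]
        has_vector_derivative_of_real[OF DERIV_ident, simplified])
  then show "((\<lambda>x. P (of_real x + c)) has_vector_derivative F (of_real x + c)) (at x within {u..v})"
    by simp
qed fact

text \<open>Square integrability bounds no single value of \<open>F\<close>, but
  \<open>t <= 1 + t^2\<close> with \<open>t = norm (F x)\<close> turns it into a bound for the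
  integral.\<close>

lemma primitive_real_bound:
  fixes F :: "complex \<Rightarrow> complex"
  assumes P: "\<And>z. (P has_field_derivative F z) (at z)" and "u \<le> v"
    and int: "integrable lborel (\<lambda>x::real. (norm (F (of_real x)))\<^sup>2)"
  shows "norm (P (of_real v) - P (of_real u)) \<le> (v - u) + (\<integral>x. (norm (F (of_real x)))\<^sup>2 \<partial>lborel)"
proof -
  have *: "((\<lambda>x. F (of_real x)) has_integral P (of_real v) - P (of_real u)) {u..v}"
    using has_integral_primitive_horizontal[OF P \<open>u \<le> v\<close>, of 0] by simp
  have si: "set_integrable lborel {u..v} (\<lambda>x. (norm (F (of_real x)))\<^sup>2)"
    using int unfolding set_integrable_def by (intro integrable_mult_indicator) auto
  then have h: "((\<lambda>x. (norm (F (of_real x)))\<^sup>2) has_integral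
      (LINT x:{u..v}|lborel. (norm (F (of_real x)))\<^sup>2)) {u..v}"
    using set_borel_integral_eq_integral[OF si] by (simp add: has_integral_integrable_integral)
  have **: "((\<lambda>x. 1 + (norm (F (of_real x)))\<^sup>2) has_integral
      ((v - u) + (LINT x:{u..v}|lborel. (norm (F (of_real x)))\<^sup>2))) {u..v}"
    using has_integral_add[OF has_integral_const_real[of 1 u v] h] \<open>u \<le> v\<close> by simp
  have "norm (integral {u..v} (\<lambda>x. F (of_real x))) \<le> integral {u..v} (\<lambda>x. 1 + (norm (F (of_real x)))\<^sup>2)"
    using has_integral_integrable[OF *] has_integral_integrable[OF **]
  proof (rule integral_norm_bound_integral)
    show "norm (F (of_real x)) \<le> 1 + (norm (F (of_real x)))\<^sup>2" if "x \<in> {u..v}" for x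
    proof -
      have "0 \<le> (norm (F (of_real x)) - 1)\<^sup>2" by simp
      then show ?thesis by (simp add: power2_eq_square algebra_simps) (smt (verit) norm_ge_zero zero_le_square)
    qed
  qed
  then have "norm (P (of_real v) - P (of_real u)) \<le>
      ((v - u) + (LINT x:{u..v}|lborel. (norm (F (of_real x)))\<^sup>2))"
    by (simp add: integral_unique[OF *] integral_unique[OF **])
  also have "(LINT x:{u..v}|lborel. (norm (F (of_real x)))\<^sup>2) \<le> (\<integral>x. (norm (F (of_real x)))\<^sup>2 \<partial>lborel)"
    unfolding set_lebesgue_integral_def using int si[unfolded set_integrable_def]
    by (intro integral_mono) (auto simp: indicator_def)
  finally show ?thesis by simp
qed

text \<open>\<open>strip_growth\<close> applies to the primitive; Cauchy's inequality on circles of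
  radius 1 brings the bound back to its derivative \<open>F\<close>, at the price of the factors 2
  and \<open>exp (\<tau> + \<epsilon>)\<close>.\<close>

lemma PW_strip_growth:
  assumes F: "F \<in> PW \<tau>" and \<tau>: "\<tau> \<ge> 0" and \<epsilon>: "\<epsilon> > 0"
  obtains M where "\<And>z. cmod (F z) \<le> M * (1 + cmod z) * exp ((\<tau> + \<epsilon>) * \<bar>Im z\<bar>)"
proof -
  have hol: "F holomorphic_on UNIV" and int: "integrable lborel (\<lambda>x::real. (norm (F (of_real x)))\<^sup>2)"
    and ty: "exp_type_le F \<tau>"
    using F by (auto simp: PW_def)
  obtain C where C: "\<And>z. cmod (F z) \<le> C * exp ((\<tau> + \<epsilon> / 2) * cmod z)"
    using ty \<epsilon> unfolding exp_type_le_def by (metis half_gt_zero)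
  have C0: "C \<ge> 0" using order.trans[OF norm_ge_zero C[of 0]] by simp
  obtain P where P: "\<And>z. (P has_field_derivative F z) (at z)"
    by (rule entire_has_primitive[OF hol]) blast
  define P0 where "P0 z = P z - P 0" for z
  have dP0: "(P0 has_field_derivative F z) (at z)" for z
    unfolding P0_def using DERIV_diff[OF P DERIV_const] by simp
  have holP: "P0 holomorphic_on UNIV"
    using dP0 by (auto simp: holomorphic_on_def field_differentiable_def)
  have gr: "cmod (P0 z) \<le> (2 * C / \<epsilon>) * exp ((\<tau> + \<epsilon>) * cmod z)" for z
  proof -
    have "cmod (P0 z - P0 0) \<le> (C * exp ((\<tau> + \<epsilon> / 2) * cmod z)) * cmod (z - 0)"
    proof (rule field_differentiable_bound[of "cball 0 (cmod z)"])
      fix w :: complex assume "w \<in> cball 0 (cmod z)"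
      then show "cmod (F w) \<le> C * exp ((\<tau> + \<epsilon> / 2) * cmod z)"
        using C0 \<tau> \<epsilon> by (intro order.trans[OF C]) (auto intro!: mult_left_mono)
    next
      show "(P0 has_field_derivative F w) (at w within cball 0 (cmod z))" for w :: complex
        by (rule has_field_derivative_at_within[OF dP0])
    qed auto
    \<comment> \<open>Integration costs a factor \<open>cmod z\<close>; the remaining half of
      \<open>\<epsilon>\<close> pays for it, since \<open>t <= exp t\<close>.\<close>
    also have "\<dots> = (2 * C / \<epsilon>) * exp ((\<tau> + \<epsilon> / 2) * cmod z) * (\<epsilon> / 2 * cmod z)" 
      using \<epsilon> by (simp add: field_simps)
    also have "\<dots> \<le> (2 * C / \<epsilon>) * exp ((\<tau> + \<epsilon> / 2) * cmod z) * exp (\<epsilon> / 2 * cmod z)"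
      using C0 \<epsilon> by (intro mult_left_mono order.trans[OF _ exp_ge_add_one_self]) auto
    also have "\<dots> = (2 * C / \<epsilon>) * exp ((\<tau> + \<epsilon>) * cmod z)"
      by (simp add: mult.assoc flip: exp_add) (simp add: algebra_simps)
    finally show ?thesis by (simp add: P0_def)
  qed
  define I where "I = (\<integral>x. (norm (F (of_real x)))\<^sup>2 \<partial>lborel)"
  have I0: "I \<ge> 0" unfolding I_def by simp
  have re: "cmod (P0 (of_real x)) \<le> (1 + I) * (1 + \<bar>x\<bar>)" for x
  proof -
    have "cmod (P0 (of_real x)) \<le> \<bar>x\<bar> + I"
      using primitive_real_bound[OF P _ int, of 0 x] primitive_real_bound[OF P _ int, of x 0]
      by (cases "x \<ge> 0") (auto simp: P0_def I_def norm_minus_commute)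
    also have "\<dots> \<le> (1 + I) * (1 + \<bar>x\<bar>)" using I0 by (simp add: algebra_simps)
    finally show ?thesis .
  qed
  define K where "K = 2 * (1 + I) + 2 * C / \<epsilon> + 1"
  have K0: "K \<ge> 0" unfolding K_def using I0 C0 \<epsilon> by (intro add_nonneg_nonneg) auto
  have st: "cmod (P0 z) \<le> K * (1 + cmod z) * exp ((\<tau> + \<epsilon>) * \<bar>Im z\<bar>)" for z
    unfolding K_def using \<tau> \<epsilon> by (intro strip_growth[OF holP _ gr re]) auto
  have "cmod (F z) \<le> (2 * K * exp (\<tau> + \<epsilon>)) * (1 + cmod z) * exp ((\<tau> + \<epsilon>) * \<bar>Im z\<bar>)" for z
  proof -
    have "cmod ((deriv ^^ 1) P0 z) \<le> fact 1 * (K * (2 * (1 + cmod z)) * exp ((\<tau> + \<epsilon>) * (\<bar>Im z\<bar> + 1))) / 1 ^ 1"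
    proof (rule Cauchy_inequality)
      show "P0 holomorphic_on ball z 1" using holP by (rule holomorphic_on_subset) auto
      show "continuous_on (cball z 1) P0" 
        using holP by (intro holomorphic_on_imp_continuous_on) (rule holomorphic_on_subset, auto)
      fix w assume w: "cmod (z - w) = 1"
      have "cmod w \<le> cmod z + 1" using w norm_triangle_ineq2[of w z] by (simp add: norm_minus_commute)
      then have "1 + cmod w \<le> 2 * (1 + cmod z)" using norm_ge_zero[of z] by argo
      moreover have "\<bar>Im w\<bar> \<le> \<bar>Im z\<bar> + 1" using w abs_Im_le_cmod[of "z - w"] by auto
      ultimately have "K * (1 + cmod w) * exp ((\<tau> + \<epsilon>) * \<bar>Im w\<bar>) \<le> 
          K * (2 * (1 + cmod z)) * exp ((\<tau> + \<epsilon>) * (\<bar>Im z\<bar> + 1))"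
        using K0 \<tau> \<epsilon> by (intro mult_mono) auto
      with st[of w] show "cmod (P0 w) \<le> K * (2 * (1 + cmod z)) * exp ((\<tau> + \<epsilon>) * (\<bar>Im z\<bar> + 1))"
        by linarith
    qed auto
    moreover have "(deriv ^^ 1) P0 z = F z" using DERIV_imp_deriv[OF dP0[of z]] by simp
    ultimately show ?thesis by (simp add: distrib_left exp_add mult_ac)
  qed
  then show thesis by (rule that)
qed

section \<open>Damping and the support of the Fourier transform\<close>

definition csinc :: "complex \<Rightarrow> complex" where
  "csinc z = (if z = 0 then 1 else sin z / z)"

text \<open>The singularity is removable: \<open>csinc\<close> is the difference quotient of
  \<open>sin\<close> at 0, completed by the derivative.\<close>

lemma csinc_holomorphic: "csinc holomorphic_on UNIV"
proof -
  have "deriv sin (0::complex) = 1"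
    by (rule DERIV_imp_deriv) (auto intro!: derivative_eq_intros)
  then have "csinc = (\<lambda>z. if z = 0 then deriv sin 0 else (sin z - sin 0) / (z - 0))"
    by (auto simp: csinc_def fun_eq_iff)
  then show ?thesis using pole_lemma[of sin UNIV 0] by (simp add: holomorphic_on_sin holomorphic_on_ident)
qed

lemma cmod_sin_le: "cmod (sin z) \<le> exp \<bar>Im z\<bar>"
proof -
  have "cmod (sin z) = cmod (exp (\<i> * z) - exp (- (\<i> * z))) / 2"
    by (simp add: sin_exp_eq norm_divide norm_mult)
  also have "\<dots> \<le> (cmod (exp (\<i> * z)) + cmod (exp (- (\<i> * z)))) / 2"
    by (intro divide_right_mono norm_triangle_ineq4) auto
  also have "\<dots> = (exp (- Im z) + exp (Im z)) / 2" by simp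
  also have "\<dots> \<le> (exp \<bar>Im z\<bar> + exp \<bar>Im z\<bar>) / 2"
    by (intro divide_right_mono add_mono) auto
  finally show ?thesis by simp
qed

text \<open>Near 0 by compactness, elsewhere from \<open>cmod_sin_le\<close>. The gained factor
  \<open>1 / (1 + cmod z)\<close> is the decay on which the damping rests.\<close>

lemma csinc_bound:
  obtains K where "K \<ge> 0" "\<And>z. cmod (csinc z) \<le> K * exp \<bar>Im z\<bar> / (1 + cmod z)"
proof -
  have "compact (csinc ` cball 0 1)"
    using csinc_holomorphic
    by (intro compact_continuous_image holomorphic_on_imp_continuous_on) (auto intro: holomorphic_on_subset)
  then have "bounded (csinc ` cball 0 1)" by (rule compact_imp_bounded)
  then obtain B where B: "\<And>z. z \<in> cball 0 1 \<Longrightarrow> cmod (csinc z) \<le> B"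
    unfolding bounded_iff by (metis imageI)
  define K where "K = 2 * B + 2"
  have B0: "B \<ge> 0" using B[of 0] by (simp add: csinc_def)
  show thesis
  proof (rule that)
    show "K \<ge> 0" using B0 by (simp add: K_def)
    fix z
    have pos: "1 + cmod z > 0" by (simp add: add_pos_nonneg)
    have "cmod (csinc z) * (1 + cmod z) \<le> K * exp \<bar>Im z\<bar>"
    proof (cases "cmod z \<le> 1")
      case True
      then have "cmod (csinc z) * (1 + cmod z) \<le> B * 2"
        using B0 B[of z] by (intro mult_mono) auto
      also have "\<dots> \<le> K * 1" by (simp add: K_def)
      also have "\<dots> \<le> K * exp \<bar>Im z\<bar>" using B0 by (intro mult_left_mono) (auto simp: K_def)
      finally show ?thesis .
    next
      case False
      then have z: "cmod z > 0" "z \<noteq> 0" by auto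
      have "cmod (csinc z) * (1 + cmod z) \<le> cmod (csinc z) * (2 * cmod z)"
        using False by (intro mult_left_mono) auto
      also have "\<dots> = 2 * cmod (sin z)" using z by (simp add: csinc_def norm_divide)
      also have "\<dots> \<le> 2 * exp \<bar>Im z\<bar>" using cmod_sin_le[of z] by simp
      also have "\<dots> \<le> K * exp \<bar>Im z\<bar>" using B0 by (intro mult_right_mono) (auto simp: K_def)
      finally show ?thesis .
    qed
    then show "cmod (csinc z) \<le> K * exp \<bar>Im z\<bar> / (1 + cmod z)"
      using pos by (simp add: pos_le_divide_eq)
  qed
qed

text \<open>Quadratic decay in the real direction makes every horizontal line integrable and the
  vertical sides of a contour negligible; the exponential factor records the type in the imaginary
  direction.\<close>

definition strip_decay :: "(complex \<Rightarrow> complex) \<Rightarrow> real \<Rightarrow> bool" where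
  "strip_decay G \<tau> \<longleftrightarrow> G holomorphic_on UNIV \<and>
     (\<forall>\<epsilon>>0. \<exists>M. \<forall>z. cmod (G z) \<le> M / (1 + (Re z)\<^sup>2) * exp ((\<tau> + \<epsilon>) * \<bar>Im z\<bar>))"

text \<open>The types add up to \<open>(1 - \<delta>) * \<tau> + 4 * (\<delta> * \<tau> / 4) =
  \<tau>\<close>. The linear growth from \<open>PW_strip_growth\<close> against the fourth power of
  \<open>csinc\<close> leaves the inverse cube of \<open>1 + cmod z\<close>, which is at most
  \<open>1 / (1 + (Re z)^2)\<close>.\<close>

lemma PW_damped_strip_decay:
  assumes F: "F \<in> PW \<tau>" and \<tau>: "\<tau> > 0" and \<delta>: "0 < \<delta>" "\<delta> < 1"
  shows "strip_decay (\<lambda>z. F (of_real (1 - \<delta>) * z) * csinc (of_real (\<delta> * \<tau> / 4) * z) ^ 4) \<tau>"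
  unfolding strip_decay_def
proof (intro conjI allI impI)
  define k where "k = \<delta> * \<tau> / 4"
  have k: "k > 0" using \<delta> \<tau> by (simp add: k_def)
  have hol: "F holomorphic_on UNIV" using F by (simp add: PW_def)
  have "(\<lambda>z. F (of_real (1 - \<delta>) * z)) holomorphic_on UNIV"
    by (rule holomorphic_on_compose_gen[OF _ hol, unfolded o_def]) (auto intro!: holomorphic_intros)
  moreover have "(\<lambda>z. csinc (of_real (\<delta> * \<tau> / 4) * z)) holomorphic_on UNIV"
    by (rule holomorphic_on_compose_gen[OF _ csinc_holomorphic, unfolded o_def]) (auto intro!: holomorphic_intros)
  ultimately show "(\<lambda>z. F (of_real (1 - \<delta>) * z) * csinc (of_real (\<delta> * \<tau> / 4) * z) ^ 4) holomorphic_on UNIV"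
    by (intro holomorphic_intros)
  fix \<epsilon> :: real assume \<epsilon>: "\<epsilon> > 0"
  obtain M where M: "\<And>z. cmod (F z) \<le> M * (1 + cmod z) * exp ((\<tau> + \<epsilon>) * \<bar>Im z\<bar>)"
    using PW_strip_growth[OF F less_imp_le[OF \<tau>] \<epsilon>] by blast
  have M0: "M \<ge> 0" using order.trans[OF norm_ge_zero M[of 0]] by simp
  obtain K where K: "K \<ge> 0" "\<And>z. cmod (csinc z) \<le> K * exp \<bar>Im z\<bar> / (1 + cmod z)"
    using csinc_bound by blast
  \<comment> \<open>Chosen so that \<open>1 + r <= c * (1 + k * r)\<close>, which trades decay in
    \<open>k * z\<close> for decay in \<open>z\<close>.\<close>
  define c where "c = 1 + 1 / k"
  have c: "c > 0" unfolding c_def using k by (simp add: add_pos_pos)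
  have "cmod (F (of_real (1 - \<delta>) * z) * csinc (of_real (\<delta> * \<tau> / 4) * z) ^ 4)
      \<le> (M * K ^ 4 * c ^ 4) / (1 + (Re z)\<^sup>2) * exp ((\<tau> + \<epsilon>) * \<bar>Im z\<bar>)" for z
  proof -
    define r where "r = cmod z"
    have r: "r \<ge> 0" by (simp add: r_def)
    have cr: "1 + r \<le> c * (1 + k * r)"
      using k r by (simp add: c_def field_simps)
    have pos: "1 + k * r > 0" using k r by (simp add: add_pos_nonneg)
    have n: "cmod (of_real (1 - \<delta>) * z) = (1 - \<delta>) * r" "cmod (of_real k * z) = k * r"
      "\<bar>Im (of_real (1 - \<delta>) * z)\<bar> = (1 - \<delta>) * \<bar>Im z\<bar>" "\<bar>Im (of_real k * z)\<bar> = k * \<bar>Im z\<bar>"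
      using \<delta> k by (simp_all only: norm_mult norm_of_real r_def times_complex.sel
          Re_complex_of_real Im_complex_of_real mult_zero_left add_0_right abs_mult)
    have "cmod (F (of_real (1 - \<delta>) * z)) \<le> M * (1 + (1 - \<delta>) * r) * exp ((\<tau> + \<epsilon>) * ((1 - \<delta>) * \<bar>Im z\<bar>))"
      using M[of "of_real (1 - \<delta>) * z"] unfolding n .
    also have "\<dots> \<le> M * (1 + r) * exp ((\<tau> + \<epsilon>) * ((1 - \<delta>) * \<bar>Im z\<bar>))"
      using M0 \<delta> r mult_left_le_one_le[of r "1 - \<delta>"] by (intro mult_mono) auto
    finally have 1: "cmod (F (of_real (1 - \<delta>) * z)) \<le> M * (1 + r) * exp ((\<tau> + \<epsilon>) * ((1 - \<delta>) * \<bar>Im z\<bar>))" .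
    have "cmod (csinc (of_real k * z)) \<le> K * exp (k * \<bar>Im z\<bar>) / (1 + k * r)"
      using K(2)[of "of_real k * z"] unfolding n .
    also have "\<dots> \<le> K * exp (k * \<bar>Im z\<bar>) / ((1 + r) / c)"
    proof (intro divide_left_mono)
      show "(1 + r) / c \<le> 1 + k * r" using cr c by (simp add: pos_divide_le_eq mult.commute)
      show "0 < (1 + k * r) * ((1 + r) / c)" using pos c r by (intro mult_pos_pos divide_pos_pos) auto
    qed (use K(1) in auto)
    finally have "cmod (csinc (of_real k * z)) ^ 4 \<le> (K * exp (k * \<bar>Im z\<bar>) / ((1 + r) / c)) ^ 4"
      by (intro power_mono) auto
    also have "\<dots> = K ^ 4 * c ^ 4 * exp (4 * (k * \<bar>Im z\<bar>)) / (1 + r) ^ 4"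
      by (simp add: power_mult_distrib power_divide exp_of_nat_mult[of 4, simplified])
    finally have 2: "cmod (csinc (of_real k * z)) ^ 4 \<le> K ^ 4 * c ^ 4 * exp (4 * (k * \<bar>Im z\<bar>)) / (1 + r) ^ 4" .
    have "cmod (F (of_real (1 - \<delta>) * z) * csinc (of_real k * z) ^ 4)
      \<le> (M * (1 + r) * exp ((\<tau> + \<epsilon>) * ((1 - \<delta>) * \<bar>Im z\<bar>))) * (K ^ 4 * c ^ 4 * exp (4 * (k * \<bar>Im z\<bar>)) / (1 + r) ^ 4)"
      unfolding norm_mult norm_power using 1 2 M0 r by (intro mult_mono) auto
    also have "\<dots> = (M * K ^ 4 * c ^ 4) * ((1 + r) / (1 + r) ^ 4) * 
        exp ((\<tau> + \<epsilon>) * ((1 - \<delta>) * \<bar>Im z\<bar>) + 4 * (k * \<bar>Im z\<bar>))"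
      by (simp add: exp_add)
    also have "(\<tau> + \<epsilon>) * ((1 - \<delta>) * \<bar>Im z\<bar>) + 4 * (k * \<bar>Im z\<bar>) = (\<tau> + \<epsilon> * (1 - \<delta>)) * \<bar>Im z\<bar>"
      by (simp add: k_def field_simps)
    also have "(M * K ^ 4 * c ^ 4) * ((1 + r) / (1 + r) ^ 4) * exp ((\<tau> + \<epsilon> * (1 - \<delta>)) * \<bar>Im z\<bar>)
      \<le> (M * K ^ 4 * c ^ 4) * (1 / (1 + (Re z)\<^sup>2)) * exp ((\<tau> + \<epsilon>) * \<bar>Im z\<bar>)"
    proof (intro mult_mono)
      have "(Re z)\<^sup>2 \<le> r\<^sup>2" unfolding r_def by (simp add: cmod_power2)
      then have "1 + (Re z)\<^sup>2 \<le> (1 + r) ^ 2" using r by (simp add: power2_eq_square algebra_simps)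
      also have "\<dots> \<le> (1 + r) ^ 3" using r by (intro power_increasing) auto
      finally have "1 / (1 + r) ^ 3 \<le> 1 / (1 + (Re z)\<^sup>2)"
        by (intro divide_left_mono) (auto simp: r add_pos_nonneg)
      moreover have "(1 + r) / (1 + r) ^ 4 = 1 / (1 + r) ^ 3"
      proof -
        have "(1 + r) ^ 4 = (1 + r) * (1 + r) ^ 3" by (simp add: power4_eq_xxxx power3_eq_cube)
        then show ?thesis using r by simp
      qed
      ultimately show "(1 + r) / (1 + r) ^ 4 \<le> 1 / (1 + (Re z)\<^sup>2)" by simp
    qed (use M0 K c \<delta> \<epsilon> r in \<open>auto intro!: mult_right_mono simp: algebra_simps\<close>)
    finally show ?thesis by (simp add: k_def)
  qed
  then show "\<exists>M. \<forall>z. cmod (F (of_real (1 - \<delta>) * z) * csinc (of_real (\<delta> * \<tau> / 4) * z) ^ 4)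
      \<le> M / (1 + (Re z)\<^sup>2) * exp ((\<tau> + \<epsilon>) * \<bar>Im z\<bar>)" by blast
qed

lemma integrable_inverse_one_plus_square: "integrable lborel (\<lambda>x::real. M / (1 + x\<^sup>2))"
proof -
  have "integrable lborel (\<lambda>x::real. inverse (1 + x\<^sup>2))"
    using integrable_inverse_1_plus_square by (simp add: set_integrable_def)
  then show ?thesis by (auto simp: divide_inverse)
qed

lemma strip_decay_real_bound:
  assumes "strip_decay G \<tau>"
  obtains M where "M \<ge> 0" "\<And>x::real. cmod (G (of_real x)) \<le> M / (1 + x\<^sup>2)"
proof -
  obtain M where M: "\<And>z. cmod (G z) \<le> M / (1 + (Re z)\<^sup>2) * exp ((\<tau> + 1) * \<bar>Im z\<bar>)"
    using assms unfolding strip_decay_def by (meson zero_less_one)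
  have "M \<ge> 0" using order.trans[OF norm_ge_zero M[of 0]] by simp
  moreover have "cmod (G (of_real x)) \<le> M / (1 + x\<^sup>2)" for x using M[of "of_real x"] by simp
  ultimately show thesis by (rule that)
qed

lemma strip_decay_continuous:
  assumes "strip_decay G \<tau>"
  shows "continuous_on UNIV (\<lambda>x::real. G (of_real x))"
proof -
  have "continuous_on UNIV G"
    using assms by (auto simp: strip_decay_def intro: holomorphic_on_imp_continuous_on)
  then show ?thesis by (rule continuous_on_compose2) (auto intro: continuous_intros)
qed

lemma strip_decay_integrable:
  assumes "strip_decay G \<tau>"
  shows "integrable lborel (\<lambda>x::real. G (of_real x))"
proof -
  obtain M where M: "M \<ge> 0" "\<And>x::real. cmod (G (of_real x)) \<le> M / (1 + x\<^sup>2)"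
    using strip_decay_real_bound[OF assms] by blast
  have "(\<lambda>x::real. G (of_real x)) \<in> borel_measurable borel"
    by (intro borel_measurable_continuous_onI strip_decay_continuous[OF assms])
  then show ?thesis
    by (intro Bochner_Integration.integrable_bound[OF integrable_inverse_one_plus_square[of M]])
      (use M in \<open>auto intro!: AE_I2 order.trans[OF M(2)] divide_right_mono\<close>)
qed

text \<open>The factor \<open>exp (\<i> * c * z)\<close> decays at rate \<open>|c|\<close> in one
  half plane, faster than \<open>G\<close> grows, so moving the line of integration to infinity
  there sends the integral to 0. This is the support statement of Paley-Wiener.\<close>

lemma strip_decay_fourier_vanishes:
  assumes G: "strip_decay G \<tau>" and c: "\<bar>c\<bar> > \<tau>" and \<tau>: "\<tau> \<ge> 0"
  shows "(\<integral>x. G (of_real x) * cis (c * x) \<partial>lborel) = 0"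
proof -
  define K where "K z = G z * exp (\<i> * of_real c * z)" for z
  have hol: "K holomorphic_on UNIV" unfolding K_def
    using G by (auto simp: strip_decay_def intro!: holomorphic_intros)
  obtain Q where Q: "\<And>z. (Q has_field_derivative K z) (at z)"
    by (rule entire_has_primitive[OF hol]) blast
  \<comment> \<open>Half of the gap \<open>|c| - \<tau>\<close> is spent on the growth of
    \<open>G\<close>, the other half remains as decay.\<close>
  define \<epsilon> where "\<epsilon> = (\<bar>c\<bar> - \<tau>) / 2"
  have \<epsilon>: "\<epsilon> > 0" using c by (simp add: \<epsilon>_def)
  obtain M where M: "\<And>z. cmod (G z) \<le> M / (1 + (Re z)\<^sup>2) * exp ((\<tau> + \<epsilon>) * \<bar>Im z\<bar>)"
    using G \<epsilon> unfolding strip_decay_def by meson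
  have M0: "M \<ge> 0" using order.trans[OF norm_ge_zero M[of 0]] by simp
  have K: "cmod (K z) \<le> M / (1 + (Re z)\<^sup>2) * exp (- \<epsilon> * \<bar>Im z\<bar>)" if "c * Im z \<ge> 0" for z
  proof -
    have cI: "c * Im z = \<bar>c\<bar> * \<bar>Im z\<bar>" using that by (simp flip: abs_mult)
    have "cmod (K z) = cmod (G z) * exp (- (c * Im z))" unfolding K_def norm_mult by simp
    also have "\<dots> \<le> (M / (1 + (Re z)\<^sup>2) * exp ((\<tau> + \<epsilon>) * \<bar>Im z\<bar>)) * exp (- (c * Im z))"
      using M by (intro mult_right_mono) auto
    also have "\<dots> = M / (1 + (Re z)\<^sup>2) * exp ((\<tau> + \<epsilon>) * \<bar>Im z\<bar> - c * Im z)"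
      by (simp add: exp_diff exp_minus field_simps)
    also have "(\<tau> + \<epsilon>) * \<bar>Im z\<bar> - c * Im z = - \<epsilon> * \<bar>Im z\<bar>"
      unfolding cI \<epsilon>_def by (simp add: field_simps)
    finally show ?thesis .
  qed
  have Kx: "K (of_real x) = G (of_real x) * cis (c * x)" for x
    by (simp add: K_def cis_conv_exp mult_ac)
  have intK: "integrable lborel (\<lambda>x::real. K (of_real x))"
  proof (rule Bochner_Integration.integrable_bound[OF strip_decay_integrable[OF G]])
    show "(\<lambda>x::real. K (of_real x)) \<in> borel_measurable lborel"
      unfolding measurable_lborel2
      by (intro borel_measurable_continuous_onI continuous_on_compose2[OF holomorphic_on_imp_continuous_on[OF hol]])
        (auto intro: continuous_intros)
  qed (auto simp: Kx norm_mult)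
  (* The contour is shifted to Im z = Y, with sgn Y = sgn c, through a primitive Q of K. *)
  have fin: "norm (integral {- R..R} (\<lambda>x. K (of_real x))) \<le> exp (- \<epsilon> * s) * (M * pi) + 2 * s * (M / (1 + R\<^sup>2))"
    if s: "s > 0" and R: "R > 0" for s R
  proof -
    define Y where "Y = s * sgn c"
    have c0: "c \<noteq> 0" using c \<tau> by auto
    have Y: "c * Y \<ge> 0" "\<bar>Y\<bar> = s" using s c0 by (auto simp: Y_def abs_mult sgn_if mult_le_0_iff)
    have i1: "((\<lambda>x. K (of_real x)) has_integral Q (of_real R) - Q (of_real (- R))) {- R..R}"
      using has_integral_primitive_horizontal[OF Q, of "- R" R 0] R by simp
    have i2: "((\<lambda>x. K (of_real x + \<i> * Y)) has_integral Q (of_real R + \<i> * Y) - Q (of_real (- R) + \<i> * Y)) {- R..R}"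
      using has_integral_primitive_horizontal[OF Q, of "- R" R "\<i> * Y"] R by simp
    have vert: "cmod (Q (of_real x + \<i> * Y) - Q (of_real x)) \<le> M / (1 + R\<^sup>2) * s" if "\<bar>x\<bar> = R" for x
    proof -
      have "cmod (Q (of_real x + \<i> * Y) - Q (of_real x)) \<le> M / (1 + R\<^sup>2) * cmod (of_real x + \<i> * Y - of_real x)"
      proof (rule field_differentiable_bound[of "closed_segment (of_real x) (of_real x + \<i> * of_real Y)"])
        fix w assume "w \<in> closed_segment (of_real x) (of_real x + \<i> * of_real Y)"
        then obtain u where u: "0 \<le> u" "u \<le> 1" "w = of_real x + of_real u * (\<i> * of_real Y)"
          by (auto simp: in_segment algebra_simps scaleR_conv_of_real)
        then have w: "Re w = x" "Im w = u * Y" by auto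
        have "c * Im w \<ge> 0" unfolding w using Y u by (metis mult.left_commute mult_nonneg_nonneg)
        then have "cmod (K w) \<le> M / (1 + (Re w)\<^sup>2) * exp (- \<epsilon> * \<bar>Im w\<bar>)" by (rule K)
        also have "\<dots> \<le> M / (1 + (Re w)\<^sup>2) * 1" 
          using M0 \<epsilon> by (intro mult_left_mono) auto
        also have "(Re w)\<^sup>2 = R\<^sup>2" unfolding w using that by (metis power2_abs)
        finally show "cmod (K w) \<le> M / (1 + R\<^sup>2)" by simp
        show "(Q has_field_derivative K w) (at w within closed_segment (of_real x) (of_real x + \<i> * of_real Y))"
          by (rule has_field_derivative_at_within[OF Q])
      qed auto
      then show ?thesis using Y by (simp add: norm_mult)
    qed
    have horiz: "cmod (Q (of_real R + \<i> * Y) - Q (of_real (- R) + \<i> * Y)) \<le> exp (- \<epsilon> * s) * (M * pi)"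
    proof -
      have int': "integrable lborel (\<lambda>x::real. M / (1 + x\<^sup>2))" by (rule integrable_inverse_one_plus_square)
      have si: "set_integrable lborel {- R..R} (\<lambda>x. M / (1 + x\<^sup>2) * exp (- \<epsilon> * s))"
        unfolding set_integrable_def using int' by (intro integrable_mult_indicator integrable_mult_left) auto
      have "cmod (integral {- R..R} (\<lambda>x. K (of_real x + \<i> * Y))) \<le> integral {- R..R} (\<lambda>x. M / (1 + x\<^sup>2) * exp (- \<epsilon> * s))"
      proof (rule integral_norm_bound_integral[OF has_integral_integrable[OF i2] set_borel_integral_eq_integral(1)[OF si]])
        fix x
        show "cmod (K (of_real x + \<i> * Y)) \<le> M / (1 + x\<^sup>2) * exp (- \<epsilon> * s)"
          using K[of "of_real x + \<i> * Y"] Y by simp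
      qed
      also have "\<dots> = (LBINT x:{- R..R}. M / (1 + x\<^sup>2) * exp (- \<epsilon> * s))"
        using set_borel_integral_eq_integral(2)[OF si] by simp
      also have "\<dots> \<le> (LBINT x. M / (1 + x\<^sup>2) * exp (- \<epsilon> * s))"
        unfolding set_lebesgue_integral_def using M0
        by (intro integral_mono si[unfolded set_integrable_def] integrable_mult_left int') (auto simp: indicator_def)
      also have "\<dots> = exp (- \<epsilon> * s) * (M * pi)"
        using LBINT_inverse_1_plus_square
        by (simp add: divide_inverse einterval_def set_lebesgue_integral_def interval_lebesgue_integral_def)
      finally show ?thesis using integral_unique[OF i2] by simp
    qed
    have "integral {- R..R} (\<lambda>x. K (of_real x)) = Q (of_real R) - Q (of_real (- R))"
      using i1 by (rule integral_unique)
    also have "\<dots> = (Q (of_real R + \<i> * Y) - Q (of_real (- R) + \<i> * Y)) - (Q (of_real R + \<i> * Y) - Q (of_real R))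
         + (Q (of_real (- R) + \<i> * Y) - Q (of_real (- R)))" by simp
    also have "cmod \<dots> \<le> exp (- \<epsilon> * s) * (M * pi) + M / (1 + R\<^sup>2) * s + M / (1 + R\<^sup>2) * s"
      using R by (intro order.trans[OF norm_triangle_ineq] add_mono order.trans[OF norm_triangle_ineq4] horiz vert) auto
    finally show ?thesis by (simp add: mult_ac)
  qed
  have lim: "(\<lambda>n. integral {- real (Suc n)..real (Suc n)} (\<lambda>x. K (of_real x))) \<longlonglongrightarrow> (\<integral>x. K (of_real x) \<partial>lborel)"
  proof -
    have "(\<lambda>n. \<integral>x. indicator {- real (Suc n)..real (Suc n)} x *\<^sub>R K (of_real x) \<partial>lborel) \<longlonglongrightarrow> (\<integral>x. K (of_real x) \<partial>lborel)"
    proof (rule integral_dominated_convergence[where w = "\<lambda>x. norm (K (of_real x))"])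
      show "AE x in lborel. (\<lambda>n. indicator {- real (Suc n)..real (Suc n)} x *\<^sub>R K (of_real x)) \<longlonglongrightarrow> K (of_real x)"
      proof (rule AE_I2, rule tendsto_eventually)
        fix x :: real
        obtain N where N: "\<bar>x\<bar> \<le> real N" using real_arch_simple by blast
        show "\<forall>\<^sub>F n in sequentially. indicator {- real (Suc n)..real (Suc n)} x *\<^sub>R K (of_real x) = K (of_real x)"
          using eventually_ge_at_top[of N] by eventually_elim (use N in \<open>auto simp: indicator_def\<close>)
      qed
    qed (use intK in \<open>auto simp: indicator_def\<close>)
    moreover have "(\<integral>x. indicator {- real (Suc n)..real (Suc n)} x *\<^sub>R K (of_real x) \<partial>lborel) =
        integral {- real (Suc n)..real (Suc n)} (\<lambda>x. K (of_real x))" for n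
      using set_borel_integral_eq_integral(2)[of "{- real (Suc n)..real (Suc n)}" "\<lambda>x. K (of_real x)"]
        integrable_mult_indicator[OF _ intK]
      by (auto simp: set_integrable_def set_lebesgue_integral_def)
    ultimately show ?thesis by simp
  qed
  \<comment> \<open>The width tends to infinity while the height \<open>s\<close> is fixed, which
    removes the vertical sides; only afterwards does \<open>s\<close> grow.\<close>
  have le: "cmod (\<integral>x. K (of_real x) \<partial>lborel) \<le> exp (- \<epsilon> * s) * (M * pi)" if s: "s > 0" for s
  proof (rule LIMSEQ_le[OF tendsto_norm[OF lim]])
    have "(\<lambda>n. exp (- \<epsilon> * s) * (M * pi) + 2 * s * (M / (1 + (real (Suc n))\<^sup>2))) \<longlonglongrightarrow> exp (- \<epsilon> * s) * (M * pi) + 2 * s * 0"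
      by (intro tendsto_intros) real_asymp
    then show "(\<lambda>n. exp (- \<epsilon> * s) * (M * pi) + 2 * s * (M / (1 + (real (Suc n))\<^sup>2))) \<longlonglongrightarrow> exp (- \<epsilon> * s) * (M * pi)"
      by simp
    show "\<exists>N. \<forall>n\<ge>N. norm (integral {- real (Suc n)..real (Suc n)} (\<lambda>x. K (of_real x)))
        \<le> exp (- \<epsilon> * s) * (M * pi) + 2 * s * (M / (1 + (real (Suc n))\<^sup>2))"
      using fin[OF s, of "real (Suc _)"] by (intro exI allI impI) simp
  qed
  have "cmod (\<integral>x. K (of_real x) \<partial>lborel) \<le> 0"
  proof (rule tendsto_lowerbound)
    show "((\<lambda>s. exp (- \<epsilon> * s) * (M * pi)) \<longlongrightarrow> 0) at_top" using \<epsilon> by real_asymp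
    show "\<forall>\<^sub>F s in at_top. cmod (\<integral>x. K (of_real x) \<partial>lborel) \<le> exp (- \<epsilon> * s) * (M * pi)"
      using eventually_gt_at_top[of 0] by eventually_elim (rule le)
  qed auto
  then show ?thesis by (simp add: Kx)
qed

section \<open>Fourier inversion and Plancherel by Gaussian summation\<close>

lemma cis_borel_measurable [measurable]: "cis \<in> borel_measurable borel"
  by (intro borel_measurable_continuous_onI continuous_intros)

lemma cnj_borel_measurable [measurable]: "cnj \<in> borel_measurable borel"
  by (intro borel_measurable_continuous_onI continuous_intros)

text \<open>With \<open>2 * pi\<close> in the exponent Plancherel holds without a constant. The sign
  is always \<open>+\<close>, so two applications give a reflection.\<close>

definition fourier :: "(real \<Rightarrow> complex) \<Rightarrow> real \<Rightarrow> complex" where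
  "fourier f x = (\<integral>t. f t * cis (2 * pi * x * t) \<partial>lborel)"

lemma integrable_mult_cis:
  fixes f :: "real \<Rightarrow> complex"
  assumes "integrable lborel f"
  shows "integrable lborel (\<lambda>t. f t * cis (c * t))"
proof (rule Bochner_Integration.integrable_bound[OF assms])
  have [measurable]: "f \<in> borel_measurable borel" using borel_measurable_integrable[OF assms] by simp
  show "(\<lambda>t. f t * cis (c * t)) \<in> borel_measurable lborel" by measurable
qed (auto simp: norm_mult)

lemma norm_fourier_le:
  assumes "integrable lborel f"
  shows "norm (fourier f x) \<le> (\<integral>t. norm (f t) \<partial>lborel)"
  unfolding fourier_def
  by (rule order.trans[OF integral_norm_bound]) (auto simp: norm_mult)

lemma borel_measurable_fourier [measurable]:
  assumes "integrable lborel f"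
  shows "fourier f \<in> borel_measurable borel"
proof -
  have [measurable]: "f \<in> borel_measurable borel" using borel_measurable_integrable[OF assms] by simp
  have "(\<lambda>x. \<integral>t. f t * cis (2 * pi * x * t) \<partial>lborel) \<in> borel_measurable borel"
    by measurable
  then show ?thesis by (simp add: fourier_def[abs_def])
qed

lemma continuous_fourier:
  assumes "integrable lborel f"
  shows "continuous_on UNIV (fourier f)"
  unfolding continuous_on_sequentially
proof (intro ballI allI impI, elim conjE)
  fix x :: "nat \<Rightarrow> real" and y assume x: "x \<longlonglongrightarrow> y"
  have [measurable]: "f \<in> borel_measurable borel" using borel_measurable_integrable[OF assms] by simp
  have "(\<lambda>n. \<integral>t. f t * cis (2 * pi * x n * t) \<partial>lborel) \<longlonglongrightarrow> (\<integral>t. f t * cis (2 * pi * y * t) \<partial>lborel)"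
  proof (rule integral_dominated_convergence[where w = "\<lambda>t. norm (f t)"])
    show "AE t in lborel. (\<lambda>n. f t * cis (2 * pi * x n * t)) \<longlonglongrightarrow> f t * cis (2 * pi * y * t)"
      by (intro AE_I2 tendsto_intros x)
  qed (use assms in \<open>auto simp: norm_mult\<close>)
  then show "(fourier f \<circ> x) \<longlonglongrightarrow> fourier f y" by (simp add: fourier_def o_def)
qed

text \<open>The multiplication formula, from Fubini. Inversion, autocorrelation and the weight
  formula all come from it by a suitable choice of \<open>H\<close>.\<close>

lemma fourier_swap:
  assumes f: "integrable lborel f" and H: "integrable lborel H"
  shows "(\<integral>x. fourier f x * H x \<partial>lborel) = (\<integral>s. f s * (\<integral>x. cis (2 * pi * x * s) * H x \<partial>lborel) \<partial>lborel)"
proof -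
  have [measurable]: "f \<in> borel_measurable borel" using borel_measurable_integrable[OF f] by simp
  have [measurable]: "H \<in> borel_measurable borel" using borel_measurable_integrable[OF H] by simp
  have int: "integrable (lborel \<Otimes>\<^sub>M lborel) (\<lambda>(x, s). f s * cis (2 * pi * x * s) * H x)"
  proof (rule lborel_pair.Fubini_integrable)
    show "integrable lborel (\<lambda>x. \<integral>s. norm (case (x, s) of (x, s) \<Rightarrow> f s * cis (2 * pi * x * s) * H x) \<partial>lborel)"
      using H by (simp add: norm_mult)
    show "AE x in lborel. integrable lborel (\<lambda>s. case (x, s) of (x, s) \<Rightarrow> f s * cis (2 * pi * x * s) * H x)"
      using integrable_mult_cis[OF f] by simp
  qed measurable
  have "(\<integral>x. fourier f x * H x \<partial>lborel) = (\<integral>x. (\<integral>s. f s * cis (2 * pi * x * s) * H x \<partial>lborel) \<partial>lborel)"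
    by (simp add: fourier_def)
  also have "\<dots> = (\<integral>s. (\<integral>x. f s * cis (2 * pi * x * s) * H x \<partial>lborel) \<partial>lborel)"
    using lborel_pair.Fubini_integral[OF int] by simp
  also have "\<dots> = (\<integral>s. f s * (\<integral>x. cis (2 * pi * x * s) * H x \<partial>lborel) \<partial>lborel)"
    by (simp add: mult.assoc)
  finally show ?thesis .
qed

text \<open>The characteristic function of the standard normal distribution after the substitution
  of \<open>\<epsilon> * x\<close>.\<close>

lemma integral_gauss_cis:
  assumes \<epsilon>: "\<epsilon> > 0"
  shows "(\<integral>x. cis (v * x) * of_real (exp (- ((\<epsilon> * x)\<^sup>2) / 2)) \<partial>lborel) =
     of_real (sqrt (2 * pi) / \<epsilon> * exp (- ((v / \<epsilon>)\<^sup>2) / 2))"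
proof -
  have "of_real (exp (- ((v / \<epsilon>)\<^sup>2) / 2)) = char std_normal_distribution (v / \<epsilon>)"
    by (simp add: char_std_normal_distribution)
  also have "\<dots> = (\<integral>x. std_normal_density x *\<^sub>R cis (v / \<epsilon> * x) \<partial>lborel)"
    unfolding char_def by (subst integral_density) (auto simp: cis_conv_exp)
  also have "\<dots> = \<bar>\<epsilon>\<bar> *\<^sub>R (\<integral>x. std_normal_density (0 + \<epsilon> * x) *\<^sub>R cis (v / \<epsilon> * (0 + \<epsilon> * x)) \<partial>lborel)"
    by (rule lborel_integral_real_affine) (use \<epsilon> in auto)
  also have "\<dots> = of_real (\<epsilon> / sqrt (2 * pi)) * (\<integral>x. cis (v * x) * of_real (exp (- ((\<epsilon> * x)\<^sup>2) / 2)) \<partial>lborel)"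
    using \<epsilon> by (simp add: std_normal_density_def scaleR_conv_of_real mult_ac flip: integral_mult_right_zero)
  finally show ?thesis using \<epsilon> by (simp add: field_simps)
qed

lemma integrable_gauss: 
  assumes \<epsilon>: "\<epsilon> > 0"
  shows "integrable lborel (\<lambda>x::real. exp (- ((\<epsilon> * x)\<^sup>2) / 2))"
proof -
  have "integrable lborel (\<lambda>x. std_normal_density (0 + \<epsilon> * x))"
    by (rule lborel_integrable_real_affine) (use \<epsilon> in auto)
  from integrable_mult_right[OF this, of "sqrt (2 * pi)"] show ?thesis by (simp add: std_normal_density_def)
qed

text \<open>The inner Gaussian integral is a normal density centred at \<open>- w\<close> of width
  \<open>\<epsilon> / (2 * pi)\<close>. Substituting
  \<open>t = - w + \<epsilon> / (2 * pi) * z\<close> moves all dependence on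
  \<open>\<epsilon>\<close> into the argument of \<open>h\<close>, ready for dominated
  convergence.\<close>

lemma fourier_gauss_inversion:
  assumes h: "integrable lborel h" and \<epsilon>: "\<epsilon> > 0"
  shows "(\<integral>x. fourier h x * (cis (2 * pi * x * w) * of_real (exp (- ((\<epsilon> * x)\<^sup>2) / 2))) \<partial>lborel) =
    (\<integral>z. std_normal_density z *\<^sub>R h (- w + \<epsilon> / (2 * pi) * z) \<partial>lborel)"
proof -
  have [measurable]: "h \<in> borel_measurable borel" using borel_measurable_integrable[OF h] by simp
  have H: "integrable lborel (\<lambda>x. cis (2 * pi * x * w) * of_real (exp (- ((\<epsilon> * x)\<^sup>2) / 2)))"
    by (rule Bochner_Integration.integrable_bound[OF integrable_gauss[OF \<epsilon>]]) (auto simp: norm_mult)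
  have "(\<integral>x. fourier h x * (cis (2 * pi * x * w) * of_real (exp (- ((\<epsilon> * x)\<^sup>2) / 2))) \<partial>lborel) =
     (\<integral>t. h t * (\<integral>x. cis (2 * pi * x * t) * (cis (2 * pi * x * w) * of_real (exp (- ((\<epsilon> * x)\<^sup>2) / 2))) \<partial>lborel) \<partial>lborel)"
    by (rule fourier_swap[OF h H])
  also have "\<dots> = (\<integral>t. h t * of_real (sqrt (2 * pi) / \<epsilon> * exp (- ((2 * pi * (t + w) / \<epsilon>)\<^sup>2) / 2)) \<partial>lborel)"
    by (simp only: mult.assoc[symmetric] cis_mult integral_gauss_cis[OF \<epsilon>, symmetric])
      (simp add: algebra_simps)
  also have "\<dots> = \<bar>\<epsilon> / (2 * pi)\<bar> *\<^sub>R (\<integral>z. h (- w + \<epsilon> / (2 * pi) * z) * 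
      of_real (sqrt (2 * pi) / \<epsilon> * exp (- ((2 * pi * ((- w + \<epsilon> / (2 * pi) * z) + w) / \<epsilon>)\<^sup>2) / 2)) \<partial>lborel)"
    by (rule lborel_integral_real_affine) (use \<epsilon> in auto)
  also have "\<dots> = (\<integral>z. std_normal_density z *\<^sub>R h (- w + \<epsilon> / (2 * pi) * z) \<partial>lborel)"
  proof (subst integral_scaleR_right[symmetric], rule Bochner_Integration.integral_cong[OF refl])
    fix z :: real
    have s: "sqrt (2 * pi) * sqrt (2 * pi) = 2 * pi" by simp
    have e: "2 * pi * ((- w + \<epsilon> / (2 * pi) * z) + w) / \<epsilon> = z" using \<epsilon> by simp
    have "std_normal_density z = \<epsilon> / (2 * pi) * (sqrt (2 * pi) / \<epsilon> * exp (- (z\<^sup>2) / 2))"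
      using \<epsilon> by (simp add: std_normal_density_def field_simps s)
    then show "\<bar>\<epsilon> / (2 * pi)\<bar> *\<^sub>R (h (- w + \<epsilon> / (2 * pi) * z) * 
      of_real (sqrt (2 * pi) / \<epsilon> * exp (- ((2 * pi * ((- w + \<epsilon> / (2 * pi) * z) + w) / \<epsilon>)\<^sup>2) / 2))) =
      std_normal_density z *\<^sub>R h (- w + \<epsilon> / (2 * pi) * z)"
      unfolding e using \<epsilon>
      by (simp only: scaleR_conv_of_real of_real_mult mult_ac
        abs_of_pos divide_pos_pos mult_pos_pos zero_less_numeral pi_gt_zero)
  qed
  finally show ?thesis .
qed

lemma integral_gauss_smoothing_tendsto:
  fixes h :: "real \<Rightarrow> complex"
  assumes [measurable]: "h \<in> borel_measurable borel" and B: "\<And>x. norm (h x) \<le> B"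
    and c: "isCont h w" and e: "e \<longlonglongrightarrow> 0"
  shows "(\<lambda>n::nat. \<integral>z. std_normal_density z *\<^sub>R h (w + e n * z) \<partial>lborel) \<longlonglongrightarrow> h w"
proof -
  have "(\<lambda>n::nat. \<integral>z. std_normal_density z *\<^sub>R h (w + e n * z) \<partial>lborel) \<longlonglongrightarrow> (\<integral>z. std_normal_density z *\<^sub>R h w \<partial>lborel)"
  proof (rule integral_dominated_convergence[where w = "\<lambda>z. std_normal_density z * B"])
    show "AE z in lborel. (\<lambda>n. std_normal_density z *\<^sub>R h (w + e n * z)) \<longlonglongrightarrow> std_normal_density z *\<^sub>R h w"
    proof (intro AE_I2 tendsto_intros)
      fix z
      have "(\<lambda>n. w + e n * z) \<longlonglongrightarrow> w + 0 * z" by (intro tendsto_intros e)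
      then show "(\<lambda>n. h (w + e n * z)) \<longlonglongrightarrow> h w" using c isCont_tendsto_compose by fastforce
    qed
    show "AE z in lborel. norm (std_normal_density z *\<^sub>R h (w + e n * z)) \<le> std_normal_density z * B" for n
      using B by (auto intro!: mult_left_mono)
  qed auto
  also have "(\<integral>z. std_normal_density z *\<^sub>R h w \<partial>lborel) = h w" by simp
  finally show ?thesis .
qed

text \<open>Both sides are limits of the same Gaussian means: the left by dominated convergence on
  the transform side, the right by continuity of \<open>h\<close> at \<open>- w\<close>.\<close>

lemma fourier_inversion:
  assumes h: "integrable lborel h" and B: "\<And>x. norm (h x) \<le> B" and c: "isCont h (- w)"
    and int: "integrable lborel (fourier h)"
  shows "fourier (fourier h) w = h (- w)"
proof -
  have [measurable]: "h \<in> borel_measurable borel" using borel_measurable_integrable[OF h] by simp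
  have m[measurable]: "fourier h \<in> borel_measurable borel" using h by simp
  define e where "e n = 1 / real (Suc n)" for n
  have e: "e n > 0" for n by (simp add: e_def)
  have e0: "e \<longlonglongrightarrow> 0" unfolding e_def by real_asymp
  have "(\<lambda>n. \<integral>x. fourier h x * (cis (2 * pi * x * w) * of_real (exp (- ((e n * x)\<^sup>2) / 2))) \<partial>lborel) \<longlonglongrightarrow> h (- w)"
  proof -
    have "(\<lambda>n. e n / (2 * pi)) \<longlonglongrightarrow> 0 / (2 * pi)" by (intro tendsto_intros e0) auto
    then have "(\<lambda>n. \<integral>z. std_normal_density z *\<^sub>R h (- w + e n / (2 * pi) * z) \<partial>lborel) \<longlonglongrightarrow> h (- w)"
      by (intro integral_gauss_smoothing_tendsto[where B = B] B c) auto
    then show ?thesis by (simp only: fourier_gauss_inversion[OF h e])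
  qed
  moreover have "(\<lambda>n. \<integral>x. fourier h x * (cis (2 * pi * x * w) * of_real (exp (- ((e n * x)\<^sup>2) / 2))) \<partial>lborel) \<longlonglongrightarrow>
    (\<integral>x. fourier h x * (cis (2 * pi * x * w) * of_real (exp (- ((0 * x)\<^sup>2) / 2))) \<partial>lborel)"
  proof (rule integral_dominated_convergence[where w = "\<lambda>x. norm (fourier h x)"])
    show "AE x in lborel. (\<lambda>n. fourier h x * (cis (2 * pi * x * w) * of_real (exp (- ((e n * x)\<^sup>2) / 2)))) \<longlonglongrightarrow>
      fourier h x * (cis (2 * pi * x * w) * of_real (exp (- ((0 * x)\<^sup>2) / 2)))"
      by (intro AE_I2 tendsto_intros e0) auto
    show "AE x in lborel. norm (fourier h x * (cis (2 * pi * x * w) * of_real (exp (- ((e n * x)\<^sup>2) / 2)))) \<le> norm (fourier h x)" for n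
      by (auto simp: norm_mult intro!: mult_left_le)
  qed (use int in auto)
  ultimately have "h (- w) = (\<integral>x. fourier h x * (cis (2 * pi * x * w) * of_real (exp (- ((0 * x)\<^sup>2) / 2))) \<partial>lborel)"
    by (rule LIMSEQ_unique)
  also have "\<dots> = fourier (fourier h) w"
    unfolding fourier_def[of "fourier h"] by (simp add: mult_ac)
  finally show ?thesis by simp
qed

text \<open>A stand-in for L2 of the interval. Continuity is asked on the closed interval only:
  jumps at \<open>- a\<close> and \<open>a\<close> are allowed, because the constants and the
  eigenfunctions may have them.\<close>

definition supp_cont :: "real \<Rightarrow> (real \<Rightarrow> 'b::real_normed_vector) set" where
  "supp_cont a = {f. continuous_on {- a..a} f \<and> (\<forall>x. x \<notin> {- a..a} \<longrightarrow> f x = 0)}"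

lemma supp_cont_measurable:
  fixes f :: "real \<Rightarrow> 'b::{second_countable_topology, real_normed_vector}"
  assumes "f \<in> supp_cont a"
  shows "f \<in> borel_measurable borel"
proof -
  have "f = (\<lambda>x. indicator {- a..a} x *\<^sub>R f x)" using assms by (auto simp: supp_cont_def indicator_def)
  then show ?thesis
    using borel_measurable_continuous_on_indicator[of "{- a..a}" f] assms by (auto simp: supp_cont_def)
qed

lemma supp_cont_bounded:
  assumes f: "f \<in> supp_cont a"
  obtains B where "B \<ge> 0" "\<And>x. norm (f x) \<le> B"
proof -
  have "compact (f ` {- a..a})"
    using f by (intro compact_continuous_image) (auto simp: supp_cont_def)
  then have "bounded (f ` {- a..a})" by (rule compact_imp_bounded)
  then obtain B where B: "\<And>x. x \<in> {- a..a} \<Longrightarrow> norm (f x) \<le> B"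
    unfolding bounded_iff by (metis imageI)
  show thesis
  proof (rule that[of "max B 0"])
    show "norm (f x) \<le> max B 0" for x
      using f B[of x] by (cases "x \<in> {- a..a}") (auto simp: supp_cont_def)
  qed auto
qed

lemma supp_cont_integrable:
  fixes f :: "real \<Rightarrow> 'b::{second_countable_topology, banach}"
  assumes f: "f \<in> supp_cont a"
  shows "integrable lborel f"
proof -
  obtain B where B: "B \<ge> 0" "\<And>x. norm (f x) \<le> B" using supp_cont_bounded[OF f] by blast
  have "integrable lborel (\<lambda>x. indicator {- a..a} x * B)"
    by (intro integrable_mult_left integrable_real_indicator) (auto simp: emeasure_lborel_Icc_eq)
  then show ?thesis
  proof (rule Bochner_Integration.integrable_bound)
    show "f \<in> borel_measurable lborel" using supp_cont_measurable[OF f] by simp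
    show "AE x in lborel. norm (f x) \<le> norm (indicator {- a..a} x * B)"
      using f B by (auto simp: supp_cont_def indicator_def)
  qed
qed

lemma supp_cont_isCont:
  assumes f: "f \<in> supp_cont a" and x: "x \<noteq> a" "x \<noteq> - a"
  shows "isCont f x"
proof (cases "x \<in> {- a..a}")
  case True
  then have "x \<in> {- a<..<a}" using x by auto
  moreover have "continuous_on {- a<..<a} f" using f by (auto simp: supp_cont_def elim: continuous_on_subset)
  ultimately show ?thesis by (simp add: continuous_on_eq_continuous_at)
next
  case False
  then have "\<forall>\<^sub>F y in nhds x. f y = 0"
    using f by (intro eventually_nhds[THEN iffD2] exI[of _ "- {- a..a}"]) (auto simp: supp_cont_def)
  from isCont_cong[OF this] show ?thesis by simp
qed

text \<open>The two possible jumps form a null set, so pointwise limits under an integral still hold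
  almost everywhere.\<close>

lemma AE_supp_cont_isCont:
  assumes f: "f \<in> supp_cont a"
  shows "AE s in lborel. isCont f (s + u)"
proof -
  have "AE s in lborel. s \<noteq> a - u" "AE s in lborel. s \<noteq> - a - u" by (rule AE_lborel_singleton)+
  then show ?thesis
    by eventually_elim (auto intro!: supp_cont_isCont[OF f])
qed

lemma cnj_fourier:
  assumes "integrable lborel f"
  shows "cnj (fourier f x) = fourier (\<lambda>t. cnj (f (- t))) x"
proof -
  have "cnj (fourier f x) = (\<integral>t. cnj (f t * cis (2 * pi * x * t)) \<partial>lborel)"
    unfolding fourier_def
    by (rule integral_bounded_linear[OF bounded_linear_cnj integrable_mult_cis[OF assms], symmetric])
  also have "\<dots> = (\<integral>t. cnj (f t) * cis (- (2 * pi * x * t)) \<partial>lborel)"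
    by (simp add: cis_cnj)
  also have "\<dots> = fourier (\<lambda>t. cnj (f (- t))) x"
    unfolding fourier_def using lborel_integral_real_affine[of "- 1" "\<lambda>t. cnj (f t) * cis (- (2 * pi * x * t))" 0]
    by simp
  finally show ?thesis .
qed

text \<open>The squared modulus is a product with the conjugate, which is the transform of
  \<open>cnj (f (- t))\<close>. The multiplication formula frees \<open>f\<close>, and Gaussian
  inversion evaluates the rest.\<close>

lemma fourier_autocorrelation_gauss:
  assumes f: "integrable lborel f" and \<epsilon>: "\<epsilon> > 0"
  shows "(\<integral>x. of_real ((norm (fourier f x))\<^sup>2) * cis (2 * pi * x * u) * of_real (exp (- ((\<epsilon> * x)\<^sup>2) / 2)) \<partial>lborel) =
    (\<integral>s. f s * (\<integral>z. std_normal_density z *\<^sub>R cnj (f (s + u + - \<epsilon> / (2 * pi) * z)) \<partial>lborel) \<partial>lborel)"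
proof -
  have [measurable]: "f \<in> borel_measurable borel" using borel_measurable_integrable[OF f] by simp
  have m[measurable]: "fourier f \<in> borel_measurable borel" using f by simp
  define f2 where "f2 t = cnj (f (- t))" for t
  have f2: "integrable lborel f2"
    unfolding f2_def using lborel_integrable_real_affine[OF f, of "- 1" 0] by simp
  define H where "H x = fourier f2 x * (cis (2 * pi * x * u) * of_real (exp (- ((\<epsilon> * x)\<^sup>2) / 2)))" for x
  have H: "integrable lborel H"
  proof (rule Bochner_Integration.integrable_bound)
    show "integrable lborel (\<lambda>x. (\<integral>t. norm (f2 t) \<partial>lborel) * exp (- ((\<epsilon> * x)\<^sup>2) / 2))"
      by (intro integrable_mult_right integrable_gauss \<epsilon>)
    have "fourier f2 \<in> borel_measurable borel" using f2 by simp
    then show "H \<in> borel_measurable lborel" unfolding H_def[abs_def] by measurable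
    show "AE x in lborel. norm (H x) \<le> norm ((\<integral>t. norm (f2 t) \<partial>lborel) * exp (- ((\<epsilon> * x)\<^sup>2) / 2))"
      using norm_fourier_le[OF f2] by (auto simp: H_def norm_mult intro!: mult_right_mono AE_I2)
  qed
  have "(\<integral>x. of_real ((norm (fourier f x))\<^sup>2) * cis (2 * pi * x * u) * of_real (exp (- ((\<epsilon> * x)\<^sup>2) / 2)) \<partial>lborel) =
     (\<integral>x. fourier f x * H x \<partial>lborel)"
    unfolding H_def f2_def cnj_fourier[OF f, symmetric] by (simp only: complex_norm_square mult.assoc)
  also have "\<dots> = (\<integral>s. f s * (\<integral>x. cis (2 * pi * x * s) * H x \<partial>lborel) \<partial>lborel)"
    by (rule fourier_swap[OF f H])
  also have "\<dots> = (\<integral>s. f s * (\<integral>z. std_normal_density z *\<^sub>R cnj (f (s + u + - \<epsilon> / (2 * pi) * z)) \<partial>lborel) \<partial>lborel)"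
  proof -
    have "(\<integral>x. cis (2 * pi * x * s) * H x \<partial>lborel) =
      (\<integral>z. std_normal_density z *\<^sub>R cnj (f (s + u + - \<epsilon> / (2 * pi) * z)) \<partial>lborel)" for s
    proof -
      have "(\<integral>x. cis (2 * pi * x * s) * H x \<partial>lborel) =
      (\<integral>x. fourier f2 x * (cis (2 * pi * x * (s + u)) * of_real (exp (- ((\<epsilon> * x)\<^sup>2) / 2))) \<partial>lborel)"
      by (simp add: H_def distrib_left mult_ac flip: cis_mult)
    also have "\<dots> = (\<integral>z. std_normal_density z *\<^sub>R f2 (- (s + u) + \<epsilon> / (2 * pi) * z) \<partial>lborel)"
      by (rule fourier_gauss_inversion[OF f2 \<epsilon>])
    also have "\<dots> = (\<integral>z. std_normal_density z *\<^sub>R cnj (f (s + u + - \<epsilon> / (2 * pi) * z)) \<partial>lborel)"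
      by (simp add: f2_def add.commute)
    finally show "(\<integral>x. cis (2 * pi * x * s) * H x \<partial>lborel) =
      (\<integral>z. std_normal_density z *\<^sub>R cnj (f (s + u + - \<epsilon> / (2 * pi) * z)) \<partial>lborel)" .
    qed
    then show ?thesis by (simp only:)
  qed
  finally show ?thesis .
qed

lemma fourier_autocorrelation_gauss_tendsto:
  assumes f: "f \<in> supp_cont a"
  shows "(\<lambda>n. \<integral>x. of_real ((norm (fourier f x))\<^sup>2) * cis (2 * pi * x * u) * 
      of_real (exp (- ((1 / real (Suc n) * x)\<^sup>2) / 2)) \<partial>lborel) \<longlonglongrightarrow> (\<integral>s. f s * cnj (f (s + u)) \<partial>lborel)"
proof -
  have fi: "integrable lborel f" using f by (rule supp_cont_integrable)
  have [measurable]: "f \<in> borel_measurable borel" using supp_cont_measurable[OF f] .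
  obtain B where B: "B \<ge> 0" "\<And>x. norm (f x) \<le> B" using supp_cont_bounded[OF f] by blast
  have "(\<lambda>n. \<integral>s. f s * (\<integral>z. std_normal_density z *\<^sub>R cnj (f (s + u + - (1 / real (Suc n)) / (2 * pi) * z)) \<partial>lborel) \<partial>lborel)
    \<longlonglongrightarrow> (\<integral>s. f s * cnj (f (s + u)) \<partial>lborel)"
  proof (rule integral_dominated_convergence[where w = "\<lambda>s. norm (f s) * B"])
    show "AE s in lborel. (\<lambda>n. f s * (\<integral>z. std_normal_density z *\<^sub>R cnj (f (s + u + - (1 / real (Suc n)) / (2 * pi) * z)) \<partial>lborel))
       \<longlonglongrightarrow> f s * cnj (f (s + u))"
      using AE_supp_cont_isCont[OF f, of u]
    proof eventually_elim
      case (elim s)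
      have "(\<lambda>n. - (1 / real (Suc n)) / (2 * pi)) \<longlonglongrightarrow> 0" by real_asymp
      moreover have "isCont (\<lambda>x. cnj (f x)) (s + u)" using elim by (intro continuous_intros)
      ultimately have "(\<lambda>n. \<integral>z. std_normal_density z *\<^sub>R cnj (f (s + u + - (1 / real (Suc n)) / (2 * pi) * z)) \<partial>lborel)
        \<longlonglongrightarrow> cnj (f (s + u))"
        by (intro integral_gauss_smoothing_tendsto[where h = "\<lambda>x. cnj (f x)" and B = B]) (use B in auto)
      then show ?case by (intro tendsto_intros)
    qed
    show "AE s in lborel. norm (f s * (\<integral>z. std_normal_density z *\<^sub>R cnj (f (s + u + - (1 / real (Suc n)) / (2 * pi) * z)) \<partial>lborel)) \<le> norm (f s) * B" for n
    proof (rule AE_I2, unfold norm_mult, rule mult_left_mono)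
      fix s
      have "norm (\<integral>z. std_normal_density z *\<^sub>R cnj (f (s + u + - (1 / real (Suc n)) / (2 * pi) * z)) \<partial>lborel)
        \<le> (\<integral>z. std_normal_density z * B \<partial>lborel)"
      proof (rule order.trans[OF integral_norm_bound integral_mono])
        show "integrable lborel (\<lambda>z. norm (std_normal_density z *\<^sub>R cnj (f (s + u + - (1 / real (Suc n)) / (2 * pi) * z))))"
        proof (rule integrable_norm, rule Bochner_Integration.integrable_bound)
          show "integrable lborel (\<lambda>z. std_normal_density z * B)" by simp
          show "AE z in lborel. norm (std_normal_density z *\<^sub>R cnj (f (s + u + - (1 / real (Suc n)) / (2 * pi) * z)))
              \<le> norm (std_normal_density z * B)"
            using B by (intro AE_I2) (simp add: mult_left_mono)
        qed measurable
        show "norm (std_normal_density z *\<^sub>R cnj (f (s + u + - (1 / real (Suc n)) / (2 * pi) * z)))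
            \<le> std_normal_density z * B" for z
          using B by (simp add: mult_left_mono)
        show "integrable lborel (\<lambda>z. std_normal_density z * B)" by simp
      qed
      then show "norm (\<integral>z. std_normal_density z *\<^sub>R cnj (f (s + u + - (1 / real (Suc n)) / (2 * pi) * z)) \<partial>lborel) \<le> B"
        by simp
    qed auto
  qed (use fi in auto)
  then show ?thesis
    by (subst fourier_autocorrelation_gauss[OF fi]) auto
qed

text \<open>At \<open>u = 0\<close> the Gaussian means have nonnegative integrands that increase as
  the Gaussian flattens, so monotone convergence delivers integrability and value together.\<close>

lemma
  assumes f: "f \<in> supp_cont a"
  shows integrable_fourier_norm_square: "integrable lborel (\<lambda>x. (norm (fourier f x))\<^sup>2)"
    and plancherel: "(\<integral>x. (norm (fourier f x))\<^sup>2 \<partial>lborel) = (\<integral>s. (norm (f s))\<^sup>2 \<partial>lborel)"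
proof -
  have fi: "integrable lborel f" using f by (rule supp_cont_integrable)
  have m[measurable]: "fourier f \<in> borel_measurable borel" using fi by simp
  define g where "g n x = (norm (fourier f x))\<^sup>2 * exp (- ((1 / real (Suc n) * x)\<^sup>2) / 2)" for n x
  have gi: "integrable lborel (g n)" for n
  proof (rule Bochner_Integration.integrable_bound)
    show "integrable lborel (\<lambda>x. (\<integral>t. norm (f t) \<partial>lborel)\<^sup>2 * exp (- ((1 / real (Suc n) * x)\<^sup>2) / 2))"
      by (intro integrable_mult_right integrable_gauss) auto
    show "g n \<in> borel_measurable lborel" unfolding g_def[abs_def] by measurable
    show "AE x in lborel. norm (g n x) \<le> norm ((\<integral>t. norm (f t) \<partial>lborel)\<^sup>2 * exp (- ((1 / real (Suc n) * x)\<^sup>2) / 2))"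
      using norm_fourier_le[OF fi] by (auto simp: g_def intro!: mult_right_mono power_mono AE_I2)
  qed
  have "(\<lambda>n. complex_of_real (\<integral>x. g n x \<partial>lborel)) \<longlonglongrightarrow> (\<integral>s. f s * cnj (f (s + 0)) \<partial>lborel)"
    using fourier_autocorrelation_gauss_tendsto[OF f, of 0] unfolding g_def integral_complex_of_real[symmetric] by simp
  also have "(\<integral>s. f s * cnj (f (s + 0)) \<partial>lborel) = of_real (\<integral>s. (norm (f s))\<^sup>2 \<partial>lborel)"
    unfolding integral_complex_of_real[symmetric] complex_norm_square by simp
  finally have lim: "(\<lambda>n. \<integral>x. g n x \<partial>lborel) \<longlonglongrightarrow> (\<integral>s. (norm (f s))\<^sup>2 \<partial>lborel)"
    by (simp only: tendsto_of_real_iff)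
  have mono: "AE x in lborel. mono (\<lambda>n. g n x)"
  proof (intro AE_I2 monoI)
    fix x :: real and n m :: nat assume "n \<le> m"
    then have "(1 / real (Suc m) * x)\<^sup>2 \<le> (1 / real (Suc n) * x)\<^sup>2"
      unfolding power_mult_distrib by (intro mult_right_mono power_mono divide_left_mono) auto
    then show "g n x \<le> g m x" unfolding g_def by (intro mult_left_mono) auto
  qed
  have pt: "AE x in lborel. (\<lambda>n. g n x) \<longlonglongrightarrow> (norm (fourier f x))\<^sup>2"
  proof (rule AE_I2)
    fix x
    have "(\<lambda>n. 1 / real (Suc n)) \<longlonglongrightarrow> 0" by real_asymp
    then have "(\<lambda>n. g n x) \<longlonglongrightarrow> (norm (fourier f x))\<^sup>2 * exp (- ((0 * x)\<^sup>2) / 2)"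
      unfolding g_def by (intro tendsto_intros) auto
    then show "(\<lambda>n. g n x) \<longlonglongrightarrow> (norm (fourier f x))\<^sup>2" by simp
  qed
  have mf: "(\<lambda>x. (norm (fourier f x))\<^sup>2) \<in> borel_measurable lborel" by measurable
  show "integrable lborel (\<lambda>x. (norm (fourier f x))\<^sup>2)"
    by (rule integrable_monotone_convergence[OF gi mono pt lim mf])
  show "(\<integral>x. (norm (fourier f x))\<^sup>2 \<partial>lborel) = (\<integral>s. (norm (f s))\<^sup>2 \<partial>lborel)"
    by (rule integral_monotone_convergence[OF gi mono pt lim mf])
qed

text \<open>With the squared transform known to be integrable, dominated convergence removes the
  Gaussian.\<close>

lemma fourier_autocorrelation:
  assumes f: "f \<in> supp_cont a"
  shows "(\<integral>x. of_real ((norm (fourier f x))\<^sup>2) * cis (2 * pi * x * u) \<partial>lborel) = (\<integral>s. f s * cnj (f (s + u)) \<partial>lborel)"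
proof -
  have fi: "integrable lborel f" using f by (rule supp_cont_integrable)
  have m[measurable]: "fourier f \<in> borel_measurable borel" using fi by simp
  have e0: "(\<lambda>n. 1 / real (Suc n)) \<longlonglongrightarrow> 0" by real_asymp
  have "(\<lambda>n. \<integral>x. of_real ((norm (fourier f x))\<^sup>2) * cis (2 * pi * x * u) * 
      of_real (exp (- ((1 / real (Suc n) * x)\<^sup>2) / 2)) \<partial>lborel) \<longlonglongrightarrow>
      (\<integral>x. of_real ((norm (fourier f x))\<^sup>2) * cis (2 * pi * x * u) * of_real (exp (- ((0 * x)\<^sup>2) / 2)) \<partial>lborel)"
  proof (rule integral_dominated_convergence[where w = "\<lambda>x. (norm (fourier f x))\<^sup>2"])
    show "AE x in lborel. (\<lambda>n. of_real ((norm (fourier f x))\<^sup>2) * cis (2 * pi * x * u) * 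
      of_real (exp (- ((1 / real (Suc n) * x)\<^sup>2) / 2))) \<longlonglongrightarrow>
      of_real ((norm (fourier f x))\<^sup>2) * cis (2 * pi * x * u) * of_real (exp (- ((0 * x)\<^sup>2) / 2))"
      by (intro AE_I2 tendsto_intros e0) auto
    show "AE x in lborel. norm (of_real ((norm (fourier f x))\<^sup>2) * cis (2 * pi * x * u) * 
      of_real (exp (- ((1 / real (Suc n) * x)\<^sup>2) / 2))) \<le> (norm (fourier f x))\<^sup>2" for n
      by (auto simp: norm_mult norm_power intro!: mult_left_le)
  qed (use integrable_fourier_norm_square[OF f] in auto)
  from LIMSEQ_unique[OF fourier_autocorrelation_gauss_tendsto[OF f] this] show ?thesis by simp
qed

lemma integral_cis_symmetric:
  assumes "x \<noteq> 0"
  shows "fourier (\<lambda>u. indicator {- 1..1} u) x = of_real (2 * (sin (2 * pi * x) / (2 * pi * x)))"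
proof -
  have x: "2 * pi * x \<noteq> 0" using assms by simp
  have "fourier (\<lambda>u. indicator {- 1..1} u) x = (\<integral>u. indicator {- 1..1} u *\<^sub>R cis (2 * pi * x * u) \<partial>lborel)"
    unfolding fourier_def by (intro Bochner_Integration.integral_cong) (auto simp: indicator_def)
  also have "\<dots> = cis (2 * pi * x * 1) / (\<i> * of_real (2 * pi * x)) - cis (2 * pi * x * (- 1)) / (\<i> * of_real (2 * pi * x))"
  proof (rule integral_FTC_Icc)
    fix u :: real
    have "((\<lambda>u. exp (\<i> * of_real (2 * pi * x) * of_real u) / (\<i> * of_real (2 * pi * x)))
        has_vector_derivative exp (\<i> * of_real (2 * pi * x) * of_real u)) (at u within {- 1..1})"
      using x by (intro has_vector_derivative_real_field) (auto intro!: derivative_eq_intros)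
    then show "((\<lambda>u. cis (2 * pi * x * u) / (\<i> * of_real (2 * pi * x))) has_vector_derivative cis (2 * pi * x * u)) (at u within {- 1..1})"
      by (simp add: cis_conv_exp mult_ac)
  qed (auto intro!: continuous_intros)
  also have "\<dots> = of_real (2 * (sin (2 * pi * x) / (2 * pi * x)))"
  proof -
    have "cis (2 * pi * x * 1) - cis (2 * pi * x * (- 1)) = \<i> * of_real (2 * sin (2 * pi * x))"
      by (simp add: complex_eq_iff)
    then have "cis (2 * pi * x * 1) / (\<i> * of_real (2 * pi * x)) - cis (2 * pi * x * (- 1)) / (\<i> * of_real (2 * pi * x)) =
      \<i> * of_real (2 * sin (2 * pi * x)) / (\<i> * of_real (2 * pi * x))"
      by (simp only: diff_divide_distrib[symmetric])
    also have "\<dots> = of_real (2 * sin (2 * pi * x)) / of_real (2 * pi * x)"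
      by (rule mult_divide_mult_cancel_left) simp
    finally show ?thesis by simp
  qed
  finally show ?thesis .
qed

text \<open>The weight is 1 plus half the transform of the indicator of \<open>[- 1, 1]\<close>. The
  multiplication formula moves that transform onto the squared modulus, where it becomes an integral
  of autocorrelations over \<open>|u| <= 1\<close>.\<close>

lemma fourier_weighted:
  assumes f: "f \<in> supp_cont a"
  shows "complex_of_real (\<integral>x. (norm (fourier f x))\<^sup>2 * W x \<partial>lborel) = of_real (\<integral>s. (norm (f s))\<^sup>2 \<partial>lborel) +
     (\<integral>u. indicator {- 1..1} u * (\<integral>s. f s * cnj (f (s + u)) \<partial>lborel) \<partial>lborel) / 2"
proof -
  have fi: "integrable lborel f" using f by (rule supp_cont_integrable)
  have m[measurable]: "fourier f \<in> borel_measurable borel" using fi by simp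
  define I where "I = (\<lambda>u::real. indicator {- 1..1} u :: complex)"
  have I: "integrable lborel I" 
  proof -
    have "integrable lborel (\<lambda>u::real. indicat_real {- 1..1} u *\<^sub>R (1::complex))"
      by (intro integrable_scaleR_left integrable_real_indicator) (auto simp: emeasure_lborel_Icc_eq)
    moreover have "(\<lambda>u::real. indicat_real {- 1..1} u *\<^sub>R (1::complex)) = I"
      by (auto simp: I_def indicator_def fun_eq_iff)
    ultimately show ?thesis by simp
  qed
  have mI[measurable]: "fourier I \<in> borel_measurable borel" using I by simp
  define N where "N x = complex_of_real ((norm (fourier f x))\<^sup>2)" for x
  have N: "integrable lborel N" unfolding N_def by (intro integrable_of_real integrable_fourier_norm_square[OF f])
  have mN[measurable]: "N \<in> borel_measurable borel" using borel_measurable_integrable[OF N] by simp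
  have NI: "integrable lborel (\<lambda>x. fourier I x * N x)"
    by (rule Bochner_Integration.integrable_bound[where f = "\<lambda>x. (\<integral>u. norm (I u) \<partial>lborel) *\<^sub>R N x"])
      (use N norm_fourier_le[OF I] in \<open>auto simp: norm_mult intro!: mult_right_mono AE_I2 order.trans[OF norm_fourier_le[OF I]]\<close>)
  have [measurable]: "W \<in> borel_measurable borel" unfolding W_def[abs_def] by measurable
  have "complex_of_real (\<integral>x. (norm (fourier f x))\<^sup>2 * W x \<partial>lborel) = (\<integral>x. N x + (1 / 2) * (fourier I x * N x) \<partial>lborel)"
    unfolding integral_complex_of_real[symmetric]
  proof (rule integral_cong_AE)
    have "AE x in lborel. x \<noteq> (0::real)" by (rule AE_lborel_singleton)
    then show "AE x in lborel. of_real ((norm (fourier f x))\<^sup>2 * W x) = N x + (1 / 2) * (fourier I x * N x)"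
      by eventually_elim (simp add: I_def integral_cis_symmetric N_def W_def algebra_simps)
  qed measurable
  also have "\<dots> = (\<integral>x. N x \<partial>lborel) + (1 / 2) * (\<integral>x. fourier I x * N x \<partial>lborel)"
    using N NI by (subst Bochner_Integration.integral_add) (auto intro!: integrable_mult_right)
  also have "(\<integral>x. fourier I x * N x \<partial>lborel) = (\<integral>u. I u * (\<integral>x. cis (2 * pi * x * u) * N x \<partial>lborel) \<partial>lborel)"
    by (rule fourier_swap[OF I N])
  also have "(\<lambda>u. \<integral>x. cis (2 * pi * x * u) * N x \<partial>lborel) = (\<lambda>u. \<integral>s. f s * cnj (f (s + u)) \<partial>lborel)"
    unfolding N_def using fourier_autocorrelation[OF f] by (simp add: mult.commute)
  also have "(\<integral>x. N x \<partial>lborel) = of_real (\<integral>s. (norm (f s))\<^sup>2 \<partial>lborel)"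
    unfolding N_def integral_complex_of_real plancherel[OF f] ..
  finally show ?thesis by (simp add: I_def)
qed

section \<open>The quadratic form of the weight\<close>

text \<open>The form \<open><T f, f>\<close> in the shape in which the Fourier side delivers it;
  \<open>qform_eq_ip_Top\<close> gives the operator form.\<close>

definition qform :: "(real \<Rightarrow> real) \<Rightarrow> real" where
  "qform f = (\<integral>u. indicator {- 1..1} u * (\<integral>s. f s * f (s + u) \<partial>lborel) \<partial>lborel) / 2"

lemma supp_cont_mult_integrable:
  fixes f g :: "real \<Rightarrow> 'b::{second_countable_topology, banach, real_normed_algebra}"
  assumes f: "f \<in> supp_cont a" and g: "g \<in> supp_cont b"
  shows "integrable lborel (\<lambda>s. f s * g (s + u))"
proof -
  obtain B where B: "B \<ge> 0" "\<And>x. norm (g x) \<le> B" using supp_cont_bounded[OF g] by blast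
  have [measurable]: "f \<in> borel_measurable borel" "g \<in> borel_measurable borel"
    using supp_cont_measurable f g by auto
  show ?thesis
  proof (rule Bochner_Integration.integrable_bound)
    show "integrable lborel (\<lambda>s. norm (f s) * B)"
      using supp_cont_integrable[OF f] by simp
    show "AE s in lborel. norm (f s * g (s + u)) \<le> norm (norm (f s) * B)"
      using B by (intro AE_I2 order.trans[OF norm_mult_ineq]) (simp add: mult_left_mono)
  qed measurable
qed

lemma integrable_indicator_autocorrelation:
  fixes f g :: "real \<Rightarrow> 'b::{second_countable_topology, banach, real_normed_algebra}"
  assumes f: "f \<in> supp_cont a" and g: "g \<in> supp_cont b"
  shows "integrable lborel (\<lambda>u. indicat_real {- 1..1} u *\<^sub>R (\<integral>s. f s * g (s + u) \<partial>lborel))"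
proof -
  obtain B where B: "B \<ge> 0" "\<And>x. norm (g x) \<le> B" using supp_cont_bounded[OF g] by blast
  have [measurable]: "f \<in> borel_measurable borel" "g \<in> borel_measurable borel"
    using supp_cont_measurable f g by auto
  define K where "K = (\<integral>s. norm (f s) * B \<partial>lborel)"
  show ?thesis
  proof (rule Bochner_Integration.integrable_bound)
    show "integrable lborel (\<lambda>u::real. indicat_real {- 1..1} u * K)"
      by (intro integrable_mult_left integrable_real_indicator) (auto simp: emeasure_lborel_Icc_eq)
    have "norm (\<integral>s. f s * g (s + u) \<partial>lborel) \<le> K" for u
      unfolding K_def
    proof (rule order.trans[OF integral_norm_bound integral_mono])
      show "integrable lborel (\<lambda>s. norm (f s * g (s + u)))"
        by (rule integrable_norm[OF supp_cont_mult_integrable[OF f g]])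
      show "integrable lborel (\<lambda>s. norm (f s) * B)" using supp_cont_integrable[OF f] by simp
      show "norm (f s * g (s + u)) \<le> norm (f s) * B" for s
        using B by (intro order.trans[OF norm_mult_ineq]) (simp add: mult_left_mono)
    qed
    then show "AE u in lborel. norm (indicat_real {- 1..1} u *\<^sub>R (\<integral>s. f s * g (s + u) \<partial>lborel)) \<le> norm (indicat_real {- 1..1} u * K)"
      by (intro AE_I2) (auto simp: indicator_def intro: order.trans[OF _ abs_ge_self])
  qed measurable
qed

text \<open>The kernel is real, so the real part of the autocorrelation separates into those of
  \<open>Re f\<close> and \<open>Im f\<close>. This reduces the extremal problem to real
  functions.\<close>

lemma fourier_weighted_qform:
  assumes f: "f \<in> supp_cont a"
  defines "p \<equiv> \<lambda>s. Re (f s)" and "q \<equiv> \<lambda>s. Im (f s)"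
  shows "p \<in> supp_cont a" "q \<in> supp_cont a"
    "(\<integral>x. (norm (fourier f x))\<^sup>2 \<partial>lborel) = (\<integral>s. (p s)\<^sup>2 \<partial>lborel) + (\<integral>s. (q s)\<^sup>2 \<partial>lborel)"
    "(\<integral>x. (norm (fourier f x))\<^sup>2 * W x \<partial>lborel) =
       (\<integral>s. (p s)\<^sup>2 \<partial>lborel) + (\<integral>s. (q s)\<^sup>2 \<partial>lborel) + qform p + qform q"
proof -
  show p: "p \<in> supp_cont a" and q: "q \<in> supp_cont a"
    using f by (auto simp: supp_cont_def p_def q_def intro!: continuous_intros)
  have cf: "(\<lambda>s. cnj (f s)) \<in> supp_cont a"
    using f by (auto simp: supp_cont_def intro!: continuous_intros)
  have sq: "(\<integral>s. (norm (f s))\<^sup>2 \<partial>lborel) = (\<integral>s. (p s)\<^sup>2 \<partial>lborel) + (\<integral>s. (q s)\<^sup>2 \<partial>lborel)"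
    using supp_cont_mult_integrable[OF p p, of 0] supp_cont_mult_integrable[OF q q, of 0]
    unfolding cmod_power2 by (simp add: p_def q_def power2_eq_square)
  then show "(\<integral>x. (norm (fourier f x))\<^sup>2 \<partial>lborel) = (\<integral>s. (p s)\<^sup>2 \<partial>lborel) + (\<integral>s. (q s)\<^sup>2 \<partial>lborel)"
    by (simp add: plancherel[OF f])
  have inner: "Re (\<integral>s. f s * cnj (f (s + u)) \<partial>lborel) = (\<integral>s. p s * p (s + u) \<partial>lborel) + (\<integral>s. q s * q (s + u) \<partial>lborel)" for u
  proof -
    have "Re (\<integral>s. f s * cnj (f (s + u)) \<partial>lborel) = (\<integral>s. Re (f s * cnj (f (s + u))) \<partial>lborel)"
      by (rule integral_Re[symmetric, OF supp_cont_mult_integrable[OF f cf]])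
    also have "\<dots> = (\<integral>s. p s * p (s + u) + q s * q (s + u) \<partial>lborel)"
      by (simp add: p_def q_def)
    also have "\<dots> = (\<integral>s. p s * p (s + u) \<partial>lborel) + (\<integral>s. q s * q (s + u) \<partial>lborel)"
      by (intro Bochner_Integration.integral_add supp_cont_mult_integrable[OF p p] supp_cont_mult_integrable[OF q q])
    finally show ?thesis .
  qed
  have "Re (\<integral>u. indicator {- 1..1} u * (\<integral>s. f s * cnj (f (s + u)) \<partial>lborel) \<partial>lborel) =
     Re (\<integral>u. indicat_real {- 1..1} u *\<^sub>R (\<integral>s. f s * cnj (f (s + u)) \<partial>lborel) \<partial>lborel)"
    by (intro arg_cong[where f = Re] Bochner_Integration.integral_cong) (auto simp: indicator_def)
  also have "\<dots> = (\<integral>u. Re (indicat_real {- 1..1} u *\<^sub>R (\<integral>s. f s * cnj (f (s + u)) \<partial>lborel)) \<partial>lborel)"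
    by (rule integral_Re[symmetric, OF integrable_indicator_autocorrelation[OF f cf]])
  also have "\<dots> = (\<integral>u. indicator {- 1..1} u * (\<integral>s. p s * p (s + u) \<partial>lborel) + indicator {- 1..1} u * (\<integral>s. q s * q (s + u) \<partial>lborel) \<partial>lborel)"
    by (simp add: inner distrib_left)
  also have "\<dots> = 2 * qform p + 2 * qform q"
    using integrable_indicator_autocorrelation[OF p p] integrable_indicator_autocorrelation[OF q q]
    by (simp add: qform_def)
  finally have r: "Re (\<integral>u. indicator {- 1..1} u * (\<integral>s. f s * cnj (f (s + u)) \<partial>lborel) \<partial>lborel) = 2 * qform p + 2 * qform q" .
  show "(\<integral>x. (norm (fourier f x))\<^sup>2 * W x \<partial>lborel) =
       (\<integral>s. (p s)\<^sup>2 \<partial>lborel) + (\<integral>s. (q s)\<^sup>2 \<partial>lborel) + qform p + qform q"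
    using arg_cong[OF fourier_weighted[OF f], of Re] by (simp add: r sq)
qed

section \<open>From damped functions to the whole Paley-Wiener space\<close>

lemma W_eq_csinc: "W x = 1 + Re (csinc (of_real (2 * pi * x)))"
proof (cases "x = 0")
  case False
  then have "csinc (of_real (2 * pi * x)) = of_real (sin (2 * pi * x) / (2 * pi * x))"
    unfolding csinc_def of_real_divide sin_of_real[symmetric] by simp
  then show ?thesis using False by (simp only: W_def if_False Re_complex_of_real)
qed (auto simp: W_def csinc_def)

lemma continuous_W: "continuous_on UNIV W"
proof -
  have "continuous_on UNIV (\<lambda>x. csinc (of_real (2 * pi * x)))"
    by (rule continuous_on_compose2[OF holomorphic_on_imp_continuous_on[OF csinc_holomorphic]])
      (auto intro!: continuous_intros)
  then show ?thesis unfolding W_eq_csinc[abs_def] by (intro continuous_intros)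
qed

lemma csinc_real_bounded:
  obtains K where "\<And>x. cmod (csinc (of_real x)) \<le> K"
proof -
  obtain K where K: "K \<ge> 0" "\<And>z. cmod (csinc z) \<le> K * exp \<bar>Im z\<bar> / (1 + cmod z)" using csinc_bound by blast
  have "cmod (csinc (of_real x)) \<le> K" for x
  proof -
    have "cmod (csinc (of_real x)) \<le> K / (1 + \<bar>x\<bar>)" using K(2)[of "of_real x"] by simp
    also have "\<dots> \<le> K / 1" using K(1) by (intro divide_left_mono) auto
    finally show ?thesis by simp
  qed
  then show thesis by (rule that)
qed

lemma W_bounded:
  obtains K where "\<And>x. \<bar>W x\<bar> \<le> K"
proof -
  obtain K where K: "\<And>x. cmod (csinc (of_real x)) \<le> K" using csinc_real_bounded by blast
  have "\<bar>W x\<bar> \<le> 1 + K" for x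
    unfolding W_eq_csinc
    using order.trans[OF abs_Re_le_cmod K[of "2 * pi * x"]] by (simp only: abs_le_iff) linarith
  then show thesis by (rule that)
qed

text \<open>The transform of \<open>G\<close> on the real line is continuous and vanishes outside
  \<open>[- a, a]\<close>, so it lies in \<open>supp_cont a\<close>, and inversion recovers
  \<open>G\<close> from it. The form bounds are then applied to the real and the imaginary
  part.\<close>

lemma strip_decay_qform_bounds:
  assumes G: "strip_decay G (2 * pi * a)" and a: "a > 0"
    and lo: "\<And>f. f \<in> supp_cont a \<Longrightarrow> m * (\<integral>s. (f s)\<^sup>2 \<partial>lborel) \<le> qform f"
    and hi: "\<And>f. f \<in> supp_cont a \<Longrightarrow> qform f \<le> M * (\<integral>s. (f s)\<^sup>2 \<partial>lborel)"
  shows "(1 + m) * (\<integral>x. (norm (G (of_real x)))\<^sup>2 \<partial>lborel) \<le> (\<integral>x. (norm (G (of_real x)))\<^sup>2 * W x \<partial>lborel)"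
    "(\<integral>x. (norm (G (of_real x)))\<^sup>2 * W x \<partial>lborel) \<le> (1 + M) * (\<integral>x. (norm (G (of_real x)))\<^sup>2 \<partial>lborel)"
proof -
  define h where "h x = G (of_real x)" for x :: real
  have hi': "integrable lborel h" unfolding h_def by (rule strip_decay_integrable[OF G])
  have hc: "continuous_on UNIV h" unfolding h_def by (rule strip_decay_continuous[OF G])
  obtain B where B: "B \<ge> 0" "\<And>x::real. cmod (G (of_real x)) \<le> B / (1 + x\<^sup>2)"
    using strip_decay_real_bound[OF G] by blast
  have hB: "norm (h x) \<le> B" for x
  proof -
    have "norm (h x) \<le> B / (1 + x\<^sup>2)" using B by (simp add: h_def)
    also have "\<dots> \<le> B / 1" using B by (intro divide_left_mono) (auto simp: add_pos_nonneg)
    finally show ?thesis by simp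
  qed
  have fh0: "fourier h t = 0" if "\<bar>t\<bar> > a" for t
  proof -
    have "\<bar>2 * pi * t\<bar> > 2 * pi * a" using that by (simp add: abs_mult)
    from strip_decay_fourier_vanishes[OF G this] a show ?thesis by (simp add: fourier_def h_def)
  qed
  have fhc: "continuous_on A (fourier h)" for A
    using continuous_fourier[OF hi'] continuous_on_subset by blast
  have fhs: "fourier h \<in> supp_cont a"
    unfolding supp_cont_def using fhc fh0 by (auto simp: abs_le_iff not_le)
  \<comment> \<open>Reflected because two transforms compose to a reflection; thus
    \<open>fourier f\<close> is \<open>G\<close> itself.\<close>
  define f where "f t = fourier h (- t)" for t
  have fs: "f \<in> supp_cont a"
  proof -
    have "continuous_on {- a..a} f"
      unfolding f_def by (rule continuous_on_compose2[OF fhc[of UNIV]]) (auto intro!: continuous_intros)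
    then show ?thesis using fhs by (auto simp: supp_cont_def f_def)
  qed
  have ff: "fourier f w = G (of_real w)" for w
  proof -
    have "fourier f w = fourier (fourier h) (- w)"
      unfolding fourier_def[of f] fourier_def[of "fourier h"] f_def
      using lborel_integral_real_affine[of "- 1" "\<lambda>t. fourier h t * cis (2 * pi * - w * t)" 0] by simp
    also have "\<dots> = h w"
      using fourier_inversion[OF hi' hB _ supp_cont_integrable[OF fhs], of "- w"] hc
      by (simp add: continuous_on_eq_continuous_at)
    finally show ?thesis by (simp add: h_def)
  qed
  note * = fourier_weighted_qform[OF fs, unfolded ff]
  show "(1 + m) * (\<integral>x. (norm (G (of_real x)))\<^sup>2 \<partial>lborel) \<le> (\<integral>x. (norm (G (of_real x)))\<^sup>2 * W x \<partial>lborel)"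
    unfolding *(3,4) using lo[OF *(1)] lo[OF *(2)] by (simp add: algebra_simps)
  show "(\<integral>x. (norm (G (of_real x)))\<^sup>2 * W x \<partial>lborel) \<le> (1 + M) * (\<integral>x. (norm (G (of_real x)))\<^sup>2 \<partial>lborel)"
    unfolding *(3,4) using hi[OF *(1)] hi[OF *(2)] by (simp add: algebra_simps)
qed

text \<open>The substitution \<open>x / (1 - d)\<close> moves the dilation from \<open>F\<close> to
  the bounded continuous factors; \<open>F\<close> stays fixed and supplies the dominating function.
  The factor \<open>1 - 1 / real (n + 2)\<close> is the Jacobian.\<close>

lemma damped_integral_tendsto:
  fixes F :: "complex \<Rightarrow> complex" and w :: "real \<Rightarrow> real"
  assumes int: "integrable lborel (\<lambda>x::real. (norm (F (of_real x)))\<^sup>2)"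
    and w: "continuous_on UNIV w" "\<And>x. \<bar>w x\<bar> \<le> K"
  shows "(\<lambda>n. (1 - 1 / real (n + 2)) *
      (\<integral>x. (norm (F (of_real (1 - 1 / real (n + 2)) * of_real x) * csinc (of_real (1 / real (n + 2) * \<tau> / 4) * of_real x) ^ 4))\<^sup>2 * w x \<partial>lborel))
    \<longlonglongrightarrow> (\<integral>x. (norm (F (of_real x)))\<^sup>2 * w x \<partial>lborel)"
proof -
  define d where "d n = 1 / real (n + 2)" for n
  have d: "0 < d n" "d n < 1" for n by (auto simp: d_def)
  have d0: "d \<longlonglongrightarrow> 0" unfolding d_def by real_asymp
  obtain S where S: "\<And>x. cmod (csinc (of_real x)) \<le> S" using csinc_real_bounded by blast
  have S0: "S \<ge> 0" using order.trans[OF norm_ge_zero S] .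
  have [measurable]: "w \<in> borel_measurable borel" using w(1) by (rule borel_measurable_continuous_onI)
  have [measurable]: "csinc \<in> borel_measurable borel"
    by (rule borel_measurable_continuous_onI[OF holomorphic_on_imp_continuous_on[OF csinc_holomorphic]])
  have [measurable]: "(\<lambda>x::real. (norm (F (of_real x)))\<^sup>2) \<in> borel_measurable borel"
    using borel_measurable_integrable[OF int] by simp
  define R where "R n x = (norm (F (of_real x)))\<^sup>2 * (cmod (csinc (of_real (d n * \<tau> / 4 * (x / (1 - d n))))) ^ 8 * w (x / (1 - d n)))" for n x
  have "(1 - d n) * (\<integral>x. (norm (F (of_real (1 - d n) * of_real x) * csinc (of_real (d n * \<tau> / 4) * of_real x) ^ 4))\<^sup>2 * w x \<partial>lborel) =
     (\<integral>x. R n x \<partial>lborel)" for n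
  proof -
    have "(\<integral>x. R n x \<partial>lborel) = \<bar>1 - d n\<bar> *\<^sub>R (\<integral>x. R n (0 + (1 - d n) * x) \<partial>lborel)"
      using d[of n] by (intro lborel_integral_real_affine) auto
    also have "(\<lambda>x. R n (0 + (1 - d n) * x)) =
        (\<lambda>x. (norm (F (of_real (1 - d n) * of_real x) * csinc (of_real (d n * \<tau> / 4) * of_real x) ^ 4))\<^sup>2 * w x)"
    proof
      fix x
      have e: "(0 + (1 - d n) * x) / (1 - d n) = x" using d[of n] by simp
      show "R n (0 + (1 - d n) * x) = (norm (F (of_real (1 - d n) * of_real x) * csinc (of_real (d n * \<tau> / 4) * of_real x) ^ 4))\<^sup>2 * w x"
        unfolding R_def e by (simp add: norm_mult norm_power power_mult_distrib mult.assoc flip: power_mult)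
    qed
    finally show ?thesis using d[of n] by simp
  qed
  moreover have "(\<lambda>n. \<integral>x. R n x \<partial>lborel) \<longlonglongrightarrow> (\<integral>x. (norm (F (of_real x)))\<^sup>2 * w x \<partial>lborel)"
  proof (rule integral_dominated_convergence[where w = "\<lambda>x. (norm (F (of_real x)))\<^sup>2 * (S ^ 8 * K)"])
    show "AE x in lborel. (\<lambda>n. R n x) \<longlonglongrightarrow> (norm (F (of_real x)))\<^sup>2 * w x"
    proof (rule AE_I2)
      fix x
      have a: "(\<lambda>n. x / (1 - d n)) \<longlonglongrightarrow> x / (1 - 0)" by (intro tendsto_intros d0) auto
      have "(\<lambda>n. d n * \<tau> / 4 * (x / (1 - d n))) \<longlonglongrightarrow> 0 * \<tau> / 4 * (x / (1 - 0))"
        by (intro tendsto_intros d0) auto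
      then have "(\<lambda>n. complex_of_real (d n * \<tau> / 4 * (x / (1 - d n)))) \<longlonglongrightarrow> 0"
        using tendsto_of_real[where 'a = complex] by fastforce
      moreover have "isCont csinc 0"
        using holomorphic_on_imp_continuous_on[OF csinc_holomorphic] by (simp add: continuous_on_eq_continuous_at)
      ultimately have c: "(\<lambda>n. csinc (of_real (d n * \<tau> / 4 * (x / (1 - d n))))) \<longlonglongrightarrow> csinc 0"
        by (rule isCont_tendsto_compose[rotated])
      have "isCont w x" using w(1) by (simp add: continuous_on_eq_continuous_at)
      then have wl: "(\<lambda>n. w (x / (1 - d n))) \<longlonglongrightarrow> w x"
        using a isCont_tendsto_compose[of x w] by fastforce
      have "(\<lambda>n. R n x) \<longlonglongrightarrow> (norm (F (of_real x)))\<^sup>2 * (cmod (csinc 0) ^ 8 * w x)"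
        unfolding R_def by (intro tendsto_intros c wl)
      then show "(\<lambda>n. R n x) \<longlonglongrightarrow> (norm (F (of_real x)))\<^sup>2 * w x" by (simp add: csinc_def)
    qed
    show "AE x in lborel. norm (R n x) \<le> (norm (F (of_real x)))\<^sup>2 * (S ^ 8 * K)" for n
    proof (rule AE_I2)
      fix x
      have "norm (R n x) = (norm (F (of_real x)))\<^sup>2 * (cmod (csinc (of_real (d n * \<tau> / 4 * (x / (1 - d n))))) ^ 8 * \<bar>w (x / (1 - d n))\<bar>)"
        unfolding R_def real_norm_def abs_mult by simp
      also have "\<dots> \<le> (norm (F (of_real x)))\<^sup>2 * (S ^ 8 * K)"
        using S0 by (intro mult_left_mono mult_mono power_mono S w(2)) auto
      finally show "norm (R n x) \<le> (norm (F (of_real x)))\<^sup>2 * (S ^ 8 * K)" .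
    qed
    show "R n \<in> borel_measurable lborel" for n unfolding R_def[abs_def] by measurable
  qed (use int in auto)
  ultimately show ?thesis by (simp only: d_def)
qed

text \<open>The Jacobian of \<open>damped_integral_tendsto\<close> is nonnegative and occurs on both
  sides, so the bounds for the damped functions pass to the limit.\<close>

lemma PW_weighted_bounds:
  assumes F: "F \<in> PW (pi * \<Delta>)" and \<Delta>: "\<Delta> > 0"
    and lo: "\<And>f. f \<in> supp_cont (\<Delta> / 2) \<Longrightarrow> m * (\<integral>s. (f s)\<^sup>2 \<partial>lborel) \<le> qform f"
    and hi: "\<And>f. f \<in> supp_cont (\<Delta> / 2) \<Longrightarrow> qform f \<le> M * (\<integral>s. (f s)\<^sup>2 \<partial>lborel)"
  shows "(1 + m) * (\<integral>x. (norm (F (of_real x)))\<^sup>2 \<partial>lborel) \<le> (\<integral>x. (norm (F (of_real x)))\<^sup>2 * W x \<partial>lborel)"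
    "(\<integral>x. (norm (F (of_real x)))\<^sup>2 * W x \<partial>lborel) \<le> (1 + M) * (\<integral>x. (norm (F (of_real x)))\<^sup>2 \<partial>lborel)"
proof -
  have int: "integrable lborel (\<lambda>x::real. (norm (F (of_real x)))\<^sup>2)" using F by (simp add: PW_def)
  define G where "G n z = F (of_real (1 - 1 / real (n + 2)) * z) * csinc (of_real (1 / real (n + 2) * (pi * \<Delta>) / 4) * z) ^ 4" for n :: nat and z
  have G: "strip_decay (G n) (2 * pi * (\<Delta> / 2))" for n
    unfolding G_def using PW_damped_strip_decay[OF F, of "1 / real (n + 2)"] \<Delta> by simp
  have a: "\<Delta> / 2 > 0" using \<Delta> by simp
  obtain K where K: "\<And>x. \<bar>W x\<bar> \<le> K" using W_bounded by blast
  have l1: "(\<lambda>n. (1 - 1 / real (n + 2)) * (\<integral>x. (norm (G n (of_real x)))\<^sup>2 * 1 \<partial>lborel)) \<longlonglongrightarrow> (\<integral>x. (norm (F (of_real x)))\<^sup>2 * 1 \<partial>lborel)"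
    unfolding G_def by (rule damped_integral_tendsto[OF int, where K = 1]) auto
  have lW: "(\<lambda>n. (1 - 1 / real (n + 2)) * (\<integral>x. (norm (G n (of_real x)))\<^sup>2 * W x \<partial>lborel)) \<longlonglongrightarrow> (\<integral>x. (norm (F (of_real x)))\<^sup>2 * W x \<partial>lborel)"
    unfolding G_def by (rule damped_integral_tendsto[OF int continuous_W K])
  have c: "1 - 1 / real (n + 2) \<ge> 0" for n by simp
  note b = strip_decay_qform_bounds[OF G a lo hi]
  show "(1 + m) * (\<integral>x. (norm (F (of_real x)))\<^sup>2 \<partial>lborel) \<le> (\<integral>x. (norm (F (of_real x)))\<^sup>2 * W x \<partial>lborel)"
  proof (rule LIMSEQ_le[OF _ lW])
    show "(\<lambda>n. (1 + m) * ((1 - 1 / real (n + 2)) * (\<integral>x. (norm (G n (of_real x)))\<^sup>2 * 1 \<partial>lborel))) \<longlonglongrightarrow> (1 + m) * (\<integral>x. (norm (F (of_real x)))\<^sup>2 \<partial>lborel)"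
      using tendsto_mult_left[OF l1, of "1 + m"] by simp
    show "\<exists>N. \<forall>n\<ge>N. (1 + m) * ((1 - 1 / real (n + 2)) * (\<integral>x. (norm (G n (of_real x)))\<^sup>2 * 1 \<partial>lborel))
        \<le> (1 - 1 / real (n + 2)) * (\<integral>x. (norm (G n (of_real x)))\<^sup>2 * W x \<partial>lborel)"
      using mult_left_mono[OF b(1) c] by (intro exI allI impI) (simp only: mult.left_commute mult_1_right)
  qed
  show "(\<integral>x. (norm (F (of_real x)))\<^sup>2 * W x \<partial>lborel) \<le> (1 + M) * (\<integral>x. (norm (F (of_real x)))\<^sup>2 \<partial>lborel)"
  proof (rule LIMSEQ_le[OF lW])
    show "(\<lambda>n. (1 + M) * ((1 - 1 / real (n + 2)) * (\<integral>x. (norm (G n (of_real x)))\<^sup>2 * 1 \<partial>lborel))) \<longlonglongrightarrow> (1 + M) * (\<integral>x. (norm (F (of_real x)))\<^sup>2 \<partial>lborel)"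
      using tendsto_mult_left[OF l1, of "1 + M"] by simp
    show "\<exists>N. \<forall>n\<ge>N. (1 - 1 / real (n + 2)) * (\<integral>x. (norm (G n (of_real x)))\<^sup>2 * W x \<partial>lborel)
        \<le> (1 + M) * ((1 - 1 / real (n + 2)) * (\<integral>x. (norm (G n (of_real x)))\<^sup>2 * 1 \<partial>lborel))"
      using mult_left_mono[OF b(2) c] by (intro exI allI impI) (simp only: mult.left_commute mult_1_right)
  qed
qed

section \<open>Positivity of norms and attained quotients\<close>

lemma continuous_AE_zero:
  fixes g :: "real \<Rightarrow> 'b::real_normed_vector"
  assumes c: "continuous_on S g" and S: "open S" and ae: "AE x in lborel. g x = 0" and x: "x \<in> S"
  shows "g x = 0"
proof (rule ccontr)
  assume nz: "g x \<noteq> 0"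
  define U where "U = S \<inter> g -` (- {0})"
  have o: "open U" unfolding U_def using c S by (simp add: continuous_on_open_vimage open_Compl Int_commute)
  have "AE y in lborel. y \<notin> U" using ae by eventually_elim (auto simp: U_def)
  then have "U \<in> null_sets lborel"
    using o by (subst AE_iff_null_sets) auto
  then have "negligible U" unfolding negligible_iff_null_sets by (rule null_sets_completionI)
  moreover have "U \<noteq> {}" using nz x by (auto simp: U_def)
  ultimately show False using open_not_negligible[OF o] by blast
qed

lemma entire_zero_on_real:
  assumes hol: "F holomorphic_on UNIV" and z: "\<And>x::real. F (of_real x) = 0"
  shows "F = (\<lambda>z. 0)"
proof
  fix w
  have lim: "0 islimpt (range complex_of_real)"
  proof (rule islimptI)
    fix T :: "complex set" assume "0 \<in> T" "open T"
    then obtain e where e: "e > 0" "ball 0 e \<subseteq> T" using open_contains_ball by blast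
    then have "complex_of_real (e / 2) \<in> T" by (auto simp: subset_iff)
    then show "\<exists>y\<in>range complex_of_real. y \<in> T \<and> y \<noteq> 0"
      using e by (intro bexI[OF _ rangeI[of _ "e / 2"]]) auto
  qed
  show "F w = 0"
    by (rule analytic_continuation[OF hol, of "range of_real" 0 w]) (use z lim in auto)
qed

lemma PW_norm_pos:
  assumes F: "F \<in> PW \<tau>" and nz: "F \<noteq> (\<lambda>z. 0)"
  shows "(\<integral>x. (norm (F (complex_of_real x)))\<^sup>2 \<partial>lborel) > 0"
proof -
  have hol: "F holomorphic_on UNIV" and int: "integrable lborel (\<lambda>x::real. (norm (F (of_real x)))\<^sup>2)"
    using F by (auto simp: PW_def)
  have c: "continuous_on UNIV (\<lambda>x::real. F (of_real x))"
    by (rule continuous_on_compose2[OF holomorphic_on_imp_continuous_on[OF hol]]) (auto intro!: continuous_intros)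
  have "(\<integral>x. (norm (F (complex_of_real x)))\<^sup>2 \<partial>lborel) \<noteq> 0"
  proof
    assume "(\<integral>x. (norm (F (complex_of_real x)))\<^sup>2 \<partial>lborel) = 0"
    then have "AE x in lborel. (norm (F (complex_of_real x)))\<^sup>2 = 0"
      using int by (subst (asm) integral_nonneg_eq_0_iff_AE) auto
    then have ae: "AE x in lborel. F (complex_of_real x) = 0" by simp
    have "F (of_real x) = 0" for x by (rule continuous_AE_zero[OF c open_UNIV ae]) simp
    then show False using entire_zero_on_real[OF hol] nz by blast
  qed
  moreover have "(\<integral>x. (norm (F (complex_of_real x)))\<^sup>2 \<partial>lborel) \<ge> 0" by simp
  ultimately show ?thesis by linarith
qed

text \<open>The transform of a function on a bounded interval makes sense at complex arguments and
  may be differentiated under the integral. This turns extremal functions of the form into elements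
  of the space.\<close>

lemma fourier_extends_to_PW:
  fixes f :: "real \<Rightarrow> complex"
  assumes f: "f \<in> supp_cont a" and a: "a > 0"
  obtains F where "F \<in> PW (2 * pi * a)" "\<And>x. F (of_real x) = fourier f x"
proof -
  define F where "F z = integral {- a..a} (\<lambda>t. f t * exp (\<i> * of_real (2 * pi * t) * z))" for z
  have cf: "continuous_on {- a..a} f" using f by (simp add: supp_cont_def)
  have ci: "(\<lambda>t. f t * exp (\<i> * of_real (2 * pi * t) * z)) integrable_on {- a..a}" for z
    by (intro integrable_continuous_real continuous_intros cf)
  have hol: "F holomorphic_on UNIV"
    unfolding F_def cbox_interval[symmetric]
  proof (rule leibniz_rule_holomorphic)
    show "((\<lambda>z. f t * exp (\<i> * of_real (2 * pi * t) * z)) has_field_derivative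
       f t * (exp (\<i> * of_real (2 * pi * t) * z) * (\<i> * of_real (2 * pi * t)))) (at z within UNIV)" for z t
      by (auto intro!: derivative_eq_intros)
    show "continuous_on (UNIV \<times> cbox (- a) a) (\<lambda>(z, t). f t * (exp (\<i> * of_real (2 * pi * t) * z) * (\<i> * of_real (2 * pi * t))))"
      unfolding split_beta cbox_interval
      by (intro continuous_intros continuous_on_compose2[OF cf]) auto
  qed (use ci in auto)
  have Fx: "F (of_real x) = fourier f x" for x
  proof -
    have si: "set_integrable lborel {- a..a} (\<lambda>t. f t * exp (\<i> * of_real (2 * pi * t) * of_real x))"
      by (intro borel_integrable_atLeastAtMost' continuous_intros cf)
    have "F (of_real x) = (LBINT t:{- a..a}. f t * exp (\<i> * of_real (2 * pi * t) * of_real x))"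
      unfolding F_def using set_borel_integral_eq_integral(2)[OF si] by simp
    also have "\<dots> = fourier f x"
      unfolding set_lebesgue_integral_def fourier_def
      using f by (intro Bochner_Integration.integral_cong) (auto simp: indicator_def supp_cont_def cis_conv_exp mult_ac)
    finally show ?thesis .
  qed
  obtain B where B: "B \<ge> 0" "\<And>x. norm (f x) \<le> B" using supp_cont_bounded[OF f] by blast
  have bd: "norm (F z) \<le> B * (2 * a) * exp (2 * pi * a * norm z)" for z
  proof -
    have "norm (F z) \<le> B * exp (2 * pi * a * norm z) * (a - (- a))"
      unfolding F_def
    proof (rule integral_bound)
      fix t assume t: "t \<in> {- a..a}"
      have "Re (\<i> * of_real (2 * pi * t) * z) \<le> norm (\<i> * of_real (2 * pi * t) * z)" by (rule complex_Re_le_cmod)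
      also have "\<dots> = 2 * pi * \<bar>t\<bar> * norm z" by (simp add: norm_mult)
      also have "\<dots> \<le> 2 * pi * a * norm z" using t by (intro mult_mono) auto
      finally show "norm (f t * exp (\<i> * of_real (2 * pi * t) * z)) \<le> B * exp (2 * pi * a * norm z)"
        unfolding norm_mult norm_exp_eq_Re using B by (intro mult_mono) auto
    qed (use a in \<open>auto intro!: continuous_intros cf\<close>)
    then show ?thesis by (simp add: mult_ac)
  qed
  have "exp_type_le F (2 * pi * a)"
    unfolding exp_type_le_def
  proof (intro allI impI exI)
    fix \<epsilon> :: real and z assume \<epsilon>: "\<epsilon> > 0"
    have "norm (F z) \<le> B * (2 * a) * exp (2 * pi * a * norm z)" by (rule bd)
    also have "\<dots> \<le> B * (2 * a) * exp ((2 * pi * a + \<epsilon>) * norm z)"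
      using B a \<epsilon> by (intro mult_left_mono) (auto simp: distrib_right)
    finally show "norm (F z) \<le> B * (2 * a) * exp ((2 * pi * a + \<epsilon>) * norm z)" .
  qed
  then have "F \<in> PW (2 * pi * a)"
    unfolding PW_def using hol integrable_fourier_norm_square[OF f] by (simp add: Fx)
  then show thesis using Fx by (rule that)
qed

lemma qform_zero: "qform (\<lambda>s. 0) = 0" by (simp add: qform_def)

lemma ratio_of_supp_cont:
  assumes f: "f \<in> supp_cont (\<Delta> / 2)" and \<Delta>: "\<Delta> > 0"
    and pos: "(\<integral>s. (f s)\<^sup>2 \<partial>lborel) > 0" and q: "qform f = m * (\<integral>s. (f s)\<^sup>2 \<partial>lborel)"
  shows "sqrt (1 + m) \<in> ratios \<Delta>"
proof -
  define g where "g s = complex_of_real (f s)" for s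
  have g: "g \<in> supp_cont (\<Delta> / 2)" using f by (auto simp: supp_cont_def g_def intro!: continuous_intros)
  obtain F where F: "F \<in> PW (2 * pi * (\<Delta> / 2))" "\<And>x. F (of_real x) = fourier g x"
    using fourier_extends_to_PW[OF g] \<Delta> by auto
  note * = fourier_weighted_qform[OF g]
  have N: "(\<integral>x. (norm (F (of_real x)))\<^sup>2 \<partial>lborel) = (\<integral>s. (f s)\<^sup>2 \<partial>lborel)"
    using *(3) by (simp add: F(2) g_def)
  have NW: "(\<integral>x. (norm (F (of_real x)))\<^sup>2 * W x \<partial>lborel) = (1 + m) * (\<integral>s. (f s)\<^sup>2 \<partial>lborel)"
    using *(4) q by (simp add: F(2) g_def qform_zero distrib_right)
  have "F \<noteq> (\<lambda>z. 0)" using N pos by auto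
  moreover have "L2normW F / L2norm F = sqrt (1 + m)"
    unfolding L2normW_def L2norm_def N NW using pos by (simp add: real_sqrt_mult)
  ultimately show ?thesis unfolding ratios_def using F(1) by (auto intro!: exI[of _ F])
qed

text \<open>The interface to the operator part: it remains to find sharp bounds of
  \<open>qform\<close> on \<open>supp_cont\<close> and functions that attain them.\<close>

lemma C_minus_C_plus_eq:
  assumes \<Delta>: "\<Delta> > 0"
    and lo: "\<And>f. f \<in> supp_cont (\<Delta> / 2) \<Longrightarrow> m * (\<integral>s. (f s)\<^sup>2 \<partial>lborel) \<le> qform f"
    and hi: "\<And>f. f \<in> supp_cont (\<Delta> / 2) \<Longrightarrow> qform f \<le> M * (\<integral>s. (f s)\<^sup>2 \<partial>lborel)"
    and f: "f \<in> supp_cont (\<Delta> / 2)" "(\<integral>s. (f s)\<^sup>2 \<partial>lborel) > 0" "qform f = m * (\<integral>s. (f s)\<^sup>2 \<partial>lborel)"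
    and g: "g \<in> supp_cont (\<Delta> / 2)" "(\<integral>s. (g s)\<^sup>2 \<partial>lborel) > 0" "qform g = M * (\<integral>s. (g s)\<^sup>2 \<partial>lborel)"
  shows "C_minus \<Delta> = sqrt (1 + m)" "C_plus \<Delta> = sqrt (1 + M)"
proof -
  have b: "sqrt (1 + m) \<le> r \<and> r \<le> sqrt (1 + M)" if rr: "r \<in> ratios \<Delta>" for r
  proof -
    obtain F where F: "F \<in> PW (pi * \<Delta>)" "F \<noteq> (\<lambda>z. 0)" and r: "r = L2normW F / L2norm F"
      using rr unfolding ratios_def by blast
    have p: "(\<integral>x. (norm (F (complex_of_real x)))\<^sup>2 \<partial>lborel) > 0" by (rule PW_norm_pos[OF F])
    have r': "r = sqrt ((\<integral>x. (norm (F (complex_of_real x)))\<^sup>2 * W x \<partial>lborel) / (\<integral>x. (norm (F (complex_of_real x)))\<^sup>2 \<partial>lborel))"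
      unfolding r L2normW_def L2norm_def by (simp add: real_sqrt_divide)
    note * = PW_weighted_bounds[OF F(1) \<Delta> lo hi]
    show ?thesis unfolding r' using * p
      by (simp add: pos_le_divide_eq pos_divide_le_eq)
  qed
  show "C_minus \<Delta> = sqrt (1 + m)"
    unfolding C_minus_def using b ratio_of_supp_cont[OF f(1) \<Delta> f(2,3)] by (intro cInf_eq_minimum) auto
  show "C_plus \<Delta> = sqrt (1 + M)"
    unfolding C_plus_def using b ratio_of_supp_cont[OF g(1) \<Delta> g(2,3)] by (intro cSup_eq_maximum) auto
qed

section \<open>The convolution operator on an interval\<close>

text \<open>The discriminant of a nonnegative quadratic polynomial. It is stated for numbers because
  it serves both the L2 inner product and the semidefinite form in
  \<open>residual_norm_bound\<close>.\<close>

lemma psd_cauchy_schwarz: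
  fixes A B C :: real
  assumes "\<And>t. 0 \<le> A + 2 * t * B + t\<^sup>2 * C" "0 \<le> C"
  shows "B\<^sup>2 \<le> A * C"
proof (cases "C = 0")
  case True
  have "B = 0"
  proof (rule ccontr)
    assume "B \<noteq> 0"
    \<comment> \<open>At this \<open>t\<close> the polynomial, now linear, takes the value
      \<open>- 1\<close>.\<close>
    then show False using assms(1)[of "- (A + 1) / (2 * B)"] True by (simp add: field_simps)
  qed
  then show ?thesis using True by simp
next
  case False
  then have C: "C > 0" using assms(2) by simp
  have "0 \<le> A + 2 * (- B / C) * B + (- B / C)\<^sup>2 * C" by (rule assms(1))
  also have "\<dots> = A - B\<^sup>2 / C" using C by (simp add: power2_eq_square field_simps)
  finally show ?thesis using C by (simp add: field_simps)
qed

lemma integral_cauchy_schwarz: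
  fixes f g :: "'a \<Rightarrow> real"
  assumes "integrable M (\<lambda>x. (f x)\<^sup>2)" "integrable M (\<lambda>x. (g x)\<^sup>2)" "integrable M (\<lambda>x. f x * g x)"
  shows "(\<integral>x. f x * g x \<partial>M)\<^sup>2 \<le> (\<integral>x. (f x)\<^sup>2 \<partial>M) * (\<integral>x. (g x)\<^sup>2 \<partial>M)"
proof (rule psd_cauchy_schwarz)
  fix t :: real
  have "0 \<le> (\<integral>x. (f x + t * g x)\<^sup>2 \<partial>M)" by simp
  also have "\<dots> = (\<integral>x. (f x)\<^sup>2 + 2 * t * (f x * g x) + t\<^sup>2 * (g x)\<^sup>2 \<partial>M)"
    by (intro Bochner_Integration.integral_cong) (auto simp: power2_eq_square algebra_simps)
  also have "\<dots> = (\<integral>x. (f x)\<^sup>2 \<partial>M) + 2 * t * (\<integral>x. f x * g x \<partial>M) + t\<^sup>2 * (\<integral>x. (g x)\<^sup>2 \<partial>M)"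
    using assms by simp
  finally show "0 \<le> (\<integral>x. (f x)\<^sup>2 \<partial>M) + 2 * t * (\<integral>x. f x * g x \<partial>M) + t\<^sup>2 * (\<integral>x. (g x)\<^sup>2 \<partial>M)" .
qed simp

abbreviation ip :: "(real \<Rightarrow> real) \<Rightarrow> (real \<Rightarrow> real) \<Rightarrow> real" where
  "ip f g \<equiv> (\<integral>s. f s * g s \<partial>lborel)"

text \<open>The primitive that vanishes at minus infinity. It lives on the whole line because the
  window ends \<open>s - 1\<close> and \<open>s + 1\<close> may leave the support.\<close>

definition prim :: "(real \<Rightarrow> real) \<Rightarrow> real \<Rightarrow> real" where
  "prim g x = (\<integral>t. indicator {..x} t * g t \<partial>lborel)"

text \<open>The operator T. Written through \<open>prim\<close>, its eigenvalue equation becomes a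
  differential equation with shifts.\<close>

definition Top :: "real \<Rightarrow> (real \<Rightarrow> real) \<Rightarrow> real \<Rightarrow> real" where
  "Top a g s = (if s \<in> {- a..a} then (prim g (s + 1) - prim g (s - 1)) / 2 else 0)"

lemma supp_cont_lin:
  fixes f g :: "real \<Rightarrow> real"
  assumes "f \<in> supp_cont a" "g \<in> supp_cont a"
  shows "(\<lambda>s. c * f s + d * g s) \<in> supp_cont a"
  using assms by (auto simp: supp_cont_def intro!: continuous_intros)

lemma supp_cont_ip_integrable:
  fixes f g :: "real \<Rightarrow> real"
  assumes "f \<in> supp_cont a" "g \<in> supp_cont a"
  shows "integrable lborel (\<lambda>s. f s * g s)" "integrable lborel (\<lambda>s. (f s)\<^sup>2)"
  using supp_cont_mult_integrable[OF assms, of 0] supp_cont_mult_integrable[OF assms(1) assms(1), of 0]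
  by (auto simp: power2_eq_square)

lemma supp_cont_indicator_integrable:
  fixes f :: "real \<Rightarrow> real"
  assumes "f \<in> supp_cont a" and [measurable]: "A \<in> sets borel"
  shows "integrable lborel (\<lambda>t. indicator A t * f t)"
  using integrable_mult_indicator[OF _ supp_cont_integrable[OF assms(1)], of A] by simp

lemma ip_lin_right:
  fixes f g h :: "real \<Rightarrow> real"
  assumes "f \<in> supp_cont a" "g \<in> supp_cont a" "h \<in> supp_cont a"
  shows "ip f (\<lambda>s. c * g s + d * h s) = c * ip f g + d * ip f h"
proof -
  have "ip f (\<lambda>s. c * g s + d * h s) = (\<integral>s. c * (f s * g s) + d * (f s * h s) \<partial>lborel)"
    by (simp add: algebra_simps)
  also have "\<dots> = c * ip f g + d * ip f h"
    using supp_cont_ip_integrable(1)[OF assms(1,2)] supp_cont_ip_integrable(1)[OF assms(1,3)] by simp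
  finally show ?thesis .
qed

lemma prim_diff:
  assumes g: "g \<in> supp_cont a" and xy: "x \<le> y"
  shows "prim g y - prim g x = (\<integral>t. indicator {x<..y} t * g t \<partial>lborel)"
proof -
  have "prim g y - prim g x = (\<integral>t. indicator {..y} t * g t - indicator {..x} t * g t \<partial>lborel)"
    unfolding prim_def
    by (intro Bochner_Integration.integral_diff[symmetric] supp_cont_indicator_integrable[OF g]) auto
  also have "\<dots> = (\<integral>t. indicator {x<..y} t * g t \<partial>lborel)"
    using xy by (intro Bochner_Integration.integral_cong) (auto simp: indicator_def)
  finally show ?thesis .
qed

lemma prim_lin:
  assumes f: "f \<in> supp_cont a" and g: "g \<in> supp_cont a"
  shows "prim (\<lambda>s. c * f s + d * g s) x = c * prim f x + d * prim g x"
proof -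
  have "prim (\<lambda>s. c * f s + d * g s) x = (\<integral>t. c * (indicator {..x} t * f t) + d * (indicator {..x} t * g t) \<partial>lborel)"
    unfolding prim_def by (simp add: algebra_simps)
  also have "\<dots> = c * prim f x + d * prim g x"
    unfolding prim_def using supp_cont_indicator_integrable[OF f] supp_cont_indicator_integrable[OF g] by simp
  finally show ?thesis .
qed

lemma Top_lin:
  assumes f: "f \<in> supp_cont a" and g: "g \<in> supp_cont a"
  shows "Top a (\<lambda>s. c * f s + d * g s) x = c * Top a f x + d * Top a g x"
  unfolding Top_def prim_lin[OF f g] by (simp add: field_simps)

text \<open>Cauchy-Schwarz against the indicator of an interval. The resulting Hoelder exponent 1/2
  is the source of both the uniform bound and the equicontinuity of the functions
  \<open>Top a g\<close>.\<close>

lemma prim_diff_square_le: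
  assumes g: "g \<in> supp_cont a"
  shows "(prim g y - prim g x)\<^sup>2 \<le> \<bar>y - x\<bar> * ip g g"
proof -
  have *: "(prim g y - prim g x)\<^sup>2 \<le> (y - x) * ip g g" if xy: "x \<le> y" for x y
  proof -
    have i: "integrable lborel (\<lambda>t. (indicat_real {x<..y} t)\<^sup>2)"
      "(\<integral>t. (indicat_real {x<..y} t)\<^sup>2 \<partial>lborel) = y - x"
    proof -
      have e: "(\<lambda>t. (indicat_real {x<..y} t)\<^sup>2) = indicat_real {x<..y}" by (auto simp: indicator_def)
      show "integrable lborel (\<lambda>t. (indicat_real {x<..y} t)\<^sup>2)"
        unfolding e using xy by (intro integrable_real_indicator) auto
      show "(\<integral>t. (indicat_real {x<..y} t)\<^sup>2 \<partial>lborel) = y - x"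
        unfolding e using xy by simp
    qed
    have "(\<integral>t. indicator {x<..y} t * g t \<partial>lborel)\<^sup>2 \<le> (\<integral>t. (indicat_real {x<..y} t)\<^sup>2 \<partial>lborel) * (\<integral>t. (g t)\<^sup>2 \<partial>lborel)"
      using supp_cont_ip_integrable(2)[OF g g] supp_cont_indicator_integrable[OF g] i
      by (intro integral_cauchy_schwarz) auto
    then show ?thesis unfolding prim_diff[OF g xy] i by (simp add: power2_eq_square)
  qed
  show ?thesis
  proof (cases "x \<le> y")
    case True
    then show ?thesis using *[of x y] by simp
  next
    case False
    then show ?thesis using *[of y x] by (simp add: power2_commute)
  qed
qed

lemma Top_square_le:
  assumes g: "g \<in> supp_cont a"
  shows "(Top a g s)\<^sup>2 \<le> ip g g / 2"
proof (cases "s \<in> {- a..a}")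
  case True
  then show ?thesis using prim_diff_square_le[OF g, of "s + 1" "s - 1"] by (simp add: Top_def power_divide)
qed (auto simp: Top_def)

lemma Top_diff_le:
  assumes g: "g \<in> supp_cont a" and s: "s \<in> {- a..a}" "t \<in> {- a..a}"
  shows "\<bar>Top a g s - Top a g t\<bar> \<le> sqrt (\<bar>s - t\<bar> * ip g g)"
proof -
  have 1: "\<bar>prim g (s + c) - prim g (t + c)\<bar> \<le> sqrt (\<bar>s - t\<bar> * ip g g)" for c
    using prim_diff_square_le[OF g, of "s + c" "t + c"] by (intro real_le_rsqrt) (simp add: power2_abs)
  have "Top a g s - Top a g t = ((prim g (s + 1) - prim g (t + 1)) - (prim g (s + - 1) - prim g (t + - 1))) / 2"
    using s by (simp add: Top_def field_simps)
  then show ?thesis using 1[of 1] 1[of "- 1"] by (simp add: abs_le_iff field_simps)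
qed

lemma Top_supp_cont:
  assumes g: "g \<in> supp_cont a"
  shows "Top a g \<in> supp_cont a"
proof -
  have "continuous_on {- a..a} (Top a g)"
    unfolding continuous_on_def
  proof
    fix x assume x: "x \<in> {- a..a}"
    have "((\<lambda>y. sqrt (\<bar>y - x\<bar> * ip g g)) \<longlongrightarrow> sqrt (\<bar>x - x\<bar> * ip g g)) (at x within {- a..a})"
      by (intro tendsto_intros)
    then have "((\<lambda>y. sqrt (\<bar>y - x\<bar> * ip g g)) \<longlongrightarrow> 0) (at x within {- a..a})" by simp
    then have "((\<lambda>y. Top a g y - Top a g x) \<longlongrightarrow> 0) (at x within {- a..a})"
    proof (rule Lim_null_comparison[rotated])
      show "\<forall>\<^sub>F y in at x within {- a..a}. norm (Top a g y - Top a g x) \<le> sqrt (\<bar>y - x\<bar> * ip g g)"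
        unfolding eventually_at_filter using Top_diff_le[OF g] x by (intro always_eventually) auto
    qed
    then show "(Top a g \<longlongrightarrow> Top a g x) (at x within {- a..a})" by (simp add: LIM_zero_iff)
  qed
  then show ?thesis by (auto simp: supp_cont_def Top_def)
qed

text \<open>The polarisation of \<open>qform\<close>; its invariance under \<open>u\<close> to
  \<open>- u\<close> will give the self-adjointness of \<open>Top\<close>.\<close>

definition bform :: "(real \<Rightarrow> real) \<Rightarrow> (real \<Rightarrow> real) \<Rightarrow> real" where
  "bform f g = (\<integral>u. indicator {- 1..1} u * (\<integral>s. f s * g (s + u) \<partial>lborel) \<partial>lborel) / 2"

lemma bform_sym: "bform f g = bform g f"
proof -
  have "(\<integral>s. f s * g (s + u) \<partial>lborel) = (\<integral>s. g s * f (s + - u) \<partial>lborel)" for u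
    using lborel_integral_real_affine[of 1 "\<lambda>s. f s * g (s + u)" "- u"] by (simp add: mult.commute add.commute)
  then have "(\<integral>u. indicator {- 1..1} u * (\<integral>s. f s * g (s + u) \<partial>lborel) \<partial>lborel) =
     (\<integral>u. indicator {- 1..1} u * (\<integral>s. g s * f (s + - u) \<partial>lborel) \<partial>lborel)" by simp
  also have "\<dots> = (\<integral>u. indicator {- 1..1} (- u) * (\<integral>s. g s * f (s + u) \<partial>lborel) \<partial>lborel)"
    using lborel_integral_real_affine[of "- 1" "\<lambda>u. indicator {- 1..1} u * (\<integral>s. g s * f (s + - u) \<partial>lborel)" 0] by simp
  also have "\<dots> = (\<integral>u. indicator {- 1..1} u * (\<integral>s. g s * f (s + u) \<partial>lborel) \<partial>lborel)"
    by (intro Bochner_Integration.integral_cong) (auto simp: indicator_def)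
  finally show ?thesis by (simp add: bform_def)
qed

lemma bform_eq_ip_Top:
  assumes f: "f \<in> supp_cont a" and g: "g \<in> supp_cont a"
  shows "bform f g = ip f (Top a g)"
proof -
  have [measurable]: "f \<in> borel_measurable borel" "g \<in> borel_measurable borel"
    using supp_cont_measurable f g by auto
  have int: "integrable (lborel \<Otimes>\<^sub>M lborel) (\<lambda>(u, s). indicator {- 1..1} u * (f s * g (s + u)))"
  proof (rule lborel_pair.Fubini_integrable)
    show "integrable lborel (\<lambda>u. \<integral>s. norm (case (u, s) of (u, s) \<Rightarrow> indicator {- 1..1} u * (f s * g (s + u))) \<partial>lborel)"
    proof -
      have "(\<lambda>s. \<bar>f s\<bar>) \<in> supp_cont a" "(\<lambda>s. \<bar>g s\<bar>) \<in> supp_cont a"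
        using f g by (auto simp: supp_cont_def intro!: continuous_intros)
      from integrable_indicator_autocorrelation[OF this]
      show ?thesis by (simp add: abs_mult)
    qed
    show "AE u in lborel. integrable lborel (\<lambda>s. case (u, s) of (u, s) \<Rightarrow> indicator {- 1..1} u * (f s * g (s + u)))"
      using supp_cont_mult_integrable[OF f g] by simp
  qed measurable
  have "(\<integral>u. indicator {- 1..1} u * (\<integral>s. f s * g (s + u) \<partial>lborel) \<partial>lborel) =
     (\<integral>u. (\<integral>s. indicator {- 1..1} u * (f s * g (s + u)) \<partial>lborel) \<partial>lborel)" by simp
  also have "\<dots> = (\<integral>s. (\<integral>u. indicator {- 1..1} u * (f s * g (s + u)) \<partial>lborel) \<partial>lborel)"
    using lborel_pair.Fubini_integral[OF int] by simp
  also have "\<dots> = (\<integral>s. f s * (2 * Top a g s) \<partial>lborel)"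
  proof (intro Bochner_Integration.integral_cong refl)
    fix s
    show "(\<integral>u. indicator {- 1..1} u * (f s * g (s + u)) \<partial>lborel) = f s * (2 * Top a g s)"
    proof (cases "s \<in> {- a..a}")
      case False
      then have "f s = 0" using f by (simp add: supp_cont_def)
      then show ?thesis by simp
    next
      case True
      have "(\<integral>u. indicator {- 1..1} u * (f s * g (s + u)) \<partial>lborel) = f s * (\<integral>u. indicator {- 1..1} u * g (s + u) \<partial>lborel)"
        by (simp add: mult.left_commute)
      also have "(\<integral>u. indicator {- 1..1} u * g (s + u) \<partial>lborel) = (\<integral>u. indicator {- 1..1} (- s + u) * g u \<partial>lborel)"
        using lborel_integral_real_affine[of 1 "\<lambda>u. indicator {- 1..1} u * g (s + u)" "- s"] by simp
      also have "\<dots> = (\<integral>t. indicator {s - 1<..s + 1} t * g t \<partial>lborel)"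
      proof (rule integral_cong_AE)
        \<comment> \<open>The closed window and the half-open one of \<open>prim_diff\<close> differ
          in a single point.\<close>
        show "AE t in lborel. indicator {- 1..1} (- s + t) * g t = indicator {s - 1<..s + 1} t * g t"
          using AE_lborel_singleton[of "s - 1"] by eventually_elim (auto simp: indicator_def)
      qed measurable
      also have "\<dots> = 2 * Top a g s"
        using True prim_diff[OF g, of "s - 1" "s + 1"] by (simp add: Top_def)
      finally show ?thesis .
    qed
  qed
  also have "\<dots> = (\<integral>s. 2 * (f s * Top a g s) \<partial>lborel)"
    by (intro Bochner_Integration.integral_cong) auto
  also have "\<dots> = 2 * ip f (Top a g)" by simp
  finally show ?thesis by (simp add: bform_def)
qed

lemma qform_eq_ip_Top:
  assumes f: "f \<in> supp_cont a"
  shows "qform f = ip f (Top a f)"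
  using bform_eq_ip_Top[OF f f] by (simp add: bform_def qform_def)

lemma ip_Top_sym:
  assumes f: "f \<in> supp_cont a" and g: "g \<in> supp_cont a"
  shows "ip f (Top a g) = ip g (Top a f)"
  using bform_eq_ip_Top[OF f g] bform_eq_ip_Top[OF g f] bform_sym by metis

lemma ip_le_sup_bound:
  assumes g: "g \<in> supp_cont a" and a: "a > 0" and b: "\<And>s. s \<in> {- a..a} \<Longrightarrow> (g s)\<^sup>2 \<le> K"
  shows "ip g g \<le> 2 * a * K"
proof -
  have "(\<integral>s. (g s)\<^sup>2 \<partial>lborel) \<le> (\<integral>s. indicator {- a..a} s * K \<partial>lborel)"
  proof (rule integral_mono)
    show "integrable lborel (\<lambda>s. (g s)\<^sup>2)" by (rule supp_cont_ip_integrable(2)[OF g g])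
    show "integrable lborel (\<lambda>s. indicator {- a..a} s * K)"
      using a by (intro integrable_mult_left integrable_real_indicator) auto
    show "(g s)\<^sup>2 \<le> indicator {- a..a} s * K" for s
      using b[of s] g by (auto simp: indicator_def supp_cont_def)
  qed
  also have "\<dots> = 2 * a * K" using a by simp
  finally show ?thesis by (simp add: power2_eq_square)
qed

text \<open>The pointwise bound \<open>(Top a f s)^2 <= ip f f / 2\<close> over an interval of
  length \<open>2 * a\<close> gives \<open>Top\<close> a norm of at most
  \<open>sqrt a\<close>.\<close>

lemma qform_abs_le:
  assumes f: "f \<in> supp_cont a" and a: "a > 0"
  shows "\<bar>qform f\<bar> \<le> sqrt a * ip f f"
proof -
  have T: "Top a f \<in> supp_cont a" by (rule Top_supp_cont[OF f])
  have p: "ip f f \<ge> 0" by simp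
  have "(qform f)\<^sup>2 \<le> ip f f * ip (Top a f) (Top a f)"
    unfolding qform_eq_ip_Top[OF f]
    using integral_cauchy_schwarz[OF supp_cont_ip_integrable(2)[OF f f] supp_cont_ip_integrable(2)[OF T T] supp_cont_ip_integrable(1)[OF f T]]
    by (simp add: power2_eq_square)
  also have "\<dots> \<le> ip f f * (2 * a * (ip f f / 2))"
    using p ip_le_sup_bound[OF T a Top_square_le[OF f]] by (intro mult_left_mono) auto
  also have "\<dots> = (sqrt a * ip f f)\<^sup>2" using a by (simp add: power_mult_distrib) (simp add: power2_eq_square)
  finally have "\<bar>qform f\<bar>\<^sup>2 \<le> (sqrt a * ip f f)\<^sup>2" by simp
  then show ?thesis by (rule power2_le_imp_le) (use a p in simp)
qed

section \<open>Extremal eigenvalues\<close>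

lemma ip_lin_left:
  fixes f g h :: "real \<Rightarrow> real"
  assumes "f \<in> supp_cont a" "g \<in> supp_cont a" "h \<in> supp_cont a"
  shows "ip (\<lambda>s. c * g s + d * h s) f = c * ip g f + d * ip h f"
  using ip_lin_right[OF assms, of c d] by (simp add: mult.commute)

lemma ip_sum_le:
  fixes g h :: "real \<Rightarrow> real"
  assumes g: "g \<in> supp_cont a" and h: "h \<in> supp_cont a"
  shows "ip (\<lambda>s. g s + c * h s) (\<lambda>s. g s + c * h s) \<le> 2 * ip g g + 2 * c\<^sup>2 * ip h h"
proof -
  have gh: "(\<lambda>s. g s + c * h s) \<in> supp_cont a" using supp_cont_lin[OF g h, of 1 c] by simp
  have "(\<integral>s. (g s + c * h s)\<^sup>2 \<partial>lborel) \<le> (\<integral>s. 2 * (g s)\<^sup>2 + 2 * c\<^sup>2 * (h s)\<^sup>2 \<partial>lborel)"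
  proof (rule integral_mono)
    show "integrable lborel (\<lambda>s. (g s + c * h s)\<^sup>2)" by (rule supp_cont_ip_integrable(2)[OF gh gh])
    show "integrable lborel (\<lambda>s. 2 * (g s)\<^sup>2 + 2 * c\<^sup>2 * (h s)\<^sup>2)"
      using supp_cont_ip_integrable(2)[OF g g] supp_cont_ip_integrable(2)[OF h h] by simp
    show "(g s + c * h s)\<^sup>2 \<le> 2 * (g s)\<^sup>2 + 2 * c\<^sup>2 * (h s)\<^sup>2" for s
      using zero_le_power2[of "g s - c * h s"] by (simp add: power2_eq_square algebra_simps)
  qed
  also have "\<dots> = 2 * (\<integral>s. (g s)\<^sup>2 \<partial>lborel) + 2 * c\<^sup>2 * (\<integral>s. (h s)\<^sup>2 \<partial>lborel)"
    using supp_cont_ip_integrable(2)[OF g g] supp_cont_ip_integrable(2)[OF h h] by simp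
  finally show ?thesis by (simp add: power2_eq_square)
qed

lemma qform_scale: "qform (\<lambda>s. c * f s) = c\<^sup>2 * qform f"
proof -
  have "(\<integral>s. c * f s * (c * f (s + u)) \<partial>lborel) = c\<^sup>2 * (\<integral>s. f s * f (s + u) \<partial>lborel)" for u
    by (simp add: power2_eq_square mult_ac flip: integral_mult_right_zero)
  then show ?thesis by (simp add: qform_def mult.left_commute)
qed

text \<open>\<open>D\<close> is the form of the operator \<open>l - \<sigma> * T\<close>,
  nonnegative by \<open>ub\<close>, and \<open>r\<close> is that operator applied to
  \<open>f\<close>. Cauchy-Schwarz for \<open>D\<close> gives
  \<open>(ip r r)^2 = (D r f)^2 <= D f f * D r r\<close>, and
  \<open>D r r <= (l + sqrt a) * ip r r\<close>. So functions close to extremal are close to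
  eigenfunctions.\<close>

lemma residual_norm_bound:
  assumes a: "a > 0" and \<sigma>: "\<sigma>\<^sup>2 = (1::real)" and l: "l \<ge> 0"
    and ub: "\<And>f. f \<in> supp_cont a \<Longrightarrow> \<sigma> * qform f \<le> l * ip f f"
    and f: "f \<in> supp_cont a"
  defines "r \<equiv> \<lambda>s. l * f s + - \<sigma> * Top a f s"
  shows "ip r r \<le> (l + sqrt a) * (l * ip f f - \<sigma> * qform f)"
proof -
  have T: "Top a f \<in> supp_cont a" by (rule Top_supp_cont[OF f])
  have r: "r \<in> supp_cont a" unfolding r_def by (rule supp_cont_lin[OF f T])
  define D where "D g h = l * ip g h - \<sigma> * ip g (Top a h)" for g h
  have Dpos: "D g g \<ge> 0" if "g \<in> supp_cont a" for g
    using ub[OF that] qform_eq_ip_Top[OF that] by (simp add: D_def)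
  have Drf: "D r f = ip r r"
  proof -
    have "ip r r = l * ip r f + - \<sigma> * ip r (Top a f)"
      using ip_lin_right[OF r f T, of l "- \<sigma>"] unfolding r_def by simp
    then show ?thesis by (simp add: D_def)
  qed
  have "(D r f)\<^sup>2 \<le> D f f * D r r"
  proof (rule psd_cauchy_schwarz)
    fix t :: real
    define g where "g s = 1 * f s + t * r s" for s
    have g: "g \<in> supp_cont a" unfolding g_def by (rule supp_cont_lin[OF f r])
    have Tg: "Top a g = (\<lambda>s. 1 * Top a f s + t * Top a r s)"
      using Top_lin[OF f r, of 1 t] by (auto simp: g_def[abs_def])
    note Tr = Top_supp_cont[OF r]
    have "0 \<le> D g g" by (rule Dpos[OF g])
    also have "ip g g = ip f f + 2 * t * ip r f + t\<^sup>2 * ip r r"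
    proof -
      have "ip g g = ip g f + t * ip g r"
        using ip_lin_right[OF g f r, of 1 t] unfolding g_def by simp
      also have "ip g f = ip f f + t * ip r f"
        using ip_lin_left[OF f f r, of 1 t] unfolding g_def by simp
      also have "ip g r = ip f r + t * ip r r"
        using ip_lin_left[OF r f r, of 1 t] unfolding g_def by simp
      also have "ip f r = ip r f" by (simp add: mult.commute)
      finally show ?thesis by (simp add: power2_eq_square algebra_simps)
    qed
    moreover have "ip g (Top a g) = ip f (Top a f) + 2 * t * ip r (Top a f) + t\<^sup>2 * ip r (Top a r)"
    proof -
      have "ip g (Top a g) = ip g (Top a f) + t * ip g (Top a r)"
        unfolding Tg using ip_lin_right[OF g T Tr, of 1 t] by simp
      also have "ip g (Top a f) = ip f (Top a f) + t * ip r (Top a f)"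
        using ip_lin_left[OF T f r, of 1 t] unfolding g_def by simp
      also have "ip g (Top a r) = ip f (Top a r) + t * ip r (Top a r)"
        using ip_lin_left[OF Tr f r, of 1 t] unfolding g_def by simp
      also have "ip f (Top a r) = ip r (Top a f)" by (rule ip_Top_sym[OF f r])
      finally show ?thesis by (simp add: power2_eq_square algebra_simps)
    qed
    ultimately show "0 \<le> D f f + 2 * t * D r f + t\<^sup>2 * D r r"
      by (simp add: D_def algebra_simps)
  qed (rule Dpos[OF r])
  moreover have "D r r \<le> (l + sqrt a) * ip r r"
  proof -
    have "\<bar>\<sigma>\<bar> = 1" using \<sigma> by (simp add: power2_eq_1_iff abs_if split: if_splits) linarith
    then have "\<bar>\<sigma> * qform r\<bar> \<le> sqrt a * ip r r" using qform_abs_le[OF r a] by (simp add: abs_mult)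
    then show ?thesis unfolding D_def qform_eq_ip_Top[OF r, symmetric] by (simp add: distrib_right)
  qed
  ultimately have *: "(ip r r)\<^sup>2 \<le> D f f * ((l + sqrt a) * ip r r)"
    unfolding Drf using Dpos[OF f] by (meson mult_left_mono order.trans)
  have "ip r r \<le> (l + sqrt a) * D f f"
  proof (cases "ip r r = 0")
    case True
    then show ?thesis using Dpos[OF f] l a by simp
  next
    case False
    have "ip r r \<ge> 0" by simp
    then have p: "ip r r > 0" using False by linarith
    have "ip r r * ip r r \<le> ((l + sqrt a) * D f f) * ip r r"
      using * by (simp add: power2_eq_square mult_ac)
    then show ?thesis using p by (simp only: mult_le_cancel_right_pos)
  qed
  then show ?thesis by (simp only: D_def qform_eq_ip_Top[OF f])
qed

(* The sign \<sigma> = 1 or -1 selects the largest or the smallest value of the quadratic form. *)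
definition extremal_eigenpair :: "real \<Rightarrow> real \<Rightarrow> real \<Rightarrow> (real \<Rightarrow> real) \<Rightarrow> bool" where
  "extremal_eigenpair a \<sigma> \<eta> h \<longleftrightarrow> h \<in> supp_cont a \<and> ip h h > 0 \<and> (\<forall>s. Top a h s = \<eta> * h s) \<and>
     \<sigma> * \<eta> > 0 \<and> (\<forall>f\<in>supp_cont a. \<sigma> * qform f \<le> \<sigma> * \<eta> * ip f f)"

text \<open>For a maximising sequence the functions \<open>Top a (f n)\<close> are bounded and
  equicontinuous, so Arzela-Ascoli gives a uniform limit \<open>h\<close> along a subsequence. Small
  residuals force \<open>l * f\<close> close to \<open>\<sigma> * h\<close> in norm, and applying
  \<open>Top\<close> once more yields the eigenvalue equation.\<close>

lemma extremal_eigenpair_exists: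
  assumes a: "a > 0" and \<sigma>: "\<sigma>\<^sup>2 = (1::real)"
    and f0: "f0 \<in> supp_cont a" "\<sigma> * qform f0 > 0"
  shows "\<exists>\<eta> h. extremal_eigenpair a \<sigma> \<eta> h"
proof -
  have \<sigma>1: "\<bar>\<sigma>\<bar> = 1" using \<sigma> by (simp add: power2_eq_1_iff abs_if split: if_splits) linarith
  have qb: "\<sigma> * qform f \<le> sqrt a * ip f f" if "f \<in> supp_cont a" for f
    using qform_abs_le[OF that a] \<sigma>1 by (metis abs_le_D1 abs_mult mult_1)
  have ip0: "ip f f \<ge> 0" for f by simp
  have normalise: "\<exists>g. g \<in> supp_cont a \<and> ip g g = 1 \<and> \<sigma> * qform f = ip f f * (\<sigma> * qform g)"
    if f: "f \<in> supp_cont a" and p: "ip f f > 0" for f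
  proof (intro exI conjI)
    define c where "c = 1 / sqrt (ip f f)"
    have c2: "c\<^sup>2 = 1 / ip f f" using p by (simp add: c_def power_divide)
    show "(\<lambda>s. c * f s) \<in> supp_cont a" using supp_cont_lin[OF f f, of c 0] by simp
    have "ip (\<lambda>s. c * f s) (\<lambda>s. c * f s) = (\<integral>s. c\<^sup>2 * (f s * f s) \<partial>lborel)"
      by (simp add: power2_eq_square mult_ac)
    also have "\<dots> = c\<^sup>2 * ip f f" by simp
    finally show "ip (\<lambda>s. c * f s) (\<lambda>s. c * f s) = 1" using p c2 by simp
    show "\<sigma> * qform f = ip f f * (\<sigma> * qform (\<lambda>s. c * f s))" unfolding qform_scale c2 using p by simp
  qed
  define S where "S = {\<sigma> * qform f | f. f \<in> supp_cont a \<and> ip f f = 1}"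
  define l where "l = Sup S"
  have bdd: "bdd_above S" unfolding S_def by (rule bdd_aboveI[of _ "sqrt a"]) (use qb in force)
  have ub: "\<sigma> * qform f \<le> l * ip f f" if f: "f \<in> supp_cont a" for f
  proof (cases "ip f f = 0")
    case True
    then show ?thesis using qb[OF f] by simp
  next
    case False
    then have p: "ip f f > 0" using ip0[of f] by linarith
    obtain g where g: "g \<in> supp_cont a" "ip g g = 1" "\<sigma> * qform f = ip f f * (\<sigma> * qform g)"
      using normalise[OF f p] by blast
    then have "\<sigma> * qform g \<le> l" unfolding l_def by (intro cSup_upper bdd) (auto simp: S_def)
    then show ?thesis unfolding g(3) using p by (simp add: mult.commute)
  qed
  have p0: "ip f0 f0 > 0"
    using qb[OF f0(1)] f0(2) ip0[of f0] a by (metis less_eq_real_def mult_zero_right not_less)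
  have lpos: "l > 0"
  proof (rule ccontr)
    assume "\<not> l > 0"
    then have "l * ip f0 f0 \<le> 0" using p0 by (simp add: mult_nonpos_nonneg)
    then show False using ub[OF f0(1)] f0(2) by linarith
  qed
  have Sne: "S \<noteq> {}" using normalise[OF f0(1) p0] by (auto simp: S_def)
  have "\<exists>f. f \<in> supp_cont a \<and> ip f f = 1 \<and> l - 1 / real (Suc n) < \<sigma> * qform f" for n
  proof -
    have "l - 1 / real (Suc n) < Sup S" by (simp add: l_def)
    then obtain x where "x \<in> S" "l - 1 / real (Suc n) < x" using less_cSup_iff[OF Sne bdd] by blast
    then show ?thesis by (auto simp: S_def)
  qed
  then obtain f where f: "\<And>n. f n \<in> supp_cont a" "\<And>n. ip (f n) (f n) = 1"
      "\<And>n::nat. l - 1 / real (Suc n) < \<sigma> * qform (f n)"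
    by metis
  define r where "r n s = l * f n s + - \<sigma> * Top a (f n) s" for n s
  have Tf: "Top a (f n) \<in> supp_cont a" for n by (rule Top_supp_cont[OF f(1)])
  have r: "r n \<in> supp_cont a" for n unfolding r_def by (rule supp_cont_lin[OF f(1) Tf])
  have rb: "ip (r n) (r n) \<le> (l + sqrt a) * (1 / real (Suc n))" for n
  proof -
    have "ip (r n) (r n) \<le> (l + sqrt a) * (l * ip (f n) (f n) - \<sigma> * qform (f n))"
      unfolding r_def using lpos by (intro residual_norm_bound[OF a \<sigma> _ ub f(1)]) auto
    also have "\<dots> \<le> (l + sqrt a) * (1 / real (Suc n))"
      using f(3)[of n] lpos a unfolding f(2) by (intro mult_left_mono) auto
    finally show ?thesis .
  qed
  obtain h0 k where h0: "continuous_on {- a..a} h0" and k: "strict_mono (k :: nat \<Rightarrow> nat)"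
    and conv: "\<And>e. 0 < e \<Longrightarrow> \<exists>N. \<forall>n x. n \<ge> N \<and> x \<in> {- a..a} \<longrightarrow> norm (Top a (f (k n)) x - h0 x) < e"
  proof (rule Arzela_Ascoli[of "{- a..a}" "\<lambda>n. Top a (f n)" 1])
    show "norm (Top a (f n) x) \<le> 1" for n x
    proof (rule power2_le_imp_le)
      show "(norm (Top a (f n) x))\<^sup>2 \<le> 1\<^sup>2" using Top_square_le[OF f(1)[of n], of x] by (simp add: f(2))
    qed simp
    fix x e :: real assume x: "x \<in> {- a..a}" and e: "0 < e"
    show "\<exists>d>0. \<forall>n y. y \<in> {- a..a} \<and> norm (x - y) < d \<longrightarrow> norm (Top a (f n) x - Top a (f n) y) < e"
    proof (intro exI[of _ "e\<^sup>2"] conjI allI impI; (elim conjE)?)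
      fix n y assume y: "y \<in> {- a..a}" "norm (x - y) < e\<^sup>2"
      have "norm (Top a (f n) x - Top a (f n) y) \<le> sqrt (\<bar>x - y\<bar> * 1)"
        using Top_diff_le[OF f(1)[of n] x y(1)] unfolding f(2) by simp
      also have "\<dots> < sqrt (e\<^sup>2)" using y by (simp only: real_sqrt_less_iff) simp
      finally show "norm (Top a (f n) x - Top a (f n) y) < e" using e by simp
    qed (use e in auto)
  qed auto
  define h where "h s = (if s \<in> {- a..a} then h0 s else 0)" for s
  have h: "h \<in> supp_cont a"
  proof -
    have "continuous_on {- a..a} h" by (rule continuous_on_eq[OF h0]) (simp add: h_def)
    then show ?thesis by (auto simp: supp_cont_def h_def)
  qed
  \<comment> \<open>The residual \<open>r (k n)\<close> with \<open>Top a (f (k n))\<close> replaced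
    by its limit; the difference is \<open>\<sigma> * e n\<close>.\<close>
  define g where "g n s = l * f (k n) s + - \<sigma> * h s" for n s
  have g: "g n \<in> supp_cont a" for n unfolding g_def by (rule supp_cont_lin[OF f(1) h])
  define e where "e n s = 1 * Top a (f (k n)) s + (- 1) * h s" for n s
  have e: "e n \<in> supp_cont a" for n unfolding e_def by (rule supp_cont_lin[OF Tf h])
  have ptw: "(\<lambda>n. Top a (f (k n)) s) \<longlonglongrightarrow> h s" for s
  proof (cases "s \<in> {- a..a}")
    case True
    show ?thesis
    proof (rule LIMSEQ_I)
      fix \<epsilon> :: real assume "\<epsilon> > 0"
      from conv[OF this] show "\<exists>N. \<forall>n\<ge>N. norm (Top a (f (k n)) s - h s) < \<epsilon>"
        using True unfolding h_def by auto
    qed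
  next
    case False
    then show ?thesis by (simp only: Top_def h_def if_False) simp
  qed
  have ipe: "(\<lambda>n. ip (e n) (e n)) \<longlonglongrightarrow> 0"
  proof (rule LIMSEQ_I)
    fix \<epsilon> :: real assume \<epsilon>: "\<epsilon> > 0"
    define d where "d = sqrt (\<epsilon> / (4 * a))"
    have d: "d > 0" "d\<^sup>2 = \<epsilon> / (4 * a)" using \<epsilon> a by (auto simp: d_def)
    obtain N where N: "\<And>n x. n \<ge> N \<Longrightarrow> x \<in> {- a..a} \<Longrightarrow> norm (Top a (f (k n)) x - h0 x) < d"
      using conv[OF d(1)] by blast
    have "norm (ip (e n) (e n) - 0) < \<epsilon>" if n: "n \<ge> N" for n
    proof -
      have "ip (e n) (e n) \<le> 2 * a * d\<^sup>2"
      proof (rule ip_le_sup_bound[OF e a])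
        fix s assume s: "s \<in> {- a..a}"
        have "\<bar>e n s\<bar> \<le> d" using N[OF n s] s by (simp add: e_def h_def)
        then show "(e n s)\<^sup>2 \<le> d\<^sup>2" using abs_le_square_iff[of "e n s" d] d by simp
      qed
      also have "\<dots> = \<epsilon> / 2" unfolding d(2) using a by simp
      finally show ?thesis using \<epsilon> ip0[of "e n"] by (simp only: diff_zero real_norm_def abs_of_nonneg)
    qed
    then show "\<exists>N. \<forall>n\<ge>N. norm (ip (e n) (e n) - 0) < \<epsilon>" by blast
  qed
  have ipg: "(\<lambda>n. ip (g n) (g n)) \<longlonglongrightarrow> 0"
  proof (rule tendsto_sandwich[where f = "\<lambda>_. 0"])
    show "\<forall>\<^sub>F n in sequentially. ip (g n) (g n) \<le> 2 * ((l + sqrt a) * (1 / real (Suc n))) + 2 * ip (e n) (e n)"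
    proof (rule always_eventually, rule allI)
      fix n
      have "g n = (\<lambda>s. r (k n) s + \<sigma> * e n s)" by (auto simp: g_def r_def e_def algebra_simps)
      then have "ip (g n) (g n) \<le> 2 * ip (r (k n)) (r (k n)) + 2 * \<sigma>\<^sup>2 * ip (e n) (e n)"
        using ip_sum_le[OF r e] by simp
      moreover have "ip (r (k n)) (r (k n)) \<le> (l + sqrt a) * (1 / real (Suc n))"
      proof (rule order.trans[OF rb])
        have "n \<le> k n" using k by (rule strict_mono_imp_increasing)
        then show "(l + sqrt a) * (1 / real (Suc (k n))) \<le> (l + sqrt a) * (1 / real (Suc n))"
          using lpos a by (intro mult_left_mono divide_left_mono) auto
      qed
      ultimately show "ip (g n) (g n) \<le> 2 * ((l + sqrt a) * (1 / real (Suc n))) + 2 * ip (e n) (e n)"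
        unfolding \<sigma> by linarith
    qed
    have "(\<lambda>n. 1 / real (Suc n)) \<longlonglongrightarrow> 0" by real_asymp
    then have "(\<lambda>n. 2 * ((l + sqrt a) * (1 / real (Suc n))) + 2 * ip (e n) (e n)) \<longlonglongrightarrow> 2 * ((l + sqrt a) * 0) + 2 * 0"
      by (intro tendsto_intros ipe)
    then show "(\<lambda>n. 2 * ((l + sqrt a) * (1 / real (Suc n))) + 2 * ip (e n) (e n)) \<longlonglongrightarrow> 0" by simp
  qed auto
  have eig: "Top a h s = (\<sigma> * l) * h s" for s
  proof -
    have "(\<lambda>n. (Top a (g n) s)\<^sup>2) \<longlonglongrightarrow> 0"
    proof (rule tendsto_sandwich[where f = "\<lambda>_. 0"])
      show "\<forall>\<^sub>F n in sequentially. (Top a (g n) s)\<^sup>2 \<le> ip (g n) (g n) / 2"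
        by (intro always_eventually allI Top_square_le[OF g])
      show "(\<lambda>n. ip (g n) (g n) / 2) \<longlonglongrightarrow> 0" using tendsto_divide[OF ipg tendsto_const[of 2]] by simp
    qed auto
    moreover have "(\<lambda>n. (Top a (g n) s)\<^sup>2) \<longlonglongrightarrow> (l * h s + - \<sigma> * Top a h s)\<^sup>2"
      unfolding g_def Top_lin[OF f(1) h] by (intro tendsto_intros ptw)
    ultimately have "(l * h s + - \<sigma> * Top a h s)\<^sup>2 = 0" using LIMSEQ_unique by blast
    then have "\<sigma> * Top a h s = l * h s" by simp
    then have "\<sigma> * (\<sigma> * Top a h s) = \<sigma> * l * h s" by simp
    moreover have "\<sigma> * (\<sigma> * Top a h s) = \<sigma>\<^sup>2 * Top a h s" by (simp add: power2_eq_square)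
    ultimately show ?thesis using \<sigma> by simp
  qed
  \<comment> \<open>The limit is not zero: \<open>l * f (k n) = g n + \<sigma> * h\<close> has
    squared norm \<open>l^2\<close>, while \<open>g n\<close> tends to 0 in norm. This is where
    \<open>l > 0\<close> matters.\<close>
  have "l\<^sup>2 / 2 \<le> ip h h"
  proof (rule LIMSEQ_le_const[of "\<lambda>n. ip (g n) (g n) + ip h h"])
    have "(\<lambda>n. ip (g n) (g n) + ip h h) \<longlonglongrightarrow> 0 + ip h h" by (intro tendsto_intros ipg)
    then show "(\<lambda>n. ip (g n) (g n) + ip h h) \<longlonglongrightarrow> ip h h" by simp
    have "l\<^sup>2 / 2 \<le> ip (g n) (g n) + ip h h" for n
    proof -
      have lf: "l * f (k n) s = g n s + \<sigma> * h s" for s by (simp add: g_def)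
      have "ip (\<lambda>s. l * f (k n) s) (\<lambda>s. l * f (k n) s) \<le> 2 * ip (g n) (g n) + 2 * \<sigma>\<^sup>2 * ip h h"
        unfolding lf by (rule ip_sum_le[OF g h])
      moreover have "ip (\<lambda>s. l * f (k n) s) (\<lambda>s. l * f (k n) s) = (\<integral>s. l\<^sup>2 * (f (k n) s * f (k n) s) \<partial>lborel)"
        by (simp add: power2_eq_square mult_ac)
      moreover have "(\<integral>s. l\<^sup>2 * (f (k n) s * f (k n) s) \<partial>lborel) = l\<^sup>2 * ip (f (k n)) (f (k n))" by simp
      ultimately show ?thesis unfolding \<sigma> f(2) by linarith
    qed
    then show "\<exists>N. \<forall>n\<ge>N. l\<^sup>2 / 2 \<le> ip (g n) (g n) + ip h h" by blast
  qed
  moreover have "l\<^sup>2 / 2 > 0" using lpos by simp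
  ultimately have hpos: "ip h h > 0" by linarith
  have sl: "\<sigma> * (\<sigma> * l) = l" using \<sigma> by (simp add: power2_eq_square mult.assoc[symmetric])
  have "extremal_eigenpair a \<sigma> (\<sigma> * l) h"
    unfolding extremal_eigenpair_def sl using h hpos eig lpos ub by blast
  then show ?thesis by blast
qed

section \<open>The eigenvalue equation\<close>

lemma ip_pos:
  assumes h: "h \<in> supp_cont a" and x: "x \<in> {- a<..<a}" "h x \<noteq> 0"
  shows "ip h h > 0"
proof -
  have i: "integrable lborel (\<lambda>s. h s * h s)" by (rule supp_cont_ip_integrable(1)[OF h h])
  have "ip h h \<noteq> 0"
  proof
    assume "ip h h = 0"
    then have "AE s in lborel. h s * h s = 0"
      using i by (subst (asm) integral_nonneg_eq_0_iff_AE) auto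
    then have ae: "AE s in lborel. h s = 0" by simp
    have "continuous_on {- a<..<a} h"
      using h by (auto simp: supp_cont_def elim: continuous_on_subset)
    from continuous_AE_zero[OF this _ ae x(1)] x(2) show False by simp
  qed
  moreover have "ip h h \<ge> 0" by simp
  ultimately show ?thesis by linarith
qed

section \<open>Calculus of the primitive and the two directions of the eigenvalue equation\<close>

lemma prim_below:
  assumes g: "g \<in> supp_cont a" and x: "x \<le> - a"
  shows "prim g x = 0"
proof -
  have [measurable]: "g \<in> borel_measurable borel" using supp_cont_measurable[OF g] .
  have "prim g x = (\<integral>t. 0 \<partial>(lborel :: real measure))"
    unfolding prim_def
  proof (rule integral_cong_AE)
    show "AE t in lborel. indicator {..x} t * g t = 0"
      using AE_lborel_singleton[of "- a"]
    proof eventually_elim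
      case (elim t)
      then show ?case using g x by (cases "t \<le> x") (auto simp: supp_cont_def indicator_def)
    qed
  qed auto
  then show ?thesis by simp
qed

lemma prim_above:
  assumes g: "g \<in> supp_cont a" and x: "a \<le> x"
  shows "prim g x = prim g a"
proof -
  have "prim g x - prim g a = (\<integral>t. indicator {a<..x} t * g t \<partial>lborel)" by (rule prim_diff[OF g x])
  also have "\<dots> = (\<integral>t. 0 \<partial>(lborel :: real measure))"
    using g by (intro Bochner_Integration.integral_cong) (auto simp: supp_cont_def indicator_def)
  finally show ?thesis by simp
qed

lemma prim_has_derivative:
  assumes g: "g \<in> supp_cont a" and x: "x \<in> {- a..a}"
  shows "(prim g has_real_derivative g x) (at x within {- a..a})"
proof -
  have c: "continuous_on {- a..a} g" using g by (simp add: supp_cont_def)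
  have d: "((\<lambda>x. integral {- a..x} g) has_real_derivative g x) (at x within {- a..a})"
    by (rule integral_has_real_derivative[OF c x])
  have "integral {- a..y} g = prim g y" if y: "y \<in> {- a..a}" for y
  proof -
    have si: "set_integrable lborel {- a..y} g"
      using y by (intro borel_integrable_atLeastAtMost' continuous_on_subset[OF c]) auto
    have "integral {- a..y} g = (LBINT t:{- a..y}. g t)" using set_borel_integral_eq_integral(2)[OF si] by simp
    also have "\<dots> = prim g y"
      unfolding prim_def set_lebesgue_integral_def
      using g y by (intro Bochner_Integration.integral_cong) (auto simp: supp_cont_def indicator_def)
    finally show ?thesis .
  qed
  then show ?thesis
    by (intro has_field_derivative_transform_within[OF d zero_less_one x]) auto
qed

lemma prim_shift_has_derivative:
  assumes g: "g \<in> supp_cont a" and s: "s \<in> S" and S: "(\<lambda>x. x + c) ` S \<subseteq> {- a..a}"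
  shows "((\<lambda>x. prim g (x + c)) has_real_derivative g (s + c)) (at s within S)"
proof -
  have "(prim g has_real_derivative g (s + c)) (at (s + c) within (\<lambda>x. x + c) ` S)"
    using s S by (intro has_field_derivative_subset[OF prim_has_derivative[OF g] S]) auto
  moreover have "((\<lambda>x. x + c) has_real_derivative 1) (at s within S)" by (auto intro!: derivative_eq_intros)
  ultimately show ?thesis using DERIV_image_chain[of "prim g" "g (s + c)" "\<lambda>x. x + c" s S 1] by (simp add: o_def)
qed

lemma prim_increment:
  assumes g: "g \<in> supp_cont a" and xy: "x \<le> y" "- a \<le> x" "y \<le> a"
    and K: "\<And>t. t \<in> {x..y} \<Longrightarrow> (K has_real_derivative g t) (at t within {x..y})"
  shows "prim g y - prim g x = K y - K x"
proof -
  have "\<exists>c. \<forall>t\<in>{x..y}. prim g t - K t = c"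
  proof (rule has_field_derivative_zero_constant)
    fix t assume t: "t \<in> {x..y}"
    have "(prim g has_real_derivative g t) (at t within {x..y})"
      using prim_has_derivative[OF g, of t] t xy by (auto intro: has_field_derivative_subset)
    from DERIV_diff[OF this K[OF t]] show "((\<lambda>t. prim g t - K t) has_real_derivative 0) (at t within {x..y})" by simp
  qed auto
  then have "prim g x - K x = prim g y - K y" using xy by (metis atLeastAtMost_iff order_refl)
  then show ?thesis by simp
qed

text \<open>In terms of the half angle, with 1 written as \<open>C^2 + S^2\<close>, the equation
  factors as \<open>(C - S) * (2 * \<eta> * (C - S) - (\<eta> + 1 - a) * (C + S)) = 0\<close>. The
  factors are the matching conditions of odd and of even eigenfunctions.\<close>

lemma eta_eq_iff:
  fixes a \<eta> :: real
  assumes \<eta>: "\<eta> \<noteq> 0"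
  defines "C \<equiv> cos ((2 * a - 1) / (4 * \<eta>))" and "S \<equiv> sin ((2 * a - 1) / (4 * \<eta>))"
  shows "eta_eq (2 * a) \<eta> \<longleftrightarrow> C = S \<or> 2 * \<eta> * (C - S) = (\<eta> + 1 - a) * (C + S)"
proof -
  have two: "(2 * a - 1) / (2 * \<eta>) = 2 * ((2 * a - 1) / (4 * \<eta>))" using \<eta> by (simp add: field_simps)
  have cs: "C\<^sup>2 + S\<^sup>2 = 1" by (simp add: C_def S_def)
  have k: "1 / 2 + (2 - 2 * a) / (4 * \<eta>) = (\<eta> + 1 - a) / (2 * \<eta>)" using \<eta> by (simp add: field_simps)
  have "eta_eq (2 * a) \<eta> \<longleftrightarrow> (\<eta> + 1 - a) / (2 * \<eta>) * (C\<^sup>2 - S\<^sup>2) + 2 * S * C = 1"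
    unfolding eta_eq_def two cos_double sin_double k using \<eta> by (simp add: C_def S_def)
  also have "\<dots> \<longleftrightarrow> (\<eta> + 1 - a) / (2 * \<eta>) * (C\<^sup>2 - S\<^sup>2) + 2 * S * C = C\<^sup>2 + S\<^sup>2" by (simp only: cs)
  also have "\<dots> \<longleftrightarrow> (\<eta> + 1 - a) * (C\<^sup>2 - S\<^sup>2) + 2 * \<eta> * (2 * S * C) = 2 * \<eta> * (C\<^sup>2 + S\<^sup>2)"
    using \<eta> by (simp add: field_simps)
  also have "\<dots> \<longleftrightarrow> (C - S) * (2 * \<eta> * (C - S) - (\<eta> + 1 - a) * (C + S)) = 0"
    by (auto simp: power2_eq_square algebra_simps)
  finally show ?thesis by auto
qed

text \<open>Since \<open>a <= 1\<close>, every window leaves the interval: on both sides in the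
  middle zone, on one side in each outer zone. So \<open>h\<close> is constant in the middle, while
  the outer zones are coupled by the shift into a rotation. Three relations between the amplitudes
  \<open>A\<close>, \<open>B\<close> and the constant \<open>c\<close> remain, and a nonzero
  solution forces the equation.\<close>

lemma eigenvalue_imp_eta_eq:
  assumes a: "1 / 2 < a" "a \<le> 1" and h: "h \<in> supp_cont a" and pos: "ip h h > 0"
    and eig: "\<And>s. Top a h s = \<eta> * h s" and \<eta>: "\<eta> \<noteq> 0"
  shows "eta_eq (2 * a) \<eta>"
proof -
  define P where "P = prim h"
  define b where "b = a - 1 / 2"
  define w where "w = 1 / (2 * \<eta>)"
  have b: "b > 0" using a by (simp add: b_def)
  have mid: "\<eta> * h s = P a / 2" if "a - 1 \<le> s" "s \<le> 1 - a" for s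
    using eig[of s] that a prim_above[OF h, of "s + 1"] prim_below[OF h, of "s - 1"] by (simp add: Top_def P_def)
  have right: "\<eta> * h s = (P a - P (s - 1)) / 2" if "1 - a \<le> s" "s \<le> a" for s
    using eig[of s] that a prim_above[OF h, of "s + 1"] by (simp add: Top_def P_def)
  have left: "\<eta> * h s = P (s + 1) / 2" if "- a \<le> s" "s \<le> a - 1" for s
    using eig[of s] that a prim_below[OF h, of "s - 1"] by (simp add: Top_def P_def)
  define c where "c = P a / (2 * \<eta>)"
  have hc: "h s = c" if "a - 1 \<le> s" "s \<le> 1 - a" for s
    using mid[OF that] \<eta> by (simp add: c_def field_simps)
  \<comment> \<open>The shifts by 1/2 centre both outer zones at 0 with half-length
    \<open>b\<close>; there \<open>u' = - w * v\<close> and \<open>v' = w * u\<close>.\<close>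
  define u v where "u s = h (s + 1 / 2)" and "v s = h (s + - 1 / 2)" for s
  have ueq: "u s = w * (P a - P (s + - 1 / 2))" if "s \<in> {- b..b}" for s
    using right[of "s + 1 / 2"] that \<eta> by (simp add: u_def w_def b_def field_simps)
  have veq: "v s = w * P (s + 1 / 2)" if "s \<in> {- b..b}" for s
    using left[of "s + - 1 / 2"] that \<eta> by (simp add: v_def w_def b_def field_simps)
  have du: "(u has_real_derivative - w * v s) (at s within {- b..b})" if s: "s \<in> {- b..b}" for s
  proof -
    have d: "((\<lambda>x. P (x + - 1 / 2)) has_real_derivative v s) (at s within {- b..b})"
      unfolding P_def v_def using s a by (intro prim_shift_has_derivative[OF h]) (auto simp: b_def)
    have "((\<lambda>x. w * (P a - P (x + - 1 / 2))) has_real_derivative w * (0 - v s)) (at s within {- b..b})"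
      by (intro DERIV_cmult DERIV_diff d DERIV_const)
    from has_field_derivative_transform_within[OF this zero_less_one s, of u] show ?thesis
      using ueq by simp
  qed
  have dv: "(v has_real_derivative w * u s) (at s within {- b..b})" if s: "s \<in> {- b..b}" for s
  proof -
    have d: "((\<lambda>x. P (x + 1 / 2)) has_real_derivative u s) (at s within {- b..b})"
      unfolding P_def u_def using s a by (intro prim_shift_has_derivative[OF h]) (auto simp: b_def)
    have "((\<lambda>x. w * P (x + 1 / 2)) has_real_derivative w * u s) (at s within {- b..b})"
      by (intro DERIV_cmult d)
    from has_field_derivative_transform_within[OF this zero_less_one s, of v] show ?thesis
      using veq by simp
  qed
  \<comment> \<open>Rotating \<open>(u, v)\<close> back by the angle \<open>w * s\<close> leaves two
    constants.\<close>
  have "\<exists>A. \<forall>s\<in>{- b..b}. u s * cos (w * s) + v s * sin (w * s) = A"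
    by (rule has_field_derivative_zero_constant)
      (auto intro!: derivative_eq_intros du dv simp: algebra_simps)
  then obtain A where A: "\<And>s. s \<in> {- b..b} \<Longrightarrow> u s * cos (w * s) + v s * sin (w * s) = A" by blast
  have "\<exists>B. \<forall>s\<in>{- b..b}. v s * cos (w * s) - u s * sin (w * s) = B"
    by (rule has_field_derivative_zero_constant)
      (auto intro!: derivative_eq_intros du dv simp: algebra_simps)
  then obtain B where B: "\<And>s. s \<in> {- b..b} \<Longrightarrow> v s * cos (w * s) - u s * sin (w * s) = B" by blast
  have cs: "x * (cos y)\<^sup>2 + x * (sin y)\<^sup>2 = x" for x y :: real
    by (simp flip: distrib_left)
  have u: "u s = A * cos (w * s) - B * sin (w * s)" if s: "s \<in> {- b..b}" for s
    unfolding A[OF s, symmetric] B[OF s, symmetric] using cs[of "u s" "w * s"]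
    by (simp add: power2_eq_square algebra_simps)
  have v: "v s = A * sin (w * s) + B * cos (w * s)" if s: "s \<in> {- b..b}" for s
    unfolding A[OF s, symmetric] B[OF s, symmetric] using cs[of "v s" "w * s"]
    by (simp add: power2_eq_square algebra_simps)
  define C S where "C = cos (w * b)" and "S = sin (w * b)"
  have wb: "w * b = (2 * a - 1) / (4 * \<eta>)" using \<eta> by (simp add: w_def b_def field_simps)
  \<comment> \<open>Matching at the ends of the middle zone: \<open>u (- b) = h (1 - a)\<close> here
    and \<open>v b = h (a - 1)\<close> in \<open>e2\<close> both equal \<open>c\<close>.\<close>
  have e1: "A * C + B * S = c"
    using u[of "- b"] b hc[of "1 - a"] a by (simp add: C_def S_def u_def) (simp add: b_def)
  have e2: "A * S + B * C = c"
    using v[of b] b hc[of "a - 1"] a by (simp add: C_def S_def v_def) (simp add: b_def)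
  have Pm: "P (1 - a) - P (a - 1) = 2 * (1 - a) * c"
  proof -
    have "prim h (1 - a) - prim h (a - 1) = c * (1 - a) - c * (a - 1)"
    proof (rule prim_increment[OF h])
      fix t assume "t \<in> {a - 1..1 - a}"
      then show "((\<lambda>t. c * t) has_real_derivative h t) (at t within {a - 1..1 - a})"
        using hc[of t] by (auto intro!: derivative_eq_intros)
    qed (use a in auto)
    then show ?thesis by (simp add: P_def algebra_simps)
  qed
  \<comment> \<open>The sum of the eigenvalue equations at \<open>a\<close> and \<open>- a\<close>:
    the two windows together cover the interval and count the middle zone, where
    \<open>h = c\<close>, twice.\<close>
  have e3: "\<eta> * ((A + B) * (C - S)) = (\<eta> + 1 - a) * c"
  proof -
    have "\<eta> * u b = (P a - P (a - 1)) / 2" using right[of a] a by (simp add: u_def b_def)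
    moreover have "\<eta> * v (- b) = P (1 - a) / 2" using left[of "- a"] a by (simp add: v_def b_def)
    ultimately have "\<eta> * (u b + v (- b)) = (P a + (P (1 - a) - P (a - 1))) / 2" by (simp add: field_simps)
    also have "\<dots> = (\<eta> + 1 - a) * c" unfolding Pm using \<eta> by (simp add: c_def field_simps)
    also have "u b + v (- b) = (A + B) * (C - S)"
      using u[of b] v[of "- b"] b by (simp add: C_def S_def algebra_simps)
    finally show ?thesis .
  qed
  have "C = S \<or> 2 * \<eta> * (C - S) = (\<eta> + 1 - a) * (C + S)"
  proof (cases "C = S")
    case False
    have "(A - B) * (C - S) = 0" using e1 e2 by (simp add: algebra_simps)
    then have AB: "A = B" using False by simp
    have "A \<noteq> 0"
    proof
      assume A0: "A = 0"
      have c0: "c = 0" using e1 A0 AB by simp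
      have "h s = 0" for s
      proof (cases "s \<in> {- a..a}")
        case True
        then consider "s \<le> a - 1" | "1 - a \<le> s" | "a - 1 \<le> s" "s \<le> 1 - a" by linarith
        then show ?thesis
        proof cases
          case 1
          then show ?thesis using v[of "s + 1 / 2"] True A0 AB by (simp add: v_def b_def)
        next
          case 2
          then show ?thesis using u[of "s - 1 / 2"] True A0 AB by (simp add: u_def b_def)
        next
          case 3
          then show ?thesis using hc c0 by simp
        qed
      next
        case False
        then show ?thesis using h by (simp add: supp_cont_def)
      qed
      then show False using pos by simp
    qed
    moreover have "A * (2 * \<eta> * (C - S)) = A * ((\<eta> + 1 - a) * (C + S))"
    proof -
      have "A * (2 * \<eta> * (C - S)) = \<eta> * ((A + B) * (C - S))" unfolding AB by (simp add: algebra_simps)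
      also have "\<dots> = (\<eta> + 1 - a) * (A * C + B * S)" unfolding e3 e1 ..
      also have "\<dots> = A * ((\<eta> + 1 - a) * (C + S))" unfolding AB by (simp add: algebra_simps)
      finally show ?thesis .
    qed
    ultimately show ?thesis by simp
  qed simp
  then show ?thesis unfolding eta_eq_iff[OF \<eta>] C_def S_def wb .
qed

text \<open>Reverses the preceding argument: rotating solutions on the outer zones are glued to a
  constant in the middle, and each alternative of \<open>eta_eq_iff\<close> makes all three
  relations hold.\<close>

lemma eta_eq_imp_eigenvalue:
  assumes a: "1 / 2 < a" "a \<le> 1" and eq: "eta_eq (2 * a) \<eta>"
  obtains h where "h \<in> supp_cont a" "ip h h > 0" "\<And>s. Top a h s = \<eta> * h s"
proof -
  have \<eta>: "\<eta> \<noteq> 0" using eq by (simp add: eta_eq_def)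
  define b where "b = a - 1 / 2"
  define w where "w = 1 / (2 * \<eta>)"
  define C S where "C = cos (w * b)" and "S = sin (w * b)"
  have wb: "w * b = (2 * a - 1) / (4 * \<eta>)" using \<eta> by (simp add: w_def b_def field_simps)
  have CS: "C = S \<or> 2 * \<eta> * (C - S) = (\<eta> + 1 - a) * (C + S)"
    using eq unfolding eta_eq_iff[OF \<eta>] C_def S_def wb .
  (* The two alternatives give the odd and the even eigenfunctions. *)
  define B c where "B = (if C = S then - 1 else 1 :: real)" and "c = (if C = S then 0 else C + S)"
  have e1: "C + B * S = c" and e2: "S + B * C = c" and e3: "\<eta> * ((1 + B) * (C - S)) = (\<eta> + 1 - a) * c"
    using CS by (auto simp: B_def c_def algebra_simps)
  define U V where "U x = cos (w * x) - B * sin (w * x)" and "V x = sin (w * x) + B * cos (w * x)" for x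
  have dU: "(U has_real_derivative - w * V x) (at x within X)" for x X
    unfolding U_def V_def by (auto intro!: derivative_eq_intros simp: algebra_simps)
  have dV: "(V has_real_derivative w * U x) (at x within X)" for x X
    unfolding U_def V_def by (auto intro!: derivative_eq_intros simp: algebra_simps)
  have Ub: "U (- b) = c" "U b = C - B * S" using e1 by (auto simp: U_def C_def S_def)
  have Vb: "V b = c" "V (- b) = B * C - S" using e2 by (auto simp: V_def C_def S_def)
  have U0: "U 0 = 1" by (simp add: U_def)
  \<comment> \<open>One formula for all three zones: outside its own zone each clamped term equals
    \<open>c\<close>, because \<open>U (- b) = c\<close> and \<open>V b = c\<close>, and one copy of
    \<open>c\<close> is subtracted. Continuity is then immediate.\<close>
  define h where "h s = (if s \<in> {- a..a} then U (max s (1 - a) - 1 / 2) + V (min s (a - 1) + 1 / 2) - c else 0)" for s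
  have h: "h \<in> supp_cont a"
  proof -
    have "continuous_on {- a..a} (\<lambda>s. U (max s (1 - a) - 1 / 2) + V (min s (a - 1) + 1 / 2) - c)"
      unfolding U_def V_def by (intro continuous_intros)
    then have "continuous_on {- a..a} h" by (rule continuous_on_eq) (simp add: h_def)
    then show ?thesis by (auto simp: supp_cont_def h_def)
  qed
  have hr: "h s = U (s - 1 / 2)" if "1 - a \<le> s" "s \<le> a" for s
  proof -
    have "min s (a - 1) + 1 / 2 = b" "max s (1 - a) = s" "s \<in> {- a..a}" using that a by (auto simp: b_def)
    then show ?thesis using Vb by (simp add: h_def)
  qed
  have hl: "h s = V (s + 1 / 2)" if "- a \<le> s" "s \<le> a - 1" for s
  proof -
    have "max s (1 - a) - 1 / 2 = - b" "min s (a - 1) = s" "s \<in> {- a..a}" using that a by (auto simp: b_def)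
    then show ?thesis using Ub by (simp add: h_def)
  qed
  have hm: "h s = c" if "a - 1 \<le> s" "s \<le> 1 - a" for s
  proof -
    have "max s (1 - a) - 1 / 2 = - b" "min s (a - 1) + 1 / 2 = b" "s \<in> {- a..a}" using that a by (auto simp: b_def)
    then show ?thesis using Ub Vb by (simp add: h_def)
  qed
  define P where "P = prim h"
  have w2: "2 * \<eta> * w = 1" using \<eta> by (simp add: w_def)
  \<comment> \<open>As \<open>2 * \<eta> * w = 1\<close>, the function
    \<open>- 2 * \<eta> * U\<close> is a primitive of \<open>V\<close>, and
    \<open>2 * \<eta> * V\<close> one of \<open>U\<close>.\<close>
  have Pl: "P x = - 2 * \<eta> * (U (x + 1 / 2) - c)" if x: "- a \<le> x" "x \<le> a - 1" for x
  proof -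
    have "P x - P (- a) = - 2 * \<eta> * U (x + 1 / 2) - - 2 * \<eta> * U (- a + 1 / 2)"
      unfolding P_def
    proof (rule prim_increment[OF h])
      fix t assume t: "t \<in> {- a..x}"
      have "((\<lambda>x. - 2 * \<eta> * U (x + 1 / 2)) has_real_derivative - 2 * \<eta> * (- w * V (t + 1 / 2) * 1)) (at t within {- a..x})"
        by (intro DERIV_cmult DERIV_chain2[OF dU]) (auto intro!: derivative_eq_intros)
      moreover have "- 2 * \<eta> * (- w * V (t + 1 / 2) * 1) = h t"
        using hl[of t] t x w2 by (simp add: mult.assoc[symmetric])
      ultimately show "((\<lambda>x. - 2 * \<eta> * U (x + 1 / 2)) has_real_derivative h t) (at t within {- a..x})" by simp
    qed (use x a in auto)
    moreover have "P (- a) = 0" unfolding P_def by (rule prim_below[OF h]) simp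
    moreover have "U (- a + 1 / 2) = c" using Ub by (simp add: b_def)
    ultimately show ?thesis by (simp add: algebra_simps)
  qed
  have Pm: "P (1 - a) = P (a - 1) + 2 * (1 - a) * c"
  proof -
    have "prim h (1 - a) - prim h (a - 1) = c * (1 - a) - c * (a - 1)"
    proof (rule prim_increment[OF h])
      fix t assume "t \<in> {a - 1..1 - a}"
      then show "((\<lambda>t. c * t) has_real_derivative h t) (at t within {a - 1..1 - a})"
        using hm[of t] by (auto intro!: derivative_eq_intros)
    qed (use a in auto)
    then show ?thesis by (simp add: P_def algebra_simps)
  qed
  \<comment> \<open>The place of \<open>e3\<close>: it makes the primitive accumulated from the left
    take the value required at the start of the right zone.\<close>
  have P1: "P (1 - a) = 2 * \<eta> * V (- b)"
  proof -
    have "P (a - 1) = - 2 * \<eta> * (U b - c)" using Pl[of "a - 1"] a by (simp add: b_def)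
    then show ?thesis unfolding Pm Ub Vb using e3 by (simp add: algebra_simps)
  qed
  have Pr: "P x = 2 * \<eta> * V (x - 1 / 2)" if x: "1 - a \<le> x" "x \<le> a" for x
  proof -
    have "P x - P (1 - a) = 2 * \<eta> * V (x - 1 / 2) - 2 * \<eta> * V (1 - a - 1 / 2)"
      unfolding P_def
    proof (rule prim_increment[OF h])
      fix t assume t: "t \<in> {1 - a..x}"
      have "((\<lambda>x. 2 * \<eta> * V (x - 1 / 2)) has_real_derivative 2 * \<eta> * (w * U (t - 1 / 2) * 1)) (at t within {1 - a..x})"
        by (intro DERIV_cmult DERIV_chain2[OF dV]) (auto intro!: derivative_eq_intros)
      moreover have "2 * \<eta> * (w * U (t - 1 / 2) * 1) = h t"
        using hr[of t] t x w2 by (simp add: mult.assoc[symmetric])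
      ultimately show "((\<lambda>x. 2 * \<eta> * V (x - 1 / 2)) has_real_derivative h t) (at t within {1 - a..x})" by simp
    qed (use x a in auto)
    moreover have "1 - a - 1 / 2 = - b" by (simp add: b_def)
    ultimately show ?thesis using P1 by simp
  qed
  have Pa: "P a = 2 * \<eta> * c" using Pr[of a] a Vb by (simp add: b_def)
  have eig: "Top a h s = \<eta> * h s" for s
  proof (cases "s \<in> {- a..a}")
    case True
    then consider "s \<le> a - 1" | "1 - a \<le> s" | "a - 1 \<le> s" "s \<le> 1 - a" by linarith
    then show ?thesis
    proof cases
      case 1
      have "P (s - 1) = 0" "P (s + 1) = 2 * \<eta> * V (s + 1 / 2)"
        using prim_below[OF h, of "s - 1"] Pr[of "s + 1"] 1 True a by (auto simp: P_def add.commute)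
      then show ?thesis using True hl[of s] 1 by (simp add: Top_def P_def)
    next
      case 2
      have "P (s + 1) = P a" "P (s - 1) = - 2 * \<eta> * (U (s - 1 / 2) - c)"
        using prim_above[OF h, of "s + 1"] Pl[of "s - 1"] 2 True a by (auto simp: P_def)
      then show ?thesis using True hr[of s] 2 Pa by (simp add: Top_def P_def algebra_simps)
    next
      case 3
      have "P (s + 1) = P a" "P (s - 1) = 0"
        using prim_above[OF h, of "s + 1"] prim_below[OF h, of "s - 1"] 3 True a by (auto simp: P_def)
      then show ?thesis using True hm[of s] 3 Pa by (simp add: Top_def P_def)
    qed
  qed (auto simp: Top_def h_def)
  have "h (1 / 2) = 1" using hr[of "1 / 2"] a U0 by simp
  then have "ip h h > 0" using a by (intro ip_pos[OF h, of "1 / 2"]) auto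
  then show thesis using that h eig by blast
qed

section \<open>The extremal constants\<close>

lemma ip_eq_integral_square: "ip f f = (\<integral>s. (f s)\<^sup>2 \<partial>lborel)"
  by (simp add: power2_eq_square)

lemma qform_eigenfunction:
  assumes h: "h \<in> supp_cont a" and eig: "\<And>s. Top a h s = \<eta> * h s"
  shows "qform h = \<eta> * ip h h"
  unfolding qform_eq_ip_Top[OF h] eig by (simp add: mult.left_commute)

text \<open>Every solution comes with an eigenfunction whose Rayleigh quotient it is, so the extreme
  value of the form bounds all solutions on its side.\<close>

lemma extremal_eigenpair_eta_eq:
  assumes a: "1 / 2 < a" "a \<le> 1" and E: "extremal_eigenpair a \<sigma> \<eta> h"
  shows "eta_eq (2 * a) \<eta>" "\<And>\<eta>'. eta_eq (2 * a) \<eta>' \<Longrightarrow> \<sigma> * \<eta>' \<le> \<sigma> * \<eta>"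
proof -
  note E' = E[unfolded extremal_eigenpair_def]
  have h: "h \<in> supp_cont a" "ip h h > 0" "\<And>s. Top a h s = \<eta> * h s" and pos: "\<sigma> * \<eta> > 0"
    and ub: "\<And>f. f \<in> supp_cont a \<Longrightarrow> \<sigma> * qform f \<le> \<sigma> * \<eta> * ip f f"
    using E' by auto
  have "\<eta> \<noteq> 0" using pos by auto
  then show "eta_eq (2 * a) \<eta>" by (rule eigenvalue_imp_eta_eq[OF a h])
  fix \<eta>' assume \<eta>': "eta_eq (2 * a) \<eta>'"
  obtain g where g: "g \<in> supp_cont a" "ip g g > 0" "\<And>s. Top a g s = \<eta>' * g s"
    using eta_eq_imp_eigenvalue[OF a \<eta>'] by blast
  have "(\<sigma> * \<eta>') * ip g g \<le> (\<sigma> * \<eta>) * ip g g"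
    using ub[OF g(1)] qform_eigenfunction[OF g(1,3)] by (simp add: mult.assoc)
  then show "\<sigma> * \<eta>' \<le> \<sigma> * \<eta>" using g(2) by (simp only: mult_le_cancel_right_pos)
qed

lemma extremal_eigenpair_of_eta_eq:
  assumes a: "1 / 2 < a" "a \<le> 1" and \<sigma>: "\<sigma>\<^sup>2 = (1::real)"
    and \<eta>0: "eta_eq (2 * a) \<eta>0" "\<sigma> * \<eta>0 > 0"
  shows "\<exists>\<eta> h. extremal_eigenpair a \<sigma> \<eta> h"
proof -
  obtain h0 where h0: "h0 \<in> supp_cont a" "ip h0 h0 > 0" "\<And>s. Top a h0 s = \<eta>0 * h0 s"
    using eta_eq_imp_eigenvalue[OF a \<eta>0(1)] by blast
  have "\<sigma> * qform h0 > 0"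
    unfolding qform_eigenfunction[OF h0(1,3)] using h0(2) \<eta>0(2) by (simp add: mult.assoc[symmetric])
  then show ?thesis using a h0(1) \<sigma> by (intro extremal_eigenpair_exists) auto
qed

text \<open>The support has length at most 1, so each window centred in it covers all of it and
  \<open>Top a f\<close> is constant there.\<close>

lemma qform_small_support:
  assumes f: "f \<in> supp_cont a" and a: "0 < a" "a \<le> 1 / 2"
  shows "qform f = (prim f a)\<^sup>2 / 2"
proof -
  have T: "f s * Top a f s = f s * (prim f a / 2)" for s
  proof (cases "s \<in> {- a..a}")
    case True
    then show ?thesis using a prim_above[OF f, of "s + 1"] prim_below[OF f, of "s - 1"] by (simp add: Top_def)
  next
    case False
    then show ?thesis using f by (simp add: supp_cont_def)
  qed
  have "prim f a = (\<integral>s. f s \<partial>lborel)"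
    unfolding prim_def using f by (intro Bochner_Integration.integral_cong) (auto simp: supp_cont_def indicator_def)
  then have "qform f = prim f a * (prim f a / 2)"
    unfolding qform_eq_ip_Top[OF f] T by simp
  then show ?thesis by (simp add: power2_eq_square)
qed

lemma constants_small_Delta:
  assumes \<Delta>: "0 < \<Delta>" "\<Delta> \<le> 1"
  shows "C_minus \<Delta> = 1" "C_plus \<Delta> = sqrt (1 + \<Delta> / 2)"
proof -
  define a where "a = \<Delta> / 2"
  have a: "0 < a" "a \<le> 1 / 2" using \<Delta> by (auto simp: a_def)
  \<comment> \<open>\<open>f\<close> has integral 0 and attains the lower value 0; the constant
    \<open>g\<close> gives equality in Cauchy-Schwarz and attains \<open>a\<close>.\<close>
  define f g :: "real \<Rightarrow> real" where "f s = indicator {- a..a} s * s" and "g s = indicator {- a..a} s" for s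
  have f: "f \<in> supp_cont a"
  proof -
    have "continuous_on {- a..a} f" by (rule continuous_on_eq[OF continuous_on_id]) (simp add: f_def)
    then show ?thesis by (simp add: supp_cont_def f_def)
  qed
  have g: "g \<in> supp_cont a"
  proof -
    have "continuous_on {- a..a} g" by (rule continuous_on_eq[OF continuous_on_const[of _ 1]]) (simp add: g_def)
    then show ?thesis by (simp add: supp_cont_def g_def)
  qed
  have "prim f a - prim f (- a) = a\<^sup>2 / 2 - (- a)\<^sup>2 / 2"
  proof (rule prim_increment[OF f])
    fix t assume "t \<in> {- a..a}"
    then show "((\<lambda>t. t\<^sup>2 / 2) has_real_derivative f t) (at t within {- a..a})"
      by (auto intro!: derivative_eq_intros simp: f_def)
  qed (use a in auto)
  then have "prim f a = 0" using prim_below[OF f, of "- a"] by simp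
  then have qf: "qform f = 0 * (\<integral>s. (f s)\<^sup>2 \<partial>lborel)" using qform_small_support[OF f a] by simp
  have pf: "(\<integral>s. (f s)\<^sup>2 \<partial>lborel) > 0"
    using ip_pos[OF f, of "a / 2"] a by (simp add: f_def power2_eq_square)
  have "prim g a - prim g (- a) = a - - a"
  proof (rule prim_increment[OF g])
    fix t assume "t \<in> {- a..a}"
    then show "((\<lambda>t. t) has_real_derivative g t) (at t within {- a..a})"
      by (auto intro!: derivative_eq_intros simp: g_def)
  qed (use a in auto)
  then have "prim g a = 2 * a" using prim_below[OF g, of "- a"] by simp
  moreover have ig: "(\<integral>s. (g s)\<^sup>2 \<partial>lborel) = 2 * a"
  proof -
    have "(\<lambda>s. (g s)\<^sup>2) = indicator {- a..a}" by (auto simp: g_def indicator_def)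
    then show ?thesis using a by simp
  qed
  ultimately have qg: "qform g = a * (\<integral>s. (g s)\<^sup>2 \<partial>lborel)"
    using qform_small_support[OF g a] by (simp add: power2_eq_square)
  have "(\<integral>s. (g s)\<^sup>2 \<partial>lborel) > 0" using ig a by simp
  moreover have "0 * (\<integral>s. (h s)\<^sup>2 \<partial>lborel) \<le> qform h" if "h \<in> supp_cont a" for h
    unfolding qform_small_support[OF that a] by simp
  moreover have "qform h \<le> a * (\<integral>s. (h s)\<^sup>2 \<partial>lborel)" if h: "h \<in> supp_cont a" for h
    using qform_small_support[OF h a] prim_diff_square_le[OF h, of a "- a"] prim_below[OF h, of "- a"] a
    by (simp add: power2_eq_square)
  ultimately have "C_minus \<Delta> = sqrt (1 + 0)" "C_plus \<Delta> = sqrt (1 + a)"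
    using C_minus_C_plus_eq[OF \<Delta>(1), of 0 a f g, folded a_def] f g pf qf qg by blast+
  then show "C_minus \<Delta> = 1" "C_plus \<Delta> = sqrt (1 + \<Delta> / 2)" by (auto simp: a_def)
qed

lemma constants_large_Delta:
  assumes \<Delta>: "1 < \<Delta>" "\<Delta> \<le> 2"
  shows "\<exists>\<eta>p \<eta>m. eta_eq \<Delta> \<eta>p \<and> (\<forall>\<eta>. eta_eq \<Delta> \<eta> \<longrightarrow> \<eta> \<le> \<eta>p)
                   \<and> eta_eq \<Delta> \<eta>m \<and> (\<forall>\<eta>. eta_eq \<Delta> \<eta> \<longrightarrow> \<eta>m \<le> \<eta>)
                   \<and> C_minus \<Delta> = sqrt (1 + \<eta>m) \<and> C_plus \<Delta> = sqrt (1 + \<eta>p)"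
proof -
  define a where "a = \<Delta> / 2"
  have a: "1 / 2 < a" "a \<le> 1" and \<Delta>a: "\<Delta> = 2 * a" using \<Delta> by (auto simp: a_def)
  \<comment> \<open>At the angles \<open>pi / 2\<close> and \<open>- (3 * pi / 2)\<close> the cosine
    vanishes and the sine is 1, so the equation holds whatever its coefficient. The corresponding
    solutions \<open>(\<Delta> - 1) / pi\<close> and \<open>- (\<Delta> - 1) / (3 * pi)\<close> show
    that the form takes both signs.\<close>
  have cs: "cos (3 * pi / 2) = 0" "sin (3 * pi / 2) = - 1"
    using cos_3over2_pi sin_3over2_pi by (simp_all add: mult.commute)
  have x1: "(\<Delta> - 1) / (2 * ((\<Delta> - 1) / pi)) = pi / 2"
  proof -
    have "x / (2 * (x / pi)) = pi / 2" if "x \<noteq> 0" for x :: real using that by simp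
    from this[of "\<Delta> - 1"] \<Delta> show ?thesis by simp
  qed
  have e1: "eta_eq (2 * a) ((\<Delta> - 1) / pi)" unfolding eta_eq_def \<Delta>a[symmetric] x1 using \<Delta> by simp
  have x2: "(\<Delta> - 1) / (2 * (- (\<Delta> - 1) / (3 * pi))) = - (3 * pi / 2)"
  proof -
    have "x / (2 * (- x / (3 * pi))) = - (3 * pi / 2)" if "x \<noteq> 0" for x :: real
      using that by (simp add: field_simps)
    from this[of "\<Delta> - 1"] \<Delta> show ?thesis by simp
  qed
  have e2: "eta_eq (2 * a) (- (\<Delta> - 1) / (3 * pi))"
    unfolding eta_eq_def \<Delta>a[symmetric] x2 cos_minus sin_minus cs using \<Delta> by simp
  obtain \<eta>p g where p: "extremal_eigenpair a 1 \<eta>p g"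
    using extremal_eigenpair_of_eta_eq[OF a _ e1, of 1] \<Delta> by auto
  obtain \<eta>m f where m: "extremal_eigenpair a (- 1) \<eta>m f"
    using extremal_eigenpair_of_eta_eq[OF a _ e2, of "- 1"] \<Delta> by (auto simp: divide_less_0_iff)
  note p' = p[unfolded extremal_eigenpair_def] and m' = m[unfolded extremal_eigenpair_def]
  have "\<eta>m * ip h h \<le> qform h" "qform h \<le> \<eta>p * ip h h" if "h \<in> supp_cont a" for h
    using p' m' that by auto
  moreover have "qform g = \<eta>p * ip g g" "qform f = \<eta>m * ip f f"
    using p' m' by (auto intro: qform_eigenfunction)
  ultimately have "C_minus \<Delta> = sqrt (1 + \<eta>m)" "C_plus \<Delta> = sqrt (1 + \<eta>p)"
    using C_minus_C_plus_eq[of \<Delta> \<eta>m \<eta>p f g, folded a_def ip_eq_integral_square] \<Delta> p' m' by auto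
  moreover note extremal_eigenpair_eta_eq[OF a p] extremal_eigenpair_eta_eq[OF a m]
  ultimately show ?thesis unfolding \<Delta>a by (intro exI[of _ \<eta>p] exI[of _ \<eta>m]) auto
qed

theorem theorem16:
  shows "(\<forall>\<Delta>::real. 0 < \<Delta> \<and> \<Delta> \<le> 1 \<longrightarrow>
            C_minus \<Delta> = 1 \<and> C_plus \<Delta> = sqrt (1 + \<Delta> / 2))
       \<and> (\<forall>\<Delta>::real. 1 < \<Delta> \<and> \<Delta> \<le> 2 \<longrightarrow>
            (\<exists>\<eta>p \<eta>m. eta_eq \<Delta> \<eta>p \<and> (\<forall>\<eta>. eta_eq \<Delta> \<eta> \<longrightarrow> \<eta> \<le> \<eta>p)
                   \<and> eta_eq \<Delta> \<eta>m \<and> (\<forall>\<eta>. eta_eq \<Delta> \<eta> \<longrightarrow> \<eta>m \<le> \<eta>)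
                   \<and> C_minus \<Delta> = sqrt (1 + \<eta>m) \<and> C_plus \<Delta> = sqrt (1 + \<eta>p)))"
  using constants_small_Delta constants_large_Delta by blast

end
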